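(* Let $d=2$ and let $u\in H^1_D(\Omega)$ be the (weak) solution of the diffusion problem $-\nabla\cdot(A\nabla u)=f$ in $\Omega$, $u=0$ on $\Gamma_D$, $-A\nabla u\cdot\mathbf n=g$ on $\Gamma_N$. Then for all $w\in H^1(\mathcal T)$, $$\|A^{1/2}\nabla_h(u-w)\|^2= \inf_{\boldsymbol\tau\in\Sigma_f(\Omega)}\|A^{-1/2}\boldsymbol\tau+A^{1/2}\nabla_h w\|^2+\inf_{v\in H^1_D(\Omega)}\|A^{1/2}\nabla_h(v-w)\|^2 .$$
   Context: $\Omega\subset\mathbb R^2$ is a bounded polygonal domain with Lipschitz boundary $\partial\Omega=\overline\Gamma_D\cup\overline\Gamma_N$, $\overline\Gamma_D\cap\overline\Gamma_N=\emptyset$, $\mathrm{meas}_{1}(\Gamma_D)\ne0$; $\mathbf n$ is the outward unit normal. $f\in L^2(\Omega)$, $g\in H^{-1/2}(\Gamma_N)$. $A(x)$ is a symmetric, positive definite full tensor, piecewise constant with respect to $\overline\Omega=\cup_{i=1}^n\overline\Omega_i$, with $\Omega_i$ open and polygonal. $H^1_D(\Omega)=\{v\in H^1(\Omega): v=0 \text{ on }\Gamma_D\}$. The weak solution $u\in H_D^1(\Omega)$ satisfies $(A\nabla u,\nabla v)=(f,v)-\langle g,v\rangle_{\Gamma_N}$ for all $v\in H^1_D(\Omega)$, where $(\cdot,\cdot)$ is the $L^2(\Omega)$ inner product and $\|\cdot\|$ the $L^2(\Omega)$ norm. $\mathcal T$ is a regular finite element partition of $\Omega$ such that the interfaces $\partial\Omega_i\cap\partial\Omega_j$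 ($i\neq j$) do not cut through any element. $H^1(\mathcal T)=\{v\in L^2(\Omega): v|_K\in H^1(K)\ \forall K\in\mathcal T\}$, and $(\nabla_h v)|_K=\nabla(v|_K)$ for all $K\in\mathcal T$. $H(\mathrm{div};\Omega)$ is the space of $L^2(\Omega)^2$ vector fields with divergence in $L^2(\Omega)$, and $\Sigma_f(\Omega)=\{\boldsymbol\tau\in H(\mathrm{div};\Omega):\nabla\cdot\boldsymbol\tau=f\text{ in }\Omega,\ \boldsymbol\tau\cdot\mathbf n=g\text{ on }\Gamma_N\}$. *)

theory Defs
  imports "HOL-Analysis.Analysis"
begin

section \<open>Square-integrable functions\<close>

text \<open>Functions are used as representatives of their almost-everywhere classes.\<close>

definition L2 :: "'a measure \<Rightarrow> ('a \<Rightarrow> 'b::euclidean_space) set" where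
  "L2 M = {v. v \<in> borel_measurable M \<and> integrable M (\<lambda>x. (norm (v x))\<^sup>2)}"

definition L2_inner :: "'a measure \<Rightarrow> ('a \<Rightarrow> 'b::euclidean_space) \<Rightarrow> ('a \<Rightarrow> 'b) \<Rightarrow> real" where
  "L2_inner M v w = (LINT x|M. v x \<bullet> w x)"

definition L2_norm :: "'a measure \<Rightarrow> ('a \<Rightarrow> 'b::euclidean_space) \<Rightarrow> real" where
  "L2_norm M v = sqrt (LINT x|M. (norm (v x))\<^sup>2)"


section \<open>Smooth functions, weak derivatives and the spaces \<open>H\<^sup>1\<close> and \<open>H(div)\<close>\<close>

definition grad :: "(real^2 \<Rightarrow> real) \<Rightarrow> real^2 \<Rightarrow> real^2" where
  "grad \<phi> x = (\<chi> i. frechet_derivative \<phi> (at x) (axis i 1))"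

primrec Ck :: "nat \<Rightarrow> (real^2 \<Rightarrow> real) \<Rightarrow> bool" where
  "Ck 0 \<phi> \<longleftrightarrow> continuous_on UNIV \<phi>"
| "Ck (Suc k) \<phi> \<longleftrightarrow> (\<forall>x. \<phi> differentiable (at x)) \<and> (\<forall>i. Ck k (\<lambda>x. grad \<phi> x $ i))"

definition smooth :: "(real^2 \<Rightarrow> real) \<Rightarrow> bool" where
  "smooth \<phi> \<longleftrightarrow> (\<forall>k. Ck k \<phi>)"

definition test_functions :: "(real^2) set \<Rightarrow> (real^2 \<Rightarrow> real) set" where
  "test_functions \<Omega> =
     {\<phi>. smooth \<phi> \<and> compact (closure {x. \<phi> x \<noteq> 0}) \<and> closure {x. \<phi> x \<noteq> 0} \<subseteq> \<Omega>}"

definition is_weak_grad :: "(real^2) set \<Rightarrow> (real^2 \<Rightarrow> real) \<Rightarrow> (real^2 \<Rightarrow> real^2) \<Rightarrow> bool" where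
  "is_weak_grad \<Omega> v G \<longleftrightarrow>
     (\<forall>\<phi>\<in>test_functions \<Omega>.
        (LINT x|lebesgue_on \<Omega>. v x *\<^sub>R grad \<phi> x) = - (LINT x|lebesgue_on \<Omega>. \<phi> x *\<^sub>R G x))"

definition is_weak_div :: "(real^2) set \<Rightarrow> (real^2 \<Rightarrow> real^2) \<Rightarrow> (real^2 \<Rightarrow> real) \<Rightarrow> bool" where
  "is_weak_div \<Omega> \<tau> d \<longleftrightarrow>
     (\<forall>\<phi>\<in>test_functions \<Omega>.
        (LINT x|lebesgue_on \<Omega>. \<tau> x \<bullet> grad \<phi> x) = - (LINT x|lebesgue_on \<Omega>. \<phi> x * d x))"

text \<open>The weak gradient and divergence are unique up to null sets of \<open>\<Omega>\<close>; the operators below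
  pick a representative.\<close>

definition wgrad :: "(real^2) set \<Rightarrow> (real^2 \<Rightarrow> real) \<Rightarrow> real^2 \<Rightarrow> real^2" where
  "wgrad \<Omega> v = (SOME G. G \<in> L2 (lebesgue_on \<Omega>) \<and> is_weak_grad \<Omega> v G)"

definition wdiv :: "(real^2) set \<Rightarrow> (real^2 \<Rightarrow> real^2) \<Rightarrow> real^2 \<Rightarrow> real" where
  "wdiv \<Omega> \<tau> = (SOME d. d \<in> L2 (lebesgue_on \<Omega>) \<and> is_weak_div \<Omega> \<tau> d)"

definition H1 :: "(real^2) set \<Rightarrow> (real^2 \<Rightarrow> real) set" where
  "H1 \<Omega> = {v \<in> L2 (lebesgue_on \<Omega>). \<exists>G\<in>L2 (lebesgue_on \<Omega>). is_weak_grad \<Omega> v G}"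

definition H1_norm :: "(real^2) set \<Rightarrow> (real^2 \<Rightarrow> real) \<Rightarrow> real" where
  "H1_norm \<Omega> v =
     sqrt ((L2_norm (lebesgue_on \<Omega>) v)\<^sup>2 + (L2_norm (lebesgue_on \<Omega>) (wgrad \<Omega> v))\<^sup>2)"

definition Hdiv :: "(real^2) set \<Rightarrow> (real^2 \<Rightarrow> real^2) set" where
  "Hdiv \<Omega> = {\<tau> \<in> L2 (lebesgue_on \<Omega>). \<exists>d\<in>L2 (lebesgue_on \<Omega>). is_weak_div \<Omega> \<tau> d}"


section \<open>One-dimensional Hausdorff measure\<close>

definition hausdorff1_outer :: "(real^2) set \<Rightarrow> ennreal" where
  "hausdorff1_outer S =
     (SUP \<delta>\<in>{0<..}.
        INF U\<in>{U :: nat \<Rightarrow> (real^2) set.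
               (\<forall>i. bounded (U i) \<and> diameter (U i) \<le> \<delta>) \<and> S \<subseteq> (\<Union>i. U i)}.
          (\<Sum>i. ennreal (diameter (U i))))"

text \<open>\<open>hausdorff1_outer\<close> is a metric outer measure, hence countably additive on Borel sets.  On
  line segments it is the length.\<close>

definition hausdorff1 :: "(real^2) measure" where
  "hausdorff1 = measure_of UNIV (sets borel) hausdorff1_outer"

definition boundary_measure :: "(real^2) set \<Rightarrow> (real^2) measure" where
  "boundary_measure \<Omega> = restrict_space hausdorff1 (frontier \<Omega>)"


section \<open>Domains\<close>

definition polygonal :: "(real^2) set \<Rightarrow> bool" where
  "polygonal S \<longleftrightarrow>
     (\<exists>E :: ((real^2) \<times> (real^2)) set. finite E \<and> frontier S = (\<Union>(a, b)\<in>E. closed_segment a b))"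

text \<open>Near each boundary point the set is the strict epigraph of a Lipschitz function in some
  orthonormal coordinate system \<open>(a, b)\<close> centred at that point.\<close>

definition lipschitz_boundary :: "(real^2) set \<Rightarrow> bool" where
  "lipschitz_boundary \<Omega> \<longleftrightarrow>
     (\<forall>p\<in>frontier \<Omega>. \<exists>r>0. \<exists>a b. \<exists>L. \<exists>\<gamma> :: real \<Rightarrow> real.
        norm a = 1 \<and> norm b = 1 \<and> a \<bullet> b = 0 \<and> L-lipschitz_on UNIV \<gamma> \<and>
        \<Omega> \<inter> ball p r = {x \<in> ball p r. (x - p) \<bullet> b > \<gamma> ((x - p) \<bullet> a)})"

definition polygonal_lipschitz_domain :: "(real^2) set \<Rightarrow> bool" where
  "polygonal_lipschitz_domain \<Omega> \<longleftrightarrow>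
     open \<Omega> \<and> connected \<Omega> \<and> \<Omega> \<noteq> {} \<and> bounded \<Omega> \<and> polygonal \<Omega> \<and> lipschitz_boundary \<Omega>"

text \<open>The last conjunct makes explicit that passing to the closures of the two boundary parts only
  adds sets of length zero (such as end points), so that conditions on \<open>\<Gamma>\<^sub>D\<close> and on \<open>\<Gamma>\<^sub>N\<close> together
  are conditions on the whole boundary.\<close>

definition boundary_decomposition ::
    "(real^2) set \<Rightarrow> (real^2) set \<Rightarrow> (real^2) set \<Rightarrow> bool" where
  "boundary_decomposition \<Omega> \<Gamma>\<^sub>D \<Gamma>\<^sub>N \<longleftrightarrow>
     frontier \<Omega> = closure \<Gamma>\<^sub>D \<union> closure \<Gamma>\<^sub>N \<and> closure \<Gamma>\<^sub>D \<inter> closure \<Gamma>\<^sub>N = {} \<and>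
     emeasure hausdorff1 \<Gamma>\<^sub>D \<noteq> 0 \<and> frontier \<Omega> - (\<Gamma>\<^sub>D \<union> \<Gamma>\<^sub>N) \<in> null_sets hausdorff1"


section \<open>Traces\<close>

text \<open>Graph of the trace operator \<open>H\<^sup>1(\<Omega>) \<rightarrow> L\<^sup>2(\<partial>\<Omega>)\<close>, i.e. the closure of
  \<open>\<phi> \<mapsto> \<phi>|\<^bsub>\<partial>\<Omega>\<^esub>\<close> on functions that are smooth up to the boundary.\<close>

definition has_trace :: "(real^2) set \<Rightarrow> (real^2 \<Rightarrow> real) \<Rightarrow> (real^2 \<Rightarrow> real) \<Rightarrow> bool" where
  "has_trace \<Omega> v t \<longleftrightarrow>
     v \<in> H1 \<Omega> \<and> t \<in> L2 (boundary_measure \<Omega>) \<and>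
     (\<exists>\<phi> :: nat \<Rightarrow> real^2 \<Rightarrow> real. (\<forall>k. smooth (\<phi> k)) \<and>
        (\<lambda>k. L2_norm (lebesgue_on \<Omega>) (\<lambda>x. \<phi> k x - v x)) \<longlonglongrightarrow> 0 \<and>
        (\<lambda>k. L2_norm (lebesgue_on \<Omega>) (\<lambda>x. grad (\<phi> k) x - wgrad \<Omega> v x)) \<longlonglongrightarrow> 0 \<and>
        (\<lambda>k. \<integral>\<^sup>+x. ennreal ((\<phi> k x - t x)\<^sup>2) \<partial>boundary_measure \<Omega>) \<longlonglongrightarrow> 0)"

definition has_trace_on ::
    "(real^2) set \<Rightarrow> (real^2) set \<Rightarrow> (real^2 \<Rightarrow> real) \<Rightarrow> (real^2 \<Rightarrow> real) \<Rightarrow> bool" where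
  "has_trace_on \<Omega> \<Gamma> v t \<longleftrightarrow>
     (\<exists>s. has_trace \<Omega> v s \<and> (AE x in boundary_measure \<Omega>. x \<in> \<Gamma> \<longrightarrow> s x = t x))"

definition H1_vanishing_on :: "(real^2) set \<Rightarrow> (real^2) set \<Rightarrow> (real^2 \<Rightarrow> real) set" where
  "H1_vanishing_on \<Omega> \<Gamma> = {v \<in> H1 \<Omega>. has_trace_on \<Omega> \<Gamma> v (\<lambda>_. 0)}"

definition H_half :: "(real^2) set \<Rightarrow> (real^2) set \<Rightarrow> (real^2 \<Rightarrow> real) set" where
  "H_half \<Omega> \<Gamma> = {t. \<exists>v\<in>H1 \<Omega>. has_trace_on \<Omega> \<Gamma> v t}"

text \<open>Dual of \<open>H\<^bsup>1/2\<^esup>(\<Gamma>)\<close>, which carries the quotient norm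
  \<open>inf {\<parallel>v\<parallel> | v \<in> H\<^sup>1(\<Omega>) with trace t on \<Gamma>}\<close>; the pairing \<open>\<langle>g, t\<rangle>\<^bsub>\<Gamma>\<^esub>\<close> is \<open>g t\<close>.  Boundedness and
  linearity force \<open>g\<close> to depend only on the restriction of \<open>t\<close> to \<open>\<Gamma>\<close>, up to null sets.\<close>

definition H_minus_half ::
    "(real^2) set \<Rightarrow> (real^2) set \<Rightarrow> ((real^2 \<Rightarrow> real) \<Rightarrow> real) set" where
  "H_minus_half \<Omega> \<Gamma> =
     {g. (\<forall>s\<in>H_half \<Omega> \<Gamma>. \<forall>t\<in>H_half \<Omega> \<Gamma>. \<forall>c. g (\<lambda>x. s x + c * t x) = g s + c * g t) \<and>
         (\<exists>C. \<forall>v t. has_trace_on \<Omega> \<Gamma> v t \<longrightarrow> \<bar>g t\<bar> \<le> C * H1_norm \<Omega> v)}"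

text \<open>\<open>\<tau> \<bullet> n = g\<close> on \<open>\<Gamma>\<close> (\<open>n\<close> the outward normal) for \<open>\<tau> \<in> H(div)\<close>: the normal trace is the
  functional given by Green's formula
  \<open>\<langle>\<tau> \<bullet> n, v\<rangle> = (\<tau>, \<nabla>v) + (\<nabla> \<bullet> \<tau>, v)\<close>, tested with those \<open>v \<in> H\<^sup>1(\<Omega>)\<close> that vanish on the rest of
  the boundary.\<close>

definition has_normal_trace_on ::
    "(real^2) set \<Rightarrow> (real^2) set \<Rightarrow> (real^2 \<Rightarrow> real^2) \<Rightarrow> ((real^2 \<Rightarrow> real) \<Rightarrow> real) \<Rightarrow> bool" where
  "has_normal_trace_on \<Omega> \<Gamma> \<tau> g \<longleftrightarrow>
     (\<forall>v\<in>H1_vanishing_on \<Omega> (frontier \<Omega> - \<Gamma>). \<forall>t. has_trace_on \<Omega> \<Gamma> v t \<longrightarrow>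
        L2_inner (lebesgue_on \<Omega>) \<tau> (wgrad \<Omega> v) + L2_inner (lebesgue_on \<Omega>) (wdiv \<Omega> \<tau>) v = g t)"

definition Sigma_f ::
    "(real^2) set \<Rightarrow> (real^2) set \<Rightarrow> (real^2 \<Rightarrow> real) \<Rightarrow> ((real^2 \<Rightarrow> real) \<Rightarrow> real) \<Rightarrow>
     (real^2 \<Rightarrow> real^2) set" where
  "Sigma_f \<Omega> \<Gamma>\<^sub>N f g =
     {\<tau> \<in> Hdiv \<Omega>. (AE x in lebesgue_on \<Omega>. wdiv \<Omega> \<tau> x = f x) \<and> has_normal_trace_on \<Omega> \<Gamma>\<^sub>N \<tau> g}"


section \<open>Diffusion tensor\<close>

definition spd :: "real^2^2 \<Rightarrow> bool" where
  "spd M \<longleftrightarrow> transpose M = M \<and> (\<forall>x. x \<noteq> 0 \<longrightarrow> x \<bullet> (M *v x) > 0)"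

definition mat_sqrt :: "real^2^2 \<Rightarrow> real^2^2" where
  "mat_sqrt M = (THE S. spd S \<and> S ** S = M)"

definition subdomain_partition :: "(real^2) set \<Rightarrow> nat \<Rightarrow> (nat \<Rightarrow> (real^2) set) \<Rightarrow> bool" where
  "subdomain_partition \<Omega> n \<Omega>s \<longleftrightarrow>
     (\<forall>i<n. open (\<Omega>s i) \<and> polygonal (\<Omega>s i) \<and> \<Omega>s i \<subseteq> \<Omega>) \<and>
     (\<forall>i<n. \<forall>j<n. i \<noteq> j \<longrightarrow> \<Omega>s i \<inter> \<Omega>s j = {}) \<and>
     closure \<Omega> = (\<Union>i<n. closure (\<Omega>s i))"

text \<open>The values on the interfaces, a null set, are irrelevant and left unconstrained.\<close>

definition piecewise_constant_spd ::
    "nat \<Rightarrow> (nat \<Rightarrow> (real^2) set) \<Rightarrow> (real^2 \<Rightarrow> real^2^2) \<Rightarrow> bool" where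
  "piecewise_constant_spd n \<Omega>s A \<longleftrightarrow> (\<forall>i<n. \<exists>M. spd M \<and> (\<forall>x\<in>\<Omega>s i. A x = M))"

definition is_weak_solution ::
    "(real^2) set \<Rightarrow> (real^2) set \<Rightarrow> (real^2) set \<Rightarrow> (real^2 \<Rightarrow> real^2^2) \<Rightarrow> (real^2 \<Rightarrow> real) \<Rightarrow>
     ((real^2 \<Rightarrow> real) \<Rightarrow> real) \<Rightarrow> (real^2 \<Rightarrow> real) \<Rightarrow> bool" where
  "is_weak_solution \<Omega> \<Gamma>\<^sub>D \<Gamma>\<^sub>N A f g u \<longleftrightarrow>
     u \<in> H1_vanishing_on \<Omega> \<Gamma>\<^sub>D \<and>
     (\<forall>v\<in>H1_vanishing_on \<Omega> \<Gamma>\<^sub>D. \<forall>t. has_trace_on \<Omega> \<Gamma>\<^sub>N v t \<longrightarrow>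
        L2_inner (lebesgue_on \<Omega>) (\<lambda>x. A x *v wgrad \<Omega> u x) (wgrad \<Omega> v) =
        L2_inner (lebesgue_on \<Omega>) f v - g t)"


section \<open>Finite element partitions and the broken space\<close>

definition inscribed_diameter :: "(real^2) set \<Rightarrow> real" where
  "inscribed_diameter K = Sup {2 * r | r. 0 \<le> r \<and> (\<exists>c. cball c r \<subseteq> K)}"

text \<open>Elements are closed convex polygons (triangles, convex quadrilaterals, ...).  Regularity is
  shape regularity; hanging nodes are permitted.\<close>

definition regular_partition :: "(real^2) set \<Rightarrow> (real^2) set set \<Rightarrow> bool" where
  "regular_partition \<Omega> T \<longleftrightarrow>
     finite T \<and> (\<forall>K\<in>T. polytope K \<and> interior K \<noteq> {}) \<and>
     (\<forall>K\<in>T. \<forall>K'\<in>T. K \<noteq> K' \<longrightarrow> interior K \<inter> interior K' = {}) \<and>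
     closure \<Omega> = \<Union>T \<and>
     (\<exists>\<kappa>>0. \<forall>K\<in>T. diameter K \<le> \<kappa> * inscribed_diameter K)"

definition interfaces_respected ::
    "nat \<Rightarrow> (nat \<Rightarrow> (real^2) set) \<Rightarrow> (real^2) set set \<Rightarrow> bool" where
  "interfaces_respected n \<Omega>s T \<longleftrightarrow>
     (\<forall>i<n. \<forall>j<n. i \<noteq> j \<longrightarrow>
        (\<forall>K\<in>T. frontier (\<Omega>s i) \<inter> frontier (\<Omega>s j) \<inter> interior K = {}))"

definition H1_broken :: "(real^2) set \<Rightarrow> (real^2) set set \<Rightarrow> (real^2 \<Rightarrow> real) set" where
  "H1_broken \<Omega> T = {v \<in> L2 (lebesgue_on \<Omega>). \<forall>K\<in>T. v \<in> H1 (interior K)}"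

text \<open>The value off the element interiors, a null set, is a dummy.\<close>

definition broken_grad :: "(real^2) set set \<Rightarrow> (real^2 \<Rightarrow> real) \<Rightarrow> real^2 \<Rightarrow> real^2" where
  "broken_grad T v x =
     (if \<exists>K\<in>T. x \<in> interior K
      then wgrad (interior (THE K. K \<in> T \<and> x \<in> interior K)) v x else 0)"

end

theory Submission
  imports Defs
begin

text \<open>
  Let \<open>G\<close> be the broken gradient of \<open>w\<close>, let \<open>E = A\<^bsup>1/2\<^esup> (\<nabla>u - G)\<close>, and let \<open>W\<close> be the space of all
  \<open>A\<^bsup>1/2\<^esup> \<nabla>v\<close> with \<open>v \<in> H\<^sup>1\<close> vanishing on the Dirichlet part. The identity is Pythagoras' theorem for
  \<open>E\<close> with respect to \<open>W\<close> and its orthogonal complement in \<open>L\<^sup>2\<close>.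

  As \<open>u\<close> itself vanishes on the Dirichlet part, the fields \<open>A\<^bsup>1/2\<^esup> (\<nabla>v - G) = E - A\<^bsup>1/2\<^esup> \<nabla>(u - v)\<close> run
  through \<open>E - W\<close>, and the infimum over \<open>v\<close> is the squared distance of \<open>E\<close> to \<open>W\<close>. On the other hand
  Green's formula and the weak formulation together say that \<open>\<tau>\<close> is admissible exactly if
  \<open>\<tau> + A \<nabla>u\<close> is orthogonal to all \<open>\<nabla>v\<close> (\<open>Sigma_f_iff_orthogonal\<close>), that is, if
  \<open>p = A\<^bsup>-1/2\<^esup> \<tau> + A\<^bsup>1/2\<^esup> \<nabla>u\<close> is orthogonal to \<open>W\<close>. Since \<open>A\<^bsup>-1/2\<^esup> \<tau> + A\<^bsup>1/2\<^esup> G = p - E\<close>, the infimum over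
  \<open>\<tau>\<close> is the squared distance of \<open>E\<close> to the orthogonal complement of \<open>W\<close>. The two squared distances
  add up to \<open>\<parallel>E\<parallel>\<^sup>2\<close> for any subspace, closed or not (\<open>L2_orthogonal_split_INF\<close>); this avoids a
  Poincare inequality, and rests on the completeness of \<open>L\<^sup>2\<close>.

  Three facts justify these manipulations with representatives. Weak gradients are unique almost
  everywhere by the fundamental lemma of the calculus of variations, which is applied with explicit
  smooth bumps on boxes; hence \<open>wgrad\<close> is linear and local up to null sets. Test functions have
  vanishing trace and their classical gradient as weak gradient, by integration by parts; hence
  orthogonality to \<open>W\<close> determines the divergence. Finally, the subdomains and the element interiors
  cover \<open>\<Omega>\<close> up to null sets, and element interiors lie inside \<open>\<Omega>\<close> because a Lipschitz domain is the
  interior of its closure; hence \<open>A\<close> acts on \<open>L\<^sup>2\<close> and the broken gradient of \<open>u - w\<close> is \<open>\<nabla>u - G\<close>.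
\<close>

section \<open>Orthogonal projection of square-integrable functions\<close>

text \<open>A quadratic polynomial without negative values has no two distinct real roots. With \<open>a = \<parallel>v\<parallel>\<^sup>2\<close> this is
  Cauchy-Schwarz; with \<open>a\<close> the excess of \<open>\<parallel>E - v\<parallel>\<^sup>2\<close> over its infimum it says that an almost minimiser
  \<open>v\<close> leaves an almost orthogonal error \<open>E - v\<close>.\<close>

lemma quadratic_nonneg_imp_discriminant:
  fixes a b c :: real
  assumes "\<And>t. 0 \<le> a - 2 * t * b + t\<^sup>2 * c"
  shows "b\<^sup>2 \<le> a * c"
proof (cases "c = 0")
  case True
  have "b = 0"
  proof (rule ccontr)
    assume "b \<noteq> 0"
    with assms[of "(a + 1) / (2 * b)"] True show False by simp
  qed
  with True show ?thesis by simp
next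
  case False
  have "c > 0"
  proof (rule ccontr)
    assume "\<not> c > 0"
    with False have c: "c < 0" by simp
    \<comment> \<open>completing the square, \<open>c\<close> times the polynomial is \<open>(c t - b)\<^sup>2 + a c - b\<^sup>2\<close>; this \<open>t\<close> makes it positive\<close>
    define t where "t = (b + sqrt (b\<^sup>2 + \<bar>a * c\<bar> + 1)) / c"
    have "c * t = b + sqrt (b\<^sup>2 + \<bar>a * c\<bar> + 1)" using c by (simp add: t_def)
    hence "(c * t - b)\<^sup>2 = b\<^sup>2 + \<bar>a * c\<bar> + 1" by simp
    hence "c * (a - 2 * t * b + t\<^sup>2 * c) = \<bar>a * c\<bar> + 1 + a * c"
      by (simp add: algebra_simps power2_eq_square)
    also have "\<dots> > 0" by simp
    finally show False using assms[of t] c by (simp add: zero_less_mult_iff)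
  qed
  with assms[of "b / c"] show ?thesis
    by (simp add: field_simps power2_eq_square)
qed

lemma L2_measurable: "v \<in> L2 M \<Longrightarrow> v \<in> borel_measurable M"
  by (simp add: L2_def)

lemma L2_zero: "(\<lambda>x. 0) \<in> L2 M"
  by (simp add: L2_def)

lemma L2_integrable_inner:
  assumes "v \<in> L2 M" "w \<in> L2 M"
  shows "integrable M (\<lambda>x. v x \<bullet> w x)"
proof (rule Bochner_Integration.integrable_bound)
  show "integrable M (\<lambda>x. (norm (v x))\<^sup>2 + (norm (w x))\<^sup>2)"
    using assms by (simp add: L2_def)
  show "(\<lambda>x. v x \<bullet> w x) \<in> borel_measurable M"
    using assms by (auto simp: L2_def)
  show "AE x in M. norm (v x \<bullet> w x) \<le> norm ((norm (v x))\<^sup>2 + (norm (w x))\<^sup>2)"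
  proof (intro AE_I2)
    fix x
    have "\<bar>v x \<bullet> w x\<bar> \<le> norm (v x) * norm (w x)" by (rule Cauchy_Schwarz_ineq2)
    also have "\<dots> \<le> (norm (v x))\<^sup>2 + (norm (w x))\<^sup>2"
      using sum_squares_bound[of "norm (v x)" "norm (w x)"]
        mult_nonneg_nonneg[OF norm_ge_zero[of "v x"] norm_ge_zero[of "w x"]] by linarith
    finally show "norm (v x \<bullet> w x) \<le> norm ((norm (v x))\<^sup>2 + (norm (w x))\<^sup>2)" by simp
  qed
qed

lemma L2_iff_integrable_inner_self:
  "v \<in> L2 M \<longleftrightarrow> v \<in> borel_measurable M \<and> integrable M (\<lambda>x. v x \<bullet> v x)"
  by (simp add: L2_def dot_square_norm)

lemma L2_add_scaleR:
  assumes "v \<in> L2 M" "w \<in> L2 M"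
  shows "(\<lambda>x. v x + c *\<^sub>R w x) \<in> L2 M"
proof -
  have "integrable M (\<lambda>x. v x \<bullet> v x + 2 * c * (v x \<bullet> w x) + c\<^sup>2 * (w x \<bullet> w x))"
    by (intro Bochner_Integration.integrable_add integrable_mult_right L2_integrable_inner assms)
  moreover have "(\<lambda>x. v x \<bullet> v x + 2 * c * (v x \<bullet> w x) + c\<^sup>2 * (w x \<bullet> w x))
     = (\<lambda>x. (v x + c *\<^sub>R w x) \<bullet> (v x + c *\<^sub>R w x))"
    by (simp add: inner_add inner_commute power2_eq_square algebra_simps)
  ultimately show ?thesis
    using assms by (auto simp: L2_iff_integrable_inner_self)
qed

lemma L2_add: "v \<in> L2 M \<Longrightarrow> w \<in> L2 M \<Longrightarrow> (\<lambda>x. v x + w x) \<in> L2 M"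
  using L2_add_scaleR[of v M w 1] by simp

lemma L2_diff: "v \<in> L2 M \<Longrightarrow> w \<in> L2 M \<Longrightarrow> (\<lambda>x. v x - w x) \<in> L2 M"
  using L2_add_scaleR[of v M w "-1"] by simp

lemma L2_sum:
  assumes "finite I" "\<And>i. i \<in> I \<Longrightarrow> v i \<in> L2 M"
  shows "(\<lambda>x. \<Sum>i\<in>I. v i x) \<in> L2 M"
  using assms by (induction) (auto simp: L2_zero intro!: L2_add)

lemma L2_bound:
  assumes "v \<in> borel_measurable M" "w \<in> L2 M" "AE x in M. norm (v x) \<le> C * norm (w x)"
  shows "v \<in> L2 M"
proof -
  have "integrable M (\<lambda>x. (norm (v x))\<^sup>2)"
  proof (rule Bochner_Integration.integrable_bound)
    show "integrable M (\<lambda>x. C\<^sup>2 * (norm (w x))\<^sup>2)"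
      using assms by (simp add: L2_def)
    show "AE x in M. norm ((norm (v x))\<^sup>2) \<le> norm (C\<^sup>2 * (norm (w x))\<^sup>2)"
      using assms(3)
    proof eventually_elim
      case (elim x)
      have "(norm (v x))\<^sup>2 \<le> (C * norm (w x))\<^sup>2"
        using elim by (intro power_mono) auto
      thus ?case by (simp add: power_mult_distrib)
    qed
  qed (use assms in auto)
  with assms show ?thesis by (simp add: L2_def)
qed

lemma L2_inner_commute: "L2_inner M v w = L2_inner M w v"
  by (simp only: L2_inner_def inner_commute)

lemma L2_inner_add_left:
  "v \<in> L2 M \<Longrightarrow> w \<in> L2 M \<Longrightarrow> z \<in> L2 M \<Longrightarrow>
    L2_inner M (\<lambda>x. v x + w x) z = L2_inner M v z + L2_inner M w z"
  by (simp add: L2_inner_def inner_add_left L2_integrable_inner)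

lemma L2_inner_diff_left:
  "v \<in> L2 M \<Longrightarrow> w \<in> L2 M \<Longrightarrow> z \<in> L2 M \<Longrightarrow>
    L2_inner M (\<lambda>x. v x - w x) z = L2_inner M v z - L2_inner M w z"
  by (simp add: L2_inner_def inner_diff_left L2_integrable_inner)

lemma L2_inner_scaleR_left: "L2_inner M (\<lambda>x. c *\<^sub>R v x) z = c * L2_inner M v z"
  by (simp add: L2_inner_def)

lemma L2_norm_nonneg: "0 \<le> L2_norm M v"
  by (simp add: L2_norm_def)

lemma L2_norm_sq: "(L2_norm M v)\<^sup>2 = L2_inner M v v"
  by (simp add: L2_norm_def L2_inner_def dot_square_norm)

lemma L2_norm_sq_add_scaleR:
  assumes "v \<in> L2 M" "w \<in> L2 M"
  shows "(L2_norm M (\<lambda>x. v x + c *\<^sub>R w x))\<^sup>2 =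
    (L2_norm M v)\<^sup>2 + 2 * c * L2_inner M v w + c\<^sup>2 * (L2_norm M w)\<^sup>2"
proof -
  have "(L2_norm M (\<lambda>x. v x + c *\<^sub>R w x))\<^sup>2
     = (LINT x|M. v x \<bullet> v x + 2 * c * (v x \<bullet> w x) + c\<^sup>2 * (w x \<bullet> w x))"
    unfolding L2_norm_sq L2_inner_def
    by (rule Bochner_Integration.integral_cong[OF refl])
       (simp add: inner_add inner_commute power2_eq_square algebra_simps)
  also have "\<dots> = (L2_norm M v)\<^sup>2 + 2 * c * L2_inner M v w + c\<^sup>2 * (L2_norm M w)\<^sup>2"
    using assms by (simp add: L2_norm_sq L2_integrable_inner L2_inner_def)
  finally show ?thesis .
qed

lemma L2_norm_sq_diff:
  assumes "v \<in> L2 M" "w \<in> L2 M"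
  shows "(L2_norm M (\<lambda>x. v x - w x))\<^sup>2 =
    (L2_norm M v)\<^sup>2 - 2 * L2_inner M v w + (L2_norm M w)\<^sup>2"
  using L2_norm_sq_add_scaleR[OF assms, of "-1"] by simp

lemma L2_Cauchy_Schwarz:
  assumes "v \<in> L2 M" "w \<in> L2 M"
  shows "\<bar>L2_inner M v w\<bar> \<le> L2_norm M v * L2_norm M w"
proof -
  have "(L2_inner M v w)\<^sup>2 \<le> (L2_norm M v)\<^sup>2 * (L2_norm M w)\<^sup>2"
  proof (rule quadratic_nonneg_imp_discriminant)
    fix t
    show "0 \<le> (L2_norm M v)\<^sup>2 - 2 * t * L2_inner M v w + t\<^sup>2 * (L2_norm M w)\<^sup>2"
      using L2_norm_sq_add_scaleR[OF assms, of "-t"]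
      by (metis (no_types, lifting) add_uminus_conv_diff mult.assoc mult_minus_left
        mult_minus_right power2_minus zero_le_power2)
  qed
  hence "\<bar>L2_inner M v w\<bar>\<^sup>2 \<le> (L2_norm M v * L2_norm M w)\<^sup>2"
    by (simp add: power_mult_distrib)
  thus ?thesis
    using power2_le_imp_le[of "\<bar>L2_inner M v w\<bar>" "L2_norm M v * L2_norm M w"]
    by (simp add: L2_norm_nonneg)
qed

lemma L2_norm_cong_AE:
  assumes "v \<in> borel_measurable M" "w \<in> borel_measurable M" "AE x in M. v x = w x"
  shows "L2_norm M v = L2_norm M w"
proof -
  have "(LINT x|M. (norm (v x))\<^sup>2) = (LINT x|M. (norm (w x))\<^sup>2)"
    by (intro integral_cong_AE) (use assms in auto)
  thus ?thesis by (simp add: L2_norm_def)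
qed

lemma L2_inner_cong_AE:
  assumes "v \<in> borel_measurable M" "v' \<in> borel_measurable M"
    "w \<in> borel_measurable M" "w' \<in> borel_measurable M"
    "AE x in M. v x = v' x" "AE x in M. w x = w' x"
  shows "L2_inner M v w = L2_inner M v' w'"
  unfolding L2_inner_def by (intro integral_cong_AE) (use assms in auto)

lemma L2_cong_AE:
  assumes "v \<in> borel_measurable M" "w \<in> L2 M" "AE x in M. v x = w x"
  shows "v \<in> L2 M"
proof (rule L2_bound[OF assms(1,2)])
  show "AE x in M. norm (v x) \<le> 1 * norm (w x)"
    using assms(3) by eventually_elim simp
qed

lemma L2_norm_triangle:
  assumes "v \<in> L2 M" "w \<in> L2 M"
  shows "L2_norm M (\<lambda>x. v x + c *\<^sub>R w x) \<le> L2_norm M v + \<bar>c\<bar> * L2_norm M w"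
proof (rule power2_le_imp_le)
  have "c * L2_inner M v w \<le> \<bar>c * L2_inner M v w\<bar>" by (rule abs_ge_self)
  also have "\<dots> = \<bar>c\<bar> * \<bar>L2_inner M v w\<bar>" by (rule abs_mult)
  also have "\<dots> \<le> \<bar>c\<bar> * (L2_norm M v * L2_norm M w)"
    by (intro mult_left_mono L2_Cauchy_Schwarz assms) simp
  finally have cross: "c * L2_inner M v w \<le> \<bar>c\<bar> * (L2_norm M v * L2_norm M w)" .
  have "(L2_norm M v + \<bar>c\<bar> * L2_norm M w)\<^sup>2 =
    (L2_norm M v)\<^sup>2 + 2 * (\<bar>c\<bar> * (L2_norm M v * L2_norm M w)) + c\<^sup>2 * (L2_norm M w)\<^sup>2"
    by (simp add: power2_sum power_mult_distrib)
  with cross show "(L2_norm M (\<lambda>x. v x + c *\<^sub>R w x))\<^sup>2 \<le> (L2_norm M v + \<bar>c\<bar> * L2_norm M w)\<^sup>2"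
    unfolding L2_norm_sq_add_scaleR[OF assms] by simp
qed (simp add: L2_norm_nonneg)

text \<open>Riesz-Fischer. On a finite measure space the increments of a geometrically fast Cauchy sequence
  have summable \<open>L\<^sup>1\<close> norms, so the sequence converges absolutely at almost every point; Fatou's
  lemma turns the Cauchy bounds into bounds for the distance to the pointwise limit.\<close>

lemma L2_complete_fast_Cauchy:
  fixes w :: "nat \<Rightarrow> 'a \<Rightarrow> 'b::euclidean_space"
  assumes "finite_measure M" and w: "\<And>k. w k \<in> L2 M"
    and cauchy: "\<And>j k. k \<le> j \<Longrightarrow> (L2_norm M (\<lambda>x. w j x - w k x))\<^sup>2 \<le> (1/4)^k"
  shows "\<exists>q\<in>L2 M. (\<lambda>k. L2_norm M (\<lambda>x. w k x - q x)) \<longlonglongrightarrow> 0"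
proof -
  interpret finite_measure M by fact
  have [measurable]: "w k \<in> borel_measurable M" for k using w by (simp add: L2_def)
  define h where "h k x = norm (w (Suc k) x - w k x)" for k x
  have hL2: "integrable M (\<lambda>x. (h k x)\<^sup>2)" for k
    using L2_diff[OF w w, of "Suc k" k] by (simp add: h_def L2_def)
  have h1: "(\<integral>\<^sup>+x. ennreal (h k x) \<partial>M) \<le> ennreal ((1 + measure M (space M)) * (1/2)^k)" for k
  proof -
    \<comment> \<open>the weights balance \<open>\<parallel>h k\<parallel>\<^sup>2 \<le> (1/4)^k\<close> against the finite total mass, leaving order \<open>(1/2)^k\<close> for both terms\<close>
    have pw: "h k x \<le> 2^k * (h k x)\<^sup>2 + (1/2)^k" for x
    proof -
      have "0 \<le> (2^k * h k x - 1/2)\<^sup>2" by simp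
      hence "2^k * h k x \<le> (2^k * h k x)\<^sup>2 + 1"
        by (simp add: power2_eq_square algebra_simps)
      hence "2^k * h k x \<le> 2^k * (2^k * (h k x)\<^sup>2 + (1/2)^k)"
        by (simp add: algebra_simps power2_eq_square power_divide)
      thus ?thesis by (metis mult_le_cancel_left_pos zero_less_numeral zero_less_power)
    qed
    have "(\<integral>\<^sup>+x. ennreal (h k x) \<partial>M) \<le> (\<integral>\<^sup>+x. ennreal (2^k * (h k x)\<^sup>2 + (1/2)^k) \<partial>M)"
      by (intro nn_integral_mono ennreal_leI pw)
    also have "\<dots> = ennreal (LINT x|M. 2^k * (h k x)\<^sup>2 + (1/2)^k)"
      by (intro nn_integral_eq_integral) (use hL2 in auto)
    also have "(LINT x|M. 2^k * (h k x)\<^sup>2 + (1/2)^k)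
       = 2^k * (LINT x|M. (h k x)\<^sup>2) + (1/2)^k * measure M (space M)"
      using hL2 by simp
    also have "(LINT x|M. (h k x)\<^sup>2) = (L2_norm M (\<lambda>x. w (Suc k) x - w k x))\<^sup>2"
      by (simp add: L2_norm_def h_def)
    also have "ennreal (2^k * (L2_norm M (\<lambda>x. w (Suc k) x - w k x))\<^sup>2 + (1/2)^k * measure M (space M))
       \<le> ennreal (2^k * (1/4)^k + (1/2)^k * measure M (space M))"
      by (intro ennreal_leI add_right_mono mult_left_mono cauchy) auto
    also have "2^k * (1/4)^k + (1/2)^k * measure M (space M) = (1 + measure M (space M)) * (1/2::real)^k"
    proof -
      have "2^k * (1/4)^k = (1/2::real)^k" unfolding power_mult_distrib[symmetric] by simp
      thus ?thesis by (simp add: algebra_simps)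
    qed
    finally show ?thesis .
  qed
  have "(\<integral>\<^sup>+x. (\<Sum>k. ennreal (h k x)) \<partial>M) = (\<Sum>k. \<integral>\<^sup>+x. ennreal (h k x) \<partial>M)"
    by (rule nn_integral_suminf) (simp add: h_def)
  also have "\<dots> \<le> (\<Sum>k. ennreal ((1 + measure M (space M)) * (1/2)^k))"
    by (intro suminf_le h1) auto
  also have "\<dots> < \<infinity>"
  proof -
    have "summable (\<lambda>k. (1 + measure M (space M)) * (1/2::real)^k)"
      by (intro summable_mult summable_geometric) simp
    thus ?thesis by (subst suminf_ennreal2) auto
  qed
  finally have "AE x in M. (\<Sum>k. ennreal (h k x)) \<noteq> \<infinity>"
    by (intro nn_integral_PInf_AE) (simp_all add: h_def)
  hence conv: "AE x in M. convergent (\<lambda>k. w k x)"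
  proof eventually_elim
    case (elim x)
    have "summable (\<lambda>k. h k x)"
      using elim by (intro summable_suminf_not_top) (auto simp: h_def)
    hence "summable (\<lambda>k. w (Suc k) x - w k x)"
      unfolding h_def by (rule summable_norm_cancel)
    hence "convergent (\<lambda>n. \<Sum>k<n. w (Suc k) x - w k x)"
      by (simp add: summable_iff_convergent)
    hence "convergent (\<lambda>n. w n x - w 0 x)"
      using sum_lessThan_telescope[of "\<lambda>k. w k x"] by simp
    from convergent_add[OF this convergent_const[of "w 0 x"]] show ?case by simp
  qed
  define q where "q x = lim (\<lambda>k. w k x)" for x
  have [measurable]: "q \<in> borel_measurable M"
    unfolding q_def by measurable
  have lim: "AE x in M. (\<lambda>k. w k x) \<longlonglongrightarrow> q x"
    using conv by eventually_elim (simp add: q_def convergent_LIMSEQ_iff)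
  have est: "(\<integral>\<^sup>+x. ennreal ((norm (w k x - q x))\<^sup>2) \<partial>M) \<le> ennreal ((1/4)^k)" for k
  proof -
    have "(\<integral>\<^sup>+x. ennreal ((norm (w k x - q x))\<^sup>2) \<partial>M)
       = (\<integral>\<^sup>+x. liminf (\<lambda>j. ennreal ((norm (w k x - w j x))\<^sup>2)) \<partial>M)"
    proof (rule nn_integral_cong_AE, use lim in eventually_elim)
      case (elim x)
      have "(\<lambda>j. ennreal ((norm (w k x - w j x))\<^sup>2)) \<longlonglongrightarrow> ennreal ((norm (w k x - q x))\<^sup>2)"
        by (intro tendsto_intros elim tendsto_ennrealI)
      thus ?case using lim_imp_Liminf[OF sequentially_bot] by metis
    qed
    also have "\<dots> \<le> liminf (\<lambda>j. \<integral>\<^sup>+x. ennreal ((norm (w k x - w j x))\<^sup>2) \<partial>M)"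
      by (rule nn_integral_liminf) simp
    also have "\<dots> \<le> ennreal ((1/4)^k)"
    proof (rule Liminf_le)
      show "\<forall>\<^sub>F j in sequentially. (\<integral>\<^sup>+x. ennreal ((norm (w k x - w j x))\<^sup>2) \<partial>M) \<le> ennreal ((1/4)^k)"
        using eventually_ge_at_top[of k]
      proof eventually_elim
        case (elim j)
        have "(\<integral>\<^sup>+x. ennreal ((norm (w k x - w j x))\<^sup>2) \<partial>M) = ennreal (LINT x|M. (norm (w k x - w j x))\<^sup>2)"
          using L2_diff[OF w w, of k j] by (intro nn_integral_eq_integral) (auto simp: L2_def)
        also have "(LINT x|M. (norm (w k x - w j x))\<^sup>2) = (L2_norm M (\<lambda>x. w j x - w k x))\<^sup>2"
          by (simp add: L2_norm_def norm_minus_commute)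
        finally show ?case using cauchy[OF elim] by (simp add: ennreal_leI)
      qed
    qed simp
    finally show ?thesis .
  qed
  have dL2: "(\<lambda>x. w k x - q x) \<in> L2 M" for k
  proof -
    have "integrable M (\<lambda>x. (norm (w k x - q x))\<^sup>2)"
      by (rule integrableI_bounded) (use le_less_trans[OF est[of k]] in auto)
    thus ?thesis by (simp add: L2_def)
  qed
  have qL2: "q \<in> L2 M"
    using L2_diff[OF w[of 0] dL2[of 0]] by simp
  have bound: "L2_norm M (\<lambda>x. w k x - q x) \<le> (1/2)^k" for k
  proof -
    have "ennreal ((L2_norm M (\<lambda>x. w k x - q x))\<^sup>2) = (\<integral>\<^sup>+x. ennreal ((norm (w k x - q x))\<^sup>2) \<partial>M)"
      using dL2[of k] by (subst nn_integral_eq_integral) (auto simp: L2_def L2_norm_def)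
    also have "\<dots> \<le> ennreal ((1/4)^k)" by (rule est)
    finally have "(L2_norm M (\<lambda>x. w k x - q x))\<^sup>2 \<le> (1/4)^k"
      by (simp add: ennreal_le_iff)
    also have "(1/4)^k = ((1/2::real)^k)\<^sup>2"
      by (simp add: power2_eq_square flip: power_mult_distrib)
    finally show ?thesis by (rule power2_le_imp_le) simp
  qed
  have "(\<lambda>k. L2_norm M (\<lambda>x. w k x - q x)) \<longlonglongrightarrow> 0"
  proof (rule tendsto_sandwich[OF _ _ tendsto_const])
    show "(\<lambda>k. (1/2::real)^k) \<longlonglongrightarrow> 0" by (rule LIMSEQ_power_zero) simp
  qed (use bound in \<open>auto simp: L2_norm_nonneg\<close>)
  with qL2 show ?thesis by blast
qed

lemma L2_inner_tendsto:
  assumes "\<And>k. v k \<in> L2 M" "q \<in> L2 M" "z \<in> L2 M"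
    and "(\<lambda>k. L2_norm M (\<lambda>x. v k x - q x)) \<longlonglongrightarrow> 0"
  shows "(\<lambda>k. L2_inner M (v k) z) \<longlonglongrightarrow> L2_inner M q z"
proof -
  have "(\<lambda>k. L2_inner M (v k) z - L2_inner M q z) \<longlonglongrightarrow> 0"
  proof (rule Lim_null_comparison)
    show "\<forall>\<^sub>F k in sequentially. norm (L2_inner M (v k) z - L2_inner M q z)
        \<le> L2_norm M (\<lambda>x. v k x - q x) * L2_norm M z"
    proof (intro always_eventually allI)
      fix k
      show "norm (L2_inner M (v k) z - L2_inner M q z) \<le> L2_norm M (\<lambda>x. v k x - q x) * L2_norm M z"
        using L2_Cauchy_Schwarz[OF L2_diff[OF assms(1)[of k] assms(2)] assms(3)]
        by (simp add: L2_inner_diff_left assms)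
    qed
    show "(\<lambda>k. L2_norm M (\<lambda>x. v k x - q x) * L2_norm M z) \<longlonglongrightarrow> 0"
      using tendsto_mult_right[OF assms(4), of "L2_norm M z"] by simp
  qed
  thus ?thesis by (simp add: LIM_zero_iff)
qed

text \<open>The projection \<open>q\<close> of \<open>E\<close> onto the closure of the subspace \<open>W\<close>. The parallelogram law makes a
  minimising sequence in \<open>W\<close> Cauchy, and its limit is \<open>q\<close>. The approximating sequence is part of the
  conclusion because \<open>W\<close> need not be closed, so that \<open>q\<close> itself may lie outside \<open>W\<close>.\<close>

lemma L2_projection:
  fixes E :: "'a \<Rightarrow> 'b::euclidean_space"
  assumes fin: "finite_measure M" and W: "W \<subseteq> L2 M" "W \<noteq> {}"
    and lin: "\<And>v w c. v \<in> W \<Longrightarrow> w \<in> W \<Longrightarrow> (\<lambda>x. v x + c *\<^sub>R w x) \<in> W"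
    and E: "E \<in> L2 M"
  shows "\<exists>q\<in>L2 M. (\<forall>w\<in>W. L2_inner M (\<lambda>x. E x - q x) w = 0) \<and>
    (\<exists>v. (\<forall>k. v k \<in> W) \<and> (\<lambda>k. L2_norm M (\<lambda>x. v k x - q x)) \<longlonglongrightarrow> 0)"
proof -
  define N where "N w = (L2_norm M (\<lambda>x. E x - w x))\<^sup>2" for w
  define d where "d = (INF w\<in>W. N w)"
  have bdd: "bdd_below (N ` W)" by (rule bdd_belowI[of _ 0]) (auto simp: N_def)
  have dle: "d \<le> N w" if "w \<in> W" for w
    unfolding d_def using bdd that by (rule cINF_lower)
  \<comment> \<open>the exponent \<open>Suc k\<close> absorbs the factor lost in the parallelogram law below\<close>
  have "\<exists>w\<in>W. N w < d + (1/4)^Suc k" for k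
    using cINF_less_iff[OF W(2) bdd, of "d + (1/4)^Suc k"] by (simp add: d_def)
  then obtain v where v: "\<And>k. v k \<in> W" and Nv: "\<And>k. N (v k) < d + (1/4)^Suc k"
    by metis
  have vL: "v k \<in> L2 M" for k using v W by auto
  have EL: "(\<lambda>x. E x - w x) \<in> L2 M" if "w \<in> W" for w using E W that by (auto intro: L2_diff)
  have cauchy: "(L2_norm M (\<lambda>x. v j x - v k x))\<^sup>2 \<le> (1/4)^k" if "k \<le> j" for j k
  proof -
    let ?a = "\<lambda>x. E x - v k x" and ?b = "\<lambda>x. E x - v j x"
    have "(\<lambda>x. v j x + (-1) *\<^sub>R v k x) \<in> W" using lin v by blast
    hence "(\<lambda>x. v k x + (1/2) *\<^sub>R (v j x + (-1) *\<^sub>R v k x)) \<in> W" using lin v by blast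
    also have "(\<lambda>x. v k x + (1/2) *\<^sub>R (v j x + (-1) *\<^sub>R v k x)) = (\<lambda>x. (1/2) *\<^sub>R v k x + (1/2) *\<^sub>R v j x)"
    proof
      fix x
      have "v k x = (1/2) *\<^sub>R v k x + (1/2) *\<^sub>R v k x" by (simp flip: scaleR_add_left)
      thus "v k x + (1/2) *\<^sub>R (v j x + (-1) *\<^sub>R v k x) = (1/2) *\<^sub>R v k x + (1/2) *\<^sub>R v j x"
        by (simp add: scaleR_add_right scaleR_diff_right) (metis add_diff_cancel_left' add_diff_eq add.commute)
    qed
    finally have mid: "(\<lambda>x. (1/2) *\<^sub>R v k x + (1/2) *\<^sub>R v j x) \<in> W" .
    have "(\<lambda>x. E x - ((1/2) *\<^sub>R v k x + (1/2) *\<^sub>R v j x)) = (\<lambda>x. (1/2) *\<^sub>R (?a x + ?b x))"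
    proof
      fix x
      have "E x = (1/2) *\<^sub>R E x + (1/2) *\<^sub>R E x" by (simp flip: scaleR_add_left)
      thus "E x - ((1/2) *\<^sub>R v k x + (1/2) *\<^sub>R v j x) = (1/2) *\<^sub>R (?a x + ?b x)"
        by (simp add: scaleR_add_right scaleR_diff_right)
    qed
    hence "d \<le> (1/4) * (L2_norm M (\<lambda>x. ?a x + 1 *\<^sub>R ?b x))\<^sup>2"
      using dle[OF mid]
      by (simp add: N_def L2_norm_sq L2_inner_scaleR_left L2_inner_def)
    moreover have "(L2_norm M (\<lambda>x. ?a x + 1 *\<^sub>R ?b x))\<^sup>2 = N (v k) + 2 * L2_inner M ?a ?b + N (v j)"
      unfolding N_def L2_norm_sq_add_scaleR[OF EL[OF v] EL[OF v]] by simp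
    moreover have "(L2_norm M (\<lambda>x. ?a x - ?b x))\<^sup>2 = N (v k) - 2 * L2_inner M ?a ?b + N (v j)"
      unfolding N_def by (rule L2_norm_sq_diff[OF EL[OF v] EL[OF v]])
    moreover have "(\<lambda>x. ?a x - ?b x) = (\<lambda>x. v j x - v k x)" by auto
    moreover have "N (v k) < d + (1/4)^k / 4" using Nv[of k] by simp
    moreover have "N (v j) < d + (1/4)^k / 4"
    proof -
      have "(1/4::real)^j \<le> (1/4)^k" using that by (intro power_decreasing) auto
      with Nv[of j] show ?thesis by (simp only: power_Suc)
    qed
    moreover have "0 \<le> (1/4::real)^k" by simp
    ultimately show ?thesis by simp
  qed
  obtain q where q: "q \<in> L2 M" and lim: "(\<lambda>k. L2_norm M (\<lambda>x. v k x - q x)) \<longlonglongrightarrow> 0"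
    using L2_complete_fast_Cauchy[OF fin vL cauchy] by blast
  have "L2_inner M (\<lambda>x. E x - q x) w = 0" if w: "w \<in> W" for w
  proof -
    have wL: "w \<in> L2 M" using w W by auto
    \<comment> \<open>moving \<open>v k\<close> along \<open>w\<close> cannot beat the infimum \<open>d\<close>, so the discriminant is nonpositive\<close>
    have sq: "(L2_inner M (\<lambda>x. E x - v k x) w)\<^sup>2 \<le> (1/4)^Suc k * (L2_norm M w)\<^sup>2" for k
    proof (rule quadratic_nonneg_imp_discriminant)
      fix t
      have "(\<lambda>x. v k x + t *\<^sub>R w x) \<in> W" using lin v w by blast
      from dle[OF this] have "d \<le> (L2_norm M (\<lambda>x. (E x - v k x) + (- t) *\<^sub>R w x))\<^sup>2"
        by (simp add: N_def algebra_simps)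
      also have "\<dots> = N (v k) - 2 * t * L2_inner M (\<lambda>x. E x - v k x) w + t\<^sup>2 * (L2_norm M w)\<^sup>2"
        unfolding N_def L2_norm_sq_add_scaleR[OF EL[OF v] wL] by simp
      finally show "0 \<le> (1/4)^Suc k - 2 * t * L2_inner M (\<lambda>x. E x - v k x) w + t\<^sup>2 * (L2_norm M w)\<^sup>2"
        using Nv[of k] by simp
    qed
    have "(\<lambda>k. (L2_inner M (\<lambda>x. E x - v k x) w)\<^sup>2) \<longlonglongrightarrow> 0"
    proof (rule tendsto_sandwich[OF _ _ tendsto_const])
      have "(\<lambda>k. (1/4::real)^Suc k * (L2_norm M w)\<^sup>2) \<longlonglongrightarrow> 0 * (L2_norm M w)\<^sup>2"
        by (intro tendsto_mult_right LIMSEQ_Suc LIMSEQ_power_zero) simp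
      thus "(\<lambda>k. (1/4::real)^Suc k * (L2_norm M w)\<^sup>2) \<longlonglongrightarrow> 0" by simp
    qed (use sq in auto)
    moreover have "(\<lambda>k. (L2_inner M (\<lambda>x. E x - v k x) w)\<^sup>2) \<longlonglongrightarrow> (L2_inner M (\<lambda>x. E x - q x) w)\<^sup>2"
    proof -
      have "(\<lambda>k. L2_inner M E w - L2_inner M (v k) w) \<longlonglongrightarrow> L2_inner M E w - L2_inner M q w"
        by (intro tendsto_intros L2_inner_tendsto vL q wL lim)
      hence "(\<lambda>k. L2_inner M (\<lambda>x. E x - v k x) w) \<longlonglongrightarrow> L2_inner M (\<lambda>x. E x - q x) w"
        by (simp add: L2_inner_diff_left E vL q wL)
      thus ?thesis by (rule tendsto_power)
    qed
    ultimately have "(L2_inner M (\<lambda>x. E x - q x) w)\<^sup>2 = 0" using LIMSEQ_unique by blast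
    thus ?thesis by simp
  qed
  with q v lim show ?thesis by blast
qed

text \<open>Pythagoras: with \<open>q\<close> the projection of \<open>E\<close> onto the closure of \<open>W\<close> and \<open>r = E - q\<close>, the distance
  of \<open>E\<close> to the orthogonal complement of \<open>W\<close> is \<open>\<parallel>q\<parallel>\<close>, attained at \<open>r\<close>, and its distance to \<open>W\<close> is
  \<open>\<parallel>r\<parallel>\<close>, approached along the sequence that converges to \<open>q\<close>.\<close>

theorem L2_orthogonal_split_INF:
  fixes E :: "'a \<Rightarrow> 'b::euclidean_space"
  assumes fin: "finite_measure M" and W: "W \<subseteq> L2 M" "W \<noteq> {}"
    and lin: "\<And>v w c. v \<in> W \<Longrightarrow> w \<in> W \<Longrightarrow> (\<lambda>x. v x + c *\<^sub>R w x) \<in> W"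
    and E: "E \<in> L2 M"
  shows "(L2_norm M E)\<^sup>2 =
    (INF p\<in>{p\<in>L2 M. \<forall>w\<in>W. L2_inner M p w = 0}. (L2_norm M (\<lambda>x. E x - p x))\<^sup>2) +
    (INF w\<in>W. (L2_norm M (\<lambda>x. E x - w x))\<^sup>2)"
proof -
  obtain q v where q: "q \<in> L2 M" and v: "\<And>k. v k \<in> W"
    and lim: "(\<lambda>k. L2_norm M (\<lambda>x. v k x - q x)) \<longlonglongrightarrow> 0"
    and orth: "\<And>w. w \<in> W \<Longrightarrow> L2_inner M (\<lambda>x. E x - q x) w = 0"
    using L2_projection[OF assms] by blast
  define r where "r = (\<lambda>x. E x - q x)"
  define P where "P = {p\<in>L2 M. \<forall>w\<in>W. L2_inner M p w = 0}"
  have vL: "v k \<in> L2 M" for k using v W by auto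
  have rL: "r \<in> L2 M" unfolding r_def by (intro L2_diff E q)
  have rP: "r \<in> P" using rL orth by (auto simp: P_def r_def)
  have Pq: "L2_inner M p q = 0" if "p \<in> P" for p
  proof -
    have "(\<lambda>k. L2_inner M (v k) p) \<longlonglongrightarrow> L2_inner M q p"
      using that by (intro L2_inner_tendsto vL q lim) (auto simp: P_def)
    moreover have "L2_inner M (v k) p = 0" for k
      using that v by (auto simp: P_def L2_inner_commute)
    ultimately have "L2_inner M q p = 0" using LIMSEQ_unique[OF _ tendsto_const] by simp
    thus ?thesis by (simp add: L2_inner_commute)
  qed
  have Eeq: "(L2_norm M E)\<^sup>2 = (L2_norm M q)\<^sup>2 + (L2_norm M r)\<^sup>2"
  proof -
    have "(L2_norm M (\<lambda>x. r x + 1 *\<^sub>R q x))\<^sup>2 = (L2_norm M q)\<^sup>2 + (L2_norm M r)\<^sup>2"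
      unfolding L2_norm_sq_add_scaleR[OF rL q] using Pq[OF rP] by simp
    thus ?thesis by (simp add: r_def)
  qed
  have infP: "(INF p\<in>P. (L2_norm M (\<lambda>x. E x - p x))\<^sup>2) = (L2_norm M q)\<^sup>2"
  proof (rule cInf_eq_minimum)
    show "(L2_norm M q)\<^sup>2 \<in> (\<lambda>p. (L2_norm M (\<lambda>x. E x - p x))\<^sup>2) ` P"
      using rP by (intro image_eqI[of _ _ r]) (auto simp: r_def)
    fix y assume "y \<in> (\<lambda>p. (L2_norm M (\<lambda>x. E x - p x))\<^sup>2) ` P"
    then obtain p where p: "p \<in> P" and y: "y = (L2_norm M (\<lambda>x. E x - p x))\<^sup>2" by auto
    have pL: "p \<in> L2 M" using p by (simp add: P_def)
    have rp: "(\<lambda>x. r x - p x) \<in> L2 M" by (intro L2_diff rL pL)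
    have "L2_inner M (\<lambda>x. r x - p x) q = 0"
      using Pq[OF p] Pq[OF rP] by (simp add: L2_inner_diff_left rL pL q)
    hence "(L2_norm M (\<lambda>x. (r x - p x) + 1 *\<^sub>R q x))\<^sup>2 = (L2_norm M (\<lambda>x. r x - p x))\<^sup>2 + (L2_norm M q)\<^sup>2"
      unfolding L2_norm_sq_add_scaleR[OF rp q] by simp
    moreover have "(\<lambda>x. (r x - p x) + 1 *\<^sub>R q x) = (\<lambda>x. E x - p x)" by (auto simp: r_def)
    ultimately show "(L2_norm M q)\<^sup>2 \<le> y" by (simp add: y)
  qed
  have split: "(L2_norm M (\<lambda>x. E x - w x))\<^sup>2 = (L2_norm M r)\<^sup>2 + (L2_norm M (\<lambda>x. w x - q x))\<^sup>2"
    if "w \<in> W" for w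
  proof -
    have wL: "w \<in> L2 M" using that W by auto
    have wq: "(\<lambda>x. w x - q x) \<in> L2 M" by (intro L2_diff wL q)
    have "L2_inner M (\<lambda>x. w x - q x) r = 0"
      using Pq[OF rP] rP that
      by (simp add: L2_inner_diff_left rL wL q L2_inner_commute[of M w r]
        L2_inner_commute[of M q r] P_def)
    hence "L2_inner M r (\<lambda>x. w x - q x) = 0"
      by (simp only: L2_inner_commute[of M r "\<lambda>x. w x - q x"])
    hence "(L2_norm M (\<lambda>x. r x - (w x - q x)))\<^sup>2 = (L2_norm M r)\<^sup>2 + (L2_norm M (\<lambda>x. w x - q x))\<^sup>2"
      unfolding L2_norm_sq_diff[OF rL wq] by simp
    thus ?thesis by (simp add: r_def)
  qed
  have infW: "(INF w\<in>W. (L2_norm M (\<lambda>x. E x - w x))\<^sup>2) = (L2_norm M r)\<^sup>2"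
  proof (rule antisym)
    have "(\<lambda>k. (L2_norm M r)\<^sup>2 + (L2_norm M (\<lambda>x. v k x - q x))\<^sup>2) \<longlonglongrightarrow> (L2_norm M r)\<^sup>2 + 0\<^sup>2"
      by (intro tendsto_intros lim)
    hence "(\<lambda>k. (L2_norm M (\<lambda>x. E x - v k x))\<^sup>2) \<longlonglongrightarrow> (L2_norm M r)\<^sup>2"
      using split[OF v] by simp
    thus "(INF w\<in>W. (L2_norm M (\<lambda>x. E x - w x))\<^sup>2) \<le> (L2_norm M r)\<^sup>2"
      by (rule LIMSEQ_le_const)
         (auto intro!: exI[of _ 0] cINF_lower v bdd_belowI[of _ 0])
    show "(L2_norm M r)\<^sup>2 \<le> (INF w\<in>W. (L2_norm M (\<lambda>x. E x - w x))\<^sup>2)"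
      by (rule cINF_greatest[OF W(2)]) (simp add: split)
  qed
  show ?thesis using Eeq infP infW by (simp add: P_def)
qed

section \<open>Smooth functions and bumps on boxes\<close>

lemma grad_unique:
  assumes "(\<phi> has_derivative D) (at x)"
  shows "grad \<phi> x = (\<chi> i. D (axis i 1))"
  unfolding grad_def using frechet_derivative_at[OF assms] by simp

lemma has_derivative_grad:
  assumes "\<phi> differentiable (at x)"
  shows "(\<phi> has_derivative (\<lambda>h. grad \<phi> x \<bullet> h)) (at x)"
proof -
  obtain D where D: "(\<phi> has_derivative D) (at x)"
    using assms by (auto simp: differentiable_def)
  interpret linear D using D by (rule has_derivative_linear)
  have "D h = grad \<phi> x \<bullet> h" for h
  proof -
    have "D h = D (\<Sum>i\<in>UNIV. (h $ i) *\<^sub>R axis i 1)"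
      using basis_expansion[of h] by (simp add: scalar_mult_eq_scaleR)
    also have "\<dots> = (\<Sum>i\<in>UNIV. h $ i * D (axis i 1))"
      by (simp add: sum scale)
    also have "\<dots> = grad \<phi> x \<bullet> h"
      by (simp add: grad_unique[OF D] inner_vec_def mult.commute)
    finally show ?thesis .
  qed
  hence "D = (\<lambda>h. grad \<phi> x \<bullet> h)" by blast
  with D show ?thesis by simp
qed

lemma grad_add_scaled:
  assumes "\<phi> differentiable (at x)" "\<psi> differentiable (at x)"
  shows "grad (\<lambda>x. \<phi> x + c * \<psi> x) x = grad \<phi> x + c *\<^sub>R grad \<psi> x"
proof -
  have "((\<lambda>x. \<phi> x + c * \<psi> x) has_derivative (\<lambda>h. grad \<phi> x \<bullet> h + c * (grad \<psi> x \<bullet> h))) (at x)"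
    by (intro derivative_intros has_derivative_grad assms)
  from grad_unique[OF this] show ?thesis
    by (simp add: vec_eq_iff inner_axis)
qed

lemma grad_mult:
  assumes "\<phi> differentiable (at x)" "\<psi> differentiable (at x)"
  shows "grad (\<lambda>x. \<phi> x * \<psi> x) x = \<phi> x *\<^sub>R grad \<psi> x + \<psi> x *\<^sub>R grad \<phi> x"
proof -
  have "((\<lambda>x. \<phi> x * \<psi> x) has_derivative (\<lambda>h. \<phi> x * (grad \<psi> x \<bullet> h) + (grad \<phi> x \<bullet> h) * \<psi> x)) (at x)"
    by (intro derivative_intros has_derivative_grad assms)
  from grad_unique[OF this] show ?thesis
    by (simp add: vec_eq_iff inner_axis mult.commute)
qed

lemma Ck_SucD: "Ck (Suc k) \<phi> \<Longrightarrow> Ck k \<phi>"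
proof (induction k arbitrary: \<phi>)
  case 0
  thus ?case
    by (auto intro!: differentiable_imp_continuous_on simp: differentiable_on_def)
qed auto

lemma Ck_const: "Ck k (\<lambda>x. c)"
proof (induction k arbitrary: c)
  case (Suc k)
  have "grad (\<lambda>x. c) x $ i = 0" for x i
    using grad_unique[OF has_derivative_const[of c]] by simp
  thus ?case using Suc by simp
qed simp

lemma Ck_add_scaled: "Ck k \<phi> \<Longrightarrow> Ck k \<psi> \<Longrightarrow> Ck k (\<lambda>x. \<phi> x + c * \<psi> x)"
proof (induction k arbitrary: \<phi> \<psi>)
  case (Suc k)
  have "grad (\<lambda>x. \<phi> x + c * \<psi> x) x $ i = grad \<phi> x $ i + c * grad \<psi> x $ i" for x i
    using Suc.prems by (simp add: grad_add_scaled)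
  thus ?case using Suc by (auto intro!: derivative_intros)
qed (auto intro!: continuous_intros)

text \<open>The product rule turns the gradient of a product into a sum of products of \<open>C\<^sup>k\<close> functions, which
  is why the induction needs closure under sums and the inclusion of \<open>C\<^bsup>k+1\<^esup>\<close> in \<open>C\<^sup>k\<close>.\<close>

lemma Ck_mult: "Ck k \<phi> \<Longrightarrow> Ck k \<psi> \<Longrightarrow> Ck k (\<lambda>x. \<phi> x * \<psi> x)"
proof (induction k arbitrary: \<phi> \<psi>)
  case (Suc k)
  have eq: "grad (\<lambda>x. \<phi> x * \<psi> x) x $ i = \<phi> x * grad \<psi> x $ i + 1 * (\<psi> x * grad \<phi> x $ i)" for x i
    using Suc.prems by (simp add: grad_mult)
  have "Ck k (\<lambda>x. \<phi> x * grad \<psi> x $ i + 1 * (\<psi> x * grad \<phi> x $ i))" for i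
    using Suc.prems Ck_SucD[OF Suc.prems(1)] Ck_SucD[OF Suc.prems(2)]
    by (intro Ck_add_scaled Suc.IH) auto
  thus ?case using Suc.prems unfolding Ck.simps eq by (auto intro!: derivative_intros)
qed (auto intro!: continuous_intros)

lemma smooth_add_scaled: "smooth \<phi> \<Longrightarrow> smooth \<psi> \<Longrightarrow> smooth (\<lambda>x. \<phi> x + c * \<psi> x)"
  by (simp add: smooth_def Ck_add_scaled)

lemma smooth_mult: "smooth \<phi> \<Longrightarrow> smooth \<psi> \<Longrightarrow> smooth (\<lambda>x. \<phi> x * \<psi> x)"
  by (simp add: smooth_def Ck_mult)

lemma smooth_differentiable: "smooth \<phi> \<Longrightarrow> \<phi> differentiable (at x)"
  unfolding smooth_def by (metis Ck.simps(2))

lemma smooth_continuous: "smooth \<phi> \<Longrightarrow> continuous_on S \<phi>"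
  unfolding smooth_def by (metis Ck.simps(1) continuous_on_subset subset_UNIV)

lemma smooth_grad_continuous: "smooth \<phi> \<Longrightarrow> continuous_on S (grad \<phi>)"
proof -
  assume "smooth \<phi>"
  hence "Ck (Suc 0) \<phi>" by (auto simp: smooth_def)
  hence "continuous_on UNIV (\<lambda>x. \<chi> i. grad \<phi> x $ i)"
    by (intro continuous_on_vec_lambda) auto
  thus ?thesis by (auto intro: continuous_on_subset)
qed

text \<open>The standard smooth function that is flat at the origin, together with the functions
  \<open>exp (- 1/t) / t ^ n\<close> that arise from it by differentiation: the family is closed under
  derivatives up to linear combinations, so one induction gives smoothness of all its members.\<close>

definition flat :: "nat \<Rightarrow> real \<Rightarrow> real" where
  "flat n t = (if t \<le> 0 then 0 else exp (- (1 / t)) / t ^ n)"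

lemma flat_0_bounds: "0 \<le> flat 0 t" "flat 0 t \<le> 1"
  by (auto simp: flat_def)

text \<open>Only the origin is delicate. There the difference quotient from the right is
  \<open>y ^ Suc n / exp y\<close> at \<open>y = 1/t\<close>, and the exponential wins.\<close>

lemma flat_has_derivative:
  "(flat n has_real_derivative (flat (n + 2) t - real n * flat (n + 1) t)) (at t)"
proof -
  consider "t < 0" | "t = 0" | "t > 0" by linarith
  thus ?thesis
  proof cases
    case 1
    have "((\<lambda>_. 0) has_real_derivative 0) (at t)" by simp
    hence "(flat n has_real_derivative 0) (at t)"
      by (rule has_field_derivative_transform_within_open[of _ _ _ "{..<0}"])
         (use 1 in \<open>auto simp: flat_def\<close>)
    thus ?thesis using 1 by (simp add: flat_def)
  next
    case 3
    have "((\<lambda>t. exp (- (1 / t)) * inverse (t ^ n)) has_real_derivative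
        (flat (n + 2) t - real n * flat (n + 1) t)) (at t)"
      using 3 by (auto intro!: derivative_eq_intros simp: flat_def)
        (cases n; simp add: field_simps power2_eq_square)
    thus ?thesis
      by (rule has_field_derivative_transform_within_open[of _ _ _ "{0<..}"])
         (use 3 in \<open>auto simp: flat_def field_simps\<close>)
  next
    case 2
    have "((\<lambda>y::real. y ^ Suc n / exp y) \<longlongrightarrow> 0) at_top"
      by (rule tendsto_power_div_exp_0)
    hence "((\<lambda>h::real. inverse h ^ Suc n / exp (inverse h)) \<longlongrightarrow> 0) (at_right 0)"
      by (rule filterlim_compose[OF _ filterlim_inverse_at_top_right])
    hence r: "((\<lambda>h. flat n h / h) \<longlongrightarrow> 0) (at_right 0)"
      by (rule Lim_transform_eventually)
         (auto simp: flat_def eventually_at_right_less field_simps exp_minus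
           intro!: eventually_mono[OF eventually_at_right_less[of 0]])
    have "((\<lambda>h::real. 0::real) \<longlongrightarrow> 0) (at_left 0)" by simp
    hence l: "((\<lambda>h. flat n h / h) \<longlongrightarrow> 0) (at_left 0)"
      by (rule Lim_transform_eventually)
         (auto simp: flat_def eventually_at_filter)
    have "((\<lambda>h. flat n h / h) \<longlongrightarrow> 0) (at 0)"
      using l r by (rule filterlim_split_at)
    hence "(flat n has_real_derivative 0) (at 0)"
      by (simp add: has_field_derivative_iff) (simp add: flat_def)
    thus ?thesis using 2 by (simp add: flat_def)
  qed
qed

lemma Ck_flat_affine: "Ck k (\<lambda>x. flat n (\<alpha> + \<beta> * x $ i))"
proof (induction k arbitrary: n)
  case 0
  have "isCont (flat n) t" for t
    using flat_has_derivative by (rule DERIV_isCont)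
  hence "continuous_on UNIV (flat n)" by (simp add: continuous_at_imp_continuous_on)
  thus ?case
    unfolding Ck.simps by (rule continuous_on_compose2) (auto intro!: continuous_intros)
next
  case (Suc k)
  have D: "((\<lambda>x. flat n (\<alpha> + \<beta> * x $ i)) has_derivative
      (\<lambda>h. (flat (n + 2) (\<alpha> + \<beta> * x $ i) - real n * flat (n + 1) (\<alpha> + \<beta> * x $ i)) * (\<beta> * h $ i))) (at x)"
    for x
  proof -
    have "((\<lambda>x. \<alpha> + \<beta> * x $ i) has_derivative (\<lambda>h. \<beta> * h $ i)) (at x)"
      by (auto intro!: derivative_eq_intros bounded_linear.has_derivative[OF bounded_linear_vec_nth])
    from has_derivative_compose[OF this flat_has_derivative[unfolded has_field_derivative_def]]
    show ?thesis .
  qed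
  have eq: "grad (\<lambda>x. flat n (\<alpha> + \<beta> * x $ i)) x $ j =
    (if j = i then \<beta> else 0) * (flat (n + 2) (\<alpha> + \<beta> * x $ i) + - real n * flat (n + 1) (\<alpha> + \<beta> * x $ i))" for x j
    unfolding grad_unique[OF D] by (simp add: axis_def)
  have "Ck k (\<lambda>x. (if j = i then \<beta> else 0) * (flat (n + 2) (\<alpha> + \<beta> * x $ i) + - real n * flat (n + 1) (\<alpha> + \<beta> * x $ i)))" for j
    by (intro Ck_mult Ck_const Ck_add_scaled Suc.IH)
  thus ?case unfolding Ck.simps eq using D by (auto simp: differentiable_def)
qed

text \<open>A product of four one-sided cut-offs, one for each side of the rectangle. Increasing \<open>m\<close>
  steepens the cut-offs, so that the functions increase to the indicator of the open box.\<close>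

definition box_bump :: "nat \<Rightarrow> real^2 \<Rightarrow> real^2 \<Rightarrow> real^2 \<Rightarrow> real" where
  "box_bump m a b x =
     (flat 0 (real m * (x $ 1 - a $ 1)) * flat 0 (real m * (b $ 1 - x $ 1))) *
     (flat 0 (real m * (x $ 2 - a $ 2)) * flat 0 (real m * (b $ 2 - x $ 2)))"

lemma smooth_box_bump: "smooth (box_bump m a b)"
proof -
  have 1: "real m * (x $ i - a $ i) = - (real m * a $ i) + real m * x $ i" for x i
    by (simp add: algebra_simps)
  have 2: "real m * (b $ i - x $ i) = real m * b $ i + (- real m) * x $ i" for x i
    by (simp add: algebra_simps)
  show ?thesis
    unfolding smooth_def box_bump_def[abs_def] 1 2 by (intro allI Ck_mult Ck_flat_affine)
qed

lemma box_bump_bounds: "0 \<le> box_bump m a b x" "box_bump m a b x \<le> 1"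
  unfolding box_bump_def by (intro mult_nonneg_nonneg mult_le_one flat_0_bounds)+

lemma box_bump_outside: "x \<notin> box a b \<Longrightarrow> box_bump m a b x = 0"
  by (auto simp: box_bump_def mem_box_cart forall_2 flat_def not_less mult_nonneg_nonpos)

lemma box_bump_inside:
  assumes "x \<in> box a b"
  shows "(\<lambda>m. box_bump m a b x) \<longlonglongrightarrow> 1"
proof -
  have flat: "(\<lambda>m. flat 0 (real m * t)) \<longlonglongrightarrow> 1" if "t > 0" for t
  proof -
    have "(\<lambda>m. exp (- ((1 / t) * inverse (real m)))) \<longlonglongrightarrow> exp (- ((1 / t) * 0))"
      by (intro tendsto_intros lim_inverse_n)
    hence "(\<lambda>m. exp (- ((1 / t) * inverse (real m)))) \<longlonglongrightarrow> 1" by simp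
    thus ?thesis
      by (rule Lim_transform_eventually)
         (use that in \<open>auto simp: flat_def field_simps mult_le_0_iff
           intro!: eventually_mono[OF eventually_gt_at_top[of 0]]\<close>)
  qed
  have "(\<lambda>m. box_bump m a b x) \<longlonglongrightarrow> (1 * 1) * (1 * 1)"
    unfolding box_bump_def
    using assms by (intro tendsto_mult flat) (auto simp: mem_box_cart)
  thus ?thesis by simp
qed

lemma box_bump_test_function:
  assumes "cbox a b \<subseteq> \<Omega>"
  shows "box_bump m a b \<in> test_functions \<Omega>"
proof -
  have "{x. box_bump m a b x \<noteq> 0} \<subseteq> cbox a b"
    using box_bump_outside box_subset_cbox by blast
  hence cl: "closure {x. box_bump m a b x \<noteq> 0} \<subseteq> cbox a b"
    by (rule closure_minimal) (rule closed_cbox)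
  hence "compact (closure {x. box_bump m a b x \<noteq> 0})"
    by (meson closed_closure compact_cbox compact_Int_closed compact_eq_bounded_closed bounded_subset bounded_cbox)
  thus ?thesis using cl assms smooth_box_bump by (auto simp: test_functions_def)
qed

section \<open>Measurability and integrability on bounded sets\<close>

text \<open>Products with \<open>A\<close> are known only almost everywhere, since \<open>A\<close> is arbitrary on interfaces.
  Completeness of the measure makes them measurable nevertheless.\<close>

lemma (in complete_measure) borel_measurable_cong_AE:
  fixes f g :: "'a \<Rightarrow> 'b::topological_space"
  assumes f: "f \<in> borel_measurable M" and ae: "AE x in M. f x = g x"
  shows "g \<in> borel_measurable M"
proof (rule measurableI)
  fix B :: "'b set" assume B: "B \<in> sets borel"
  obtain N where N: "{x\<in>space M. f x \<noteq> g x} \<subseteq> N" "N \<in> null_sets M"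
    using ae by (auto elim!: AE_E simp: null_sets_def)
  have "g -` B \<inter> space M = (f -` B \<inter> space M - N) \<union> (g -` B \<inter> space M \<inter> N)"
    using N(1) by auto
  moreover have "f -` B \<inter> space M - N \<in> sets M"
    using measurable_sets[OF f B] N(2) by (auto simp: null_sets_def)
  moreover have "g -` B \<inter> space M \<inter> N \<in> sets M"
    using N(2) by (rule complete[rotated]) auto
  ultimately show "g -` B \<inter> space M \<in> sets M" by (metis sets.Un)
qed simp

lemma complete_measure_lebesgue_on:
  assumes "S \<in> sets lebesgue"
  shows "complete_measure (lebesgue_on S)"
proof
  fix A B :: "'a set" assume BA: "B \<subseteq> A" and A: "A \<in> null_sets (lebesgue_on S)"
  have "A \<in> null_sets lebesgue" "A \<subseteq> S"
    using A assms by (auto simp: null_sets_restrict_space)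
  with BA have "B \<in> sets lebesgue" "B \<subseteq> S"
    using completion.complete by blast+
  thus "B \<in> sets (lebesgue_on S)"
    using assms by (auto simp: sets_restrict_space)
qed

lemmas borel_measurable_lebesgue_on_cong_AE =
  complete_measure.borel_measurable_cong_AE[OF complete_measure_lebesgue_on]

lemma finite_measure_lebesgue_on_bounded:
  "S \<in> sets lebesgue \<Longrightarrow> bounded S \<Longrightarrow> finite_measure (lebesgue_on S)"
  by (intro finite_measure_lebesgue_on bounded_set_imp_lmeasurable)

lemma L2_bounded:
  assumes "finite_measure M" "v \<in> borel_measurable M" "\<And>x. x \<in> space M \<Longrightarrow> norm (v x) \<le> C"
  shows "v \<in> L2 M"
proof -
  interpret finite_measure M by fact
  have "integrable M (\<lambda>x. (norm (v x))\<^sup>2)"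
    using assms by (intro integrable_const_bound[of _ "C\<^sup>2"]) (auto intro!: power_mono)
  with assms show ?thesis by (simp add: L2_def)
qed

lemma L2_continuous:
  fixes v :: "'a::euclidean_space \<Rightarrow> 'b::euclidean_space"
  assumes "S \<in> sets lebesgue" "bounded S" "continuous_on UNIV v"
  shows "v \<in> L2 (lebesgue_on S)"
proof -
  have "compact (v ` closure S)"
    using assms by (intro compact_continuous_image) (auto intro: continuous_on_subset)
  hence "bounded (v ` closure S)" by (rule compact_imp_bounded)
  then obtain C where "\<And>x. x \<in> closure S \<Longrightarrow> norm (v x) \<le> C" by (auto simp: bounded_iff)
  moreover have "v \<in> borel_measurable (lebesgue_on S)"
    using assms by (intro continuous_imp_measurable_on_sets_lebesgue) (auto intro: continuous_on_subset)
  ultimately show ?thesis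
    using closure_subset[of S] assms
    by (intro L2_bounded[of _ _ C] finite_measure_lebesgue_on_bounded) auto
qed

lemma L2_integrable:
  fixes v :: "'a \<Rightarrow> 'b::euclidean_space"
  assumes "finite_measure M" "v \<in> L2 M"
  shows "integrable M v"
proof -
  interpret finite_measure M by fact
  show ?thesis
  proof (rule Bochner_Integration.integrable_bound)
    show "integrable M (\<lambda>x. 1 + (norm (v x))\<^sup>2)" using assms by (simp add: L2_def)
    show "AE x in M. norm (v x) \<le> norm (1 + (norm (v x))\<^sup>2)"
    proof (intro AE_I2)
      fix x
      have "2 * norm (v x) \<le> 1 + (norm (v x))\<^sup>2"
        using sum_squares_bound[of 1 "norm (v x)"] by simp
      hence "norm (v x) \<le> 1 + (norm (v x))\<^sup>2" using norm_ge_zero[of "v x"] by linarith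
      thus "norm (v x) \<le> norm (1 + (norm (v x))\<^sup>2)" by simp
    qed
  qed (use assms in \<open>auto simp: L2_def\<close>)
qed

lemma L2_integrable_scaleR:
  assumes "\<phi> \<in> L2 M" "G \<in> L2 M"
  shows "integrable M (\<lambda>x. \<phi> x *\<^sub>R G x)"
proof (rule Bochner_Integration.integrable_bound)
  show "integrable M (\<lambda>x. (norm (\<phi> x))\<^sup>2 + (norm (G x))\<^sup>2)"
    using assms by (simp add: L2_def)
  show "(\<lambda>x. \<phi> x *\<^sub>R G x) \<in> borel_measurable M"
    using assms by (auto simp: L2_def)
  show "AE x in M. norm (\<phi> x *\<^sub>R G x) \<le> norm ((norm (\<phi> x))\<^sup>2 + (norm (G x))\<^sup>2)"
  proof (intro AE_I2)
    fix x
    have "norm (\<phi> x) * norm (G x) \<le> (norm (\<phi> x))\<^sup>2 + (norm (G x))\<^sup>2"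
      using sum_squares_bound[of "norm (\<phi> x)" "norm (G x)"]
        mult_nonneg_nonneg[OF norm_ge_zero[of "\<phi> x"] norm_ge_zero[of "G x"]] by linarith
    thus "norm (\<phi> x *\<^sub>R G x) \<le> norm ((norm (\<phi> x))\<^sup>2 + (norm (G x))\<^sup>2)" by simp
  qed
qed

section \<open>The fundamental lemma and integrals of gradients\<close>

text \<open>Testing with the bumps of a box, which converge boundedly to its indicator, shows that \<open>h\<close> has
  integral zero over every box inside \<open>\<Omega>\<close>. Lebesgue's differentiation theorem recovers \<open>h\<close> at almost
  every point from its means over small boxes.\<close>

lemma fundamental_lemma_calculus_of_variations:
  fixes h :: "real^2 \<Rightarrow> real"
  assumes \<Omega>: "open \<Omega>" and h: "integrable (lebesgue_on \<Omega>) h"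
    and test: "\<And>\<phi>. \<phi> \<in> test_functions \<Omega> \<Longrightarrow> (LINT x|lebesgue_on \<Omega>. \<phi> x * h x) = 0"
  shows "AE x in lebesgue_on \<Omega>. h x = 0"
proof -
  have [measurable]: "\<Omega> \<in> sets lebesgue" using \<Omega> by auto
  have hm[measurable]: "h \<in> borel_measurable (lebesgue_on \<Omega>)" using h by auto
  define f where "f x = (if x \<in> \<Omega> then h x else 0)" for x
  have f: "integrable lebesgue f"
  proof -
    have "f = (\<lambda>x. indicator \<Omega> x *\<^sub>R h x)" by (auto simp: f_def)
    thus ?thesis using h by (simp add: integrable_restrict_space)
  qed
  hence fi: "f integrable_on cbox a b" for a b
    by (meson integrable_on_lebesgue integrable_on_subcbox subset_UNIV)
  have box0: "integral (cbox a b) f = 0" if ab: "cbox a b \<subseteq> \<Omega>" for a b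
  proof -
    have bO: "box a b \<subseteq> \<Omega>" using ab box_subset_cbox by blast
    have "(\<lambda>m. LINT x|lebesgue_on \<Omega>. box_bump m a b x * h x)
        \<longlonglongrightarrow> (LINT x|lebesgue_on \<Omega>. (if x \<in> box a b then h x else 0))"
    proof (rule integral_dominated_convergence)
      show "integrable (lebesgue_on \<Omega>) (\<lambda>x. norm (h x))" using h by simp
      show "(\<lambda>x. if x \<in> box a b then h x else 0) \<in> borel_measurable (lebesgue_on \<Omega>)"
      proof -
        have "(indicator (box a b) :: real^2 \<Rightarrow> real) \<in> borel_measurable (lebesgue_on \<Omega>)"
          by (intro measurable_restrict_space1 borel_measurable_indicator) auto
        from borel_measurable_times[OF this hm]
        have "(\<lambda>x. indicator (box a b) x * h x) \<in> borel_measurable (lebesgue_on \<Omega>)" .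
        also have "(\<lambda>x. indicator (box a b) x * h x) = (\<lambda>x. if x \<in> box a b then h x else 0)"
          by (auto simp: indicator_def)
        finally show ?thesis .
      qed
      show "(\<lambda>x. box_bump m a b x * h x) \<in> borel_measurable (lebesgue_on \<Omega>)" for m
      proof -
        have "box_bump m a b \<in> borel_measurable (lebesgue_on \<Omega>)"
          using smooth_box_bump smooth_continuous
          by (intro continuous_imp_measurable_on_sets_lebesgue) auto
        thus ?thesis by simp
      qed
      show "AE x in lebesgue_on \<Omega>. (\<lambda>m. box_bump m a b x * h x) \<longlonglongrightarrow> (if x \<in> box a b then h x else 0)"
      proof (intro AE_I2)
        fix x
        show "(\<lambda>m. box_bump m a b x * h x) \<longlonglongrightarrow> (if x \<in> box a b then h x else 0)"
          using tendsto_mult_right[OF box_bump_inside, of x a b "h x"]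
          by (simp add: box_bump_outside)
      qed
      show "AE x in lebesgue_on \<Omega>. norm (box_bump m a b x * h x) \<le> norm (h x)" for m
        using box_bump_bounds by (auto simp: abs_mult intro!: mult_left_le_one_le)
    qed
    moreover have "(LINT x|lebesgue_on \<Omega>. box_bump m a b x * h x) = 0" for m
      by (rule test[OF box_bump_test_function[OF ab]])
    ultimately have "(LINT x|lebesgue_on \<Omega>. (if x \<in> box a b then h x else 0)) = 0"
      using LIMSEQ_unique[OF _ tendsto_const] by fastforce
    hence "(LINT x|lebesgue_on (box a b). h x) = 0"
      using bO by (simp add: integral_restrict)
    moreover have "integrable (lebesgue_on (box a b)) h"
    proof -
      have "integrable lebesgue (\<lambda>x. indicator (box a b) x *\<^sub>R f x)"
        using f by (intro integrable_mult_indicator) auto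
      moreover have "(\<lambda>x. indicator (box a b) x *\<^sub>R f x) = (\<lambda>x. indicator (box a b) x *\<^sub>R h x)"
        using bO by (intro ext) (auto simp: f_def split: split_indicator)
      ultimately show ?thesis by (simp add: integrable_restrict_space)
    qed
    ultimately have "integral (box a b) h = 0"
      by (simp add: lebesgue_integral_eq_integral)
    hence "integral (cbox a b) h = 0" by (simp add: integral_open_interval)
    moreover have "integral (cbox a b) h = integral (cbox a b) f"
      using ab by (intro integral_cong) (auto simp: f_def)
    ultimately show ?thesis by simp
  qed
  obtain N where N: "negligible N"
    and lim: "\<And>x e. \<lbrakk>x \<notin> N; 0 < e\<rbrakk> \<Longrightarrow> \<exists>d>0. \<forall>h. 0 < h \<and> h < d \<longrightarrow>
      norm (integral (cbox x (x + h *\<^sub>R One)) f /\<^sub>R h ^ DIM(real^2) - f x) < e"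
    using integrable_ccontinuous_explicit[of f, OF fi] by blast
  have zero: "h x = 0" if x: "x \<in> \<Omega>" "x \<notin> N" for x
  proof (rule ccontr)
    assume "h x \<noteq> 0"
    hence "0 < norm (f x)" using x by (simp add: f_def)
    from lim[OF x(2) this] obtain d where d: "d > 0"
      and small: "\<And>h. 0 < h \<Longrightarrow> h < d \<Longrightarrow>
        norm (integral (cbox x (x + h *\<^sub>R One)) f /\<^sub>R h ^ DIM(real^2) - f x) < norm (f x)"
      by blast
    obtain r where r: "r > 0" "ball x r \<subseteq> \<Omega>" using \<Omega> x open_contains_ball by blast
    \<comment> \<open>the box of side \<open>s\<close> at \<open>x\<close> has diameter at most \<open>2 s\<close> and must fit into the ball of radius \<open>r\<close>\<close>
    define s where "s = min d (r / 2) / 2"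
    have s: "0 < s" "s < d" "2 * s < r" using d r by (auto simp: s_def)
    have "cbox x (x + s *\<^sub>R One) \<subseteq> ball x r"
    proof
      fix y assume y: "y \<in> cbox x (x + s *\<^sub>R One)"
      have "norm (y - x) \<le> (\<Sum>i\<in>Basis. \<bar>(y - x) \<bullet> i\<bar>)" by (rule norm_le_l1)
      also have "\<dots> \<le> (\<Sum>i\<in>(Basis :: (real^2) set). s)"
        using y by (intro sum_mono) (auto simp: mem_box inner_diff_left inner_add_left abs_le_iff)
      also have "\<dots> = 2 * s" by simp
      finally show "y \<in> ball x r" using s by (simp add: dist_norm norm_minus_commute)
    qed
    with r have "integral (cbox x (x + s *\<^sub>R One)) f = 0" by (intro box0) auto
    with small[OF s(1,2)] show False by simp
  qed
  have "AE x in lebesgue. x \<notin> N"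
    using N by (simp add: negligible_iff_null_sets AE_not_in)
  hence "AE x in lebesgue. x \<in> \<Omega> \<longrightarrow> h x = 0"
    by eventually_elim (use zero in blast)
  thus ?thesis by (simp add: AE_restrict_space_iff)
qed

text \<open>Translation invariance of Lebesgue measure: the difference quotients of \<open>F\<close> in the direction of the
  \<open>i\<close>-th axis integrate to zero and converge to the partial derivative. Dominated convergence
  applies because \<open>F\<close> is Lipschitz with compact support.\<close>

lemma integral_grad_compact_support:
  assumes F: "smooth F" and K: "compact (closure {x. F x \<noteq> 0})"
  shows "integrable lebesgue (\<lambda>x. grad F x $ i)" "(LINT x|lebesgue. grad F x $ i) = 0"
proof -
  obtain R where R: "\<And>x. x \<in> closure {x. F x \<noteq> 0} \<Longrightarrow> norm x \<le> R"
    using compact_imp_bounded[OF K] by (auto simp: bounded_iff)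
  have F0: "F x = 0" if "norm x > R" for x
    using R[of x] closure_subset[of "{x. F x \<noteq> 0}"] that by fastforce
  have gF0: "grad F x = 0" if x: "norm x > R" for x
  proof -
    have "((\<lambda>_. 0) has_derivative (\<lambda>_. 0)) (at x)" by simp
    hence "(F has_derivative (\<lambda>_. 0)) (at x)"
      by (rule has_derivative_transform_within_open[of _ _ _ UNIV "- cball 0 R"])
         (use x F0 in \<open>auto simp: open_Compl\<close>)
    from grad_unique[OF this] show ?thesis by (simp add: vec_eq_iff)
  qed
  have contF: "continuous_on S F" and contg: "continuous_on S (grad F)" for S
    using F smooth_continuous smooth_grad_continuous by auto
  have "bounded (F ` cball 0 R)" "bounded (grad F ` cball 0 R)"
    by (intro compact_imp_bounded compact_continuous_image contF contg compact_cball)+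
  then obtain B C where "\<forall>x\<in>cball 0 R. norm (F x) \<le> B"
    and "\<forall>x\<in>cball 0 R. norm (grad F x) \<le> C"
    unfolding bounded_iff by auto
  hence B: "norm (F x) \<le> B" and C: "norm (grad F x) \<le> C" if "norm x \<le> R" for x
    using that by auto
  define C' where "C' = max C 0"
  have C'0: "0 \<le> C'" and gC: "norm (grad F x) \<le> C'" for x
    using C[of x] gF0[of x] by (cases "norm x \<le> R"; auto simp: C'_def)+
  have lip: "norm (F x - F y) \<le> C' * norm (x - y)" for x y
  proof (rule differentiable_bound[of UNIV])
    show "(F has_derivative (\<lambda>h. grad F x \<bullet> h)) (at x within UNIV)" for x
      using has_derivative_grad[OF smooth_differentiable[OF F]] by simp
    show "onorm (\<lambda>h. grad F x \<bullet> h) \<le> C'" for x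
    proof (rule onorm_le)
      fix h
      have "norm (grad F x \<bullet> h) \<le> norm (grad F x) * norm h"
        using Cauchy_Schwarz_ineq2 by simp
      also have "\<dots> \<le> C' * norm h" by (intro mult_right_mono gC) simp
      finally show "norm (grad F x \<bullet> h) \<le> C' * norm h" .
    qed
  qed auto
  have Fm: "F \<in> borel_measurable borel" "grad F \<in> borel_measurable borel"
    by (intro borel_measurable_continuous_onI contF contg)+
  have ind: "integrable lborel (\<lambda>x. c * indicator (cball (0::real^2) r) x :: real)" for c r
    by (intro integrable_mult_right) (auto intro!: integrable_real_indicator emeasure_bounded_finite)
  have Fi: "integrable lborel F"
  proof (rule Bochner_Integration.integrable_bound[OF ind[of B R]])
    show "AE x in lborel. norm (F x) \<le> norm (B * indicator (cball 0 R) x)"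
    proof (intro AE_I2)
      fix x
      show "norm (F x) \<le> norm (B * indicator (cball 0 R) x)"
      proof (cases "norm x \<le> R")
        case True
        from B[OF this] have "\<bar>F x\<bar> \<le> \<bar>B\<bar>" by simp
        thus ?thesis using True by simp
      qed (simp add: F0)
    qed
  qed (use Fm in auto)
  define e :: "real^2" where "e = axis i 1"
  have ne: "norm e = 1" by (simp add: e_def)
  define t where "t n = inverse (real (Suc n))" for n
  have t: "0 < t n" "t n \<le> 1" for n by (auto simp: t_def divide_simps)
  have t0: "t \<longlonglongrightarrow> 0" unfolding t_def by (rule LIMSEQ_inverse_real_of_nat)
  define q where "q n x = (F (x + t n *\<^sub>R e) - F x) / t n" for n x
  have shift: "integrable lborel (\<lambda>x. F (x + v))" "(LINT x|lborel. F (x + v)) = (LINT x|lborel. F x)" for v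
  proof -
    have d: "distr lborel borel ((+) v) = lborel" by (rule lborel_distr_plus)
    show "integrable lborel (\<lambda>x. F (x + v))"
      using integrable_distr_eq[of "(+) v" lborel borel F] Fi Fm unfolding d
      by (simp add: add.commute)
    show "(LINT x|lborel. F (x + v)) = (LINT x|lborel. F x)"
      using integral_distr[of "(+) v" lborel borel F] Fm unfolding d
      by (simp add: add.commute)
  qed
  have q0: "(LINT x|lborel. q n x) = 0" for n
    unfolding q_def using shift Fi by simp
  \<comment> \<open>steps have length at most 1, so the quotients vanish outside a ball of radius \<open>R + 1\<close>\<close>
  have dom: "norm (q n x) \<le> C' * indicator (cball 0 (R + 1)) x" for n x
  proof (cases "norm x \<le> R + 1")
    case True
    have "norm (F (x + t n *\<^sub>R e) - F x) \<le> C' * t n"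
      using lip[of "x + t n *\<^sub>R e" x] ne t[of n] by simp
    thus ?thesis using True t[of n] by (simp add: q_def field_simps)
  next
    case False
    have "norm x \<le> norm (x + t n *\<^sub>R e) + norm (t n *\<^sub>R e)"
      using norm_triangle_ineq4[of "x + t n *\<^sub>R e" "t n *\<^sub>R e"] by simp
    hence "norm (x + t n *\<^sub>R e) > R" using False ne t[of n] by simp
    thus ?thesis using False F0 by (simp add: q_def)
  qed
  have lim: "(\<lambda>n. q n x) \<longlonglongrightarrow> grad F x $ i" for x
  proof -
    have "((\<lambda>s. x + s *\<^sub>R e) has_derivative (\<lambda>s. s *\<^sub>R e)) (at 0)"
      by (auto intro!: derivative_eq_intros)
    moreover have "(F has_derivative (\<lambda>h. grad F x \<bullet> h)) (at (x + 0 *\<^sub>R e))"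
      using has_derivative_grad[OF smooth_differentiable[OF F]] by simp
    ultimately have "((\<lambda>s. F (x + s *\<^sub>R e)) has_derivative (\<lambda>s. grad F x \<bullet> (s *\<^sub>R e))) (at 0)"
      by (rule has_derivative_compose)
    hence "((\<lambda>s. F (x + s *\<^sub>R e)) has_real_derivative grad F x $ i) (at 0)"
      by (simp add: has_field_derivative_def e_def inner_axis mult_commute_abs)
    hence "((\<lambda>s. (F (x + s *\<^sub>R e) - F x) / s) \<longlongrightarrow> grad F x $ i) (at 0)"
      by (simp add: has_field_derivative_iff)
    moreover have "filterlim t (at 0) sequentially"
      using t0 t(1) by (intro filterlim_atI) (auto simp: less_imp_neq[THEN not_sym])
    ultimately show ?thesis unfolding q_def by (rule filterlim_compose)
  qed
  have gm: "(\<lambda>x. grad F x $ i) \<in> borel_measurable lborel"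
  proof -
    have "(\<lambda>x. grad F x $ i) \<in> borel_measurable borel"
      by (intro borel_measurable_continuous_onI continuous_intros contg)
    thus ?thesis by simp
  qed
  have qm: "q n \<in> borel_measurable lborel" for n
    unfolding q_def using shift(1)[of "t n *\<^sub>R e"] Fi by auto
  have gi: "integrable lborel (\<lambda>x. grad F x $ i)"
    by (rule integrable_dominated_convergence[where s = q, OF gm qm ind[of C' "R + 1"]])
       (use lim dom in auto)
  have "(\<lambda>n. LINT x|lborel. q n x) \<longlonglongrightarrow> (LINT x|lborel. grad F x $ i)"
    by (rule integral_dominated_convergence[where s = q, OF gm qm ind[of C' "R + 1"]])
       (use lim dom in auto)
  hence "(LINT x|lborel. grad F x $ i) = 0"
    unfolding q0 using LIMSEQ_unique[OF _ tendsto_const] by fastforce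
  with gi gm show "integrable lebesgue (\<lambda>x. grad F x $ i)" "(LINT x|lebesgue. grad F x $ i) = 0"
    by (simp_all add: integrable_completion integral_completion)
qed

section \<open>Weak gradients and weak divergences\<close>

lemma grad_off_support:
  assumes "x \<notin> closure {x. \<phi> x \<noteq> 0}"
  shows "grad \<phi> x = 0"
proof -
  have "((\<lambda>_. 0) has_derivative (\<lambda>_. 0)) (at x)" by simp
  hence "(\<phi> has_derivative (\<lambda>_. 0)) (at x)"
  proof (rule has_derivative_transform_within_open[of _ _ _ UNIV "- closure {x. \<phi> x \<noteq> 0}"])
    fix y assume "y \<in> - closure {x. \<phi> x \<noteq> 0}"
    thus "0 = \<phi> y" using closure_subset[of "{x. \<phi> x \<noteq> 0}"] by auto
  qed (use assms in auto)
  from grad_unique[OF this] show ?thesis by (simp add: vec_eq_iff)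
qed

lemma test_function_smooth: "\<phi> \<in> test_functions \<Omega> \<Longrightarrow> smooth \<phi>"
  by (simp add: test_functions_def)

lemma test_function_off:
  assumes "\<phi> \<in> test_functions \<Omega>" "x \<notin> \<Omega>"
  shows "\<phi> x = 0" "grad \<phi> x = 0"
proof -
  have "x \<notin> closure {x. \<phi> x \<noteq> 0}" using assms by (auto simp: test_functions_def)
  thus "\<phi> x = 0" "grad \<phi> x = 0"
    using grad_off_support closure_subset[of "{x. \<phi> x \<noteq> 0}"] by blast+
qed

lemma test_functions_mono: "K \<subseteq> \<Omega> \<Longrightarrow> test_functions K \<subseteq> test_functions \<Omega>"
  by (auto simp: test_functions_def)

lemma smooth_L2:
  assumes "smooth \<phi>" "S \<in> sets lebesgue" "bounded S"
  shows "\<phi> \<in> L2 (lebesgue_on S)" "grad \<phi> \<in> L2 (lebesgue_on S)"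
  using assms by (auto intro!: L2_continuous smooth_continuous smooth_grad_continuous)

text \<open>Integration by parts: the product of \<open>\<phi>\<close> with a test function is smooth with compact support, so
  its gradient has integral zero.\<close>

lemma smooth_is_weak_grad:
  assumes \<Omega>: "open \<Omega>" "bounded \<Omega>" and \<phi>: "smooth \<phi>"
  shows "is_weak_grad \<Omega> \<phi> (grad \<phi>)"
  unfolding is_weak_grad_def
proof
  fix \<psi> assume \<psi>: "\<psi> \<in> test_functions \<Omega>"
  have m: "\<Omega> \<in> sets lebesgue" using \<Omega> by auto
  have sm: "smooth \<psi>" using \<psi> by (rule test_function_smooth)
  let ?F = "\<lambda>x. \<phi> x * \<psi> x"
  have F: "smooth ?F" using \<phi> sm by (rule smooth_mult)
  have sub: "closure {x. ?F x \<noteq> 0} \<subseteq> closure {x. \<psi> x \<noteq> 0}"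
    by (intro closure_mono) auto
  have K: "compact (closure {x. ?F x \<noteq> 0})"
    using \<psi> sub unfolding test_functions_def
    by (metis (no_types, lifting) bounded_subset closed_closure compact_eq_bounded_closed mem_Collect_eq)
  have F0: "grad ?F x = 0" if "x \<notin> \<Omega>" for x
    using \<psi> sub that by (intro grad_off_support) (auto simp: test_functions_def)
  have gF: "grad ?F x = \<phi> x *\<^sub>R grad \<psi> x + \<psi> x *\<^sub>R grad \<phi> x" for x
    by (intro grad_mult smooth_differentiable \<phi> sm)
  have i: "integrable (lebesgue_on \<Omega>) (\<lambda>x. \<phi> x *\<^sub>R grad \<psi> x)"
    "integrable (lebesgue_on \<Omega>) (\<lambda>x. \<psi> x *\<^sub>R grad \<phi> x)"
    by (intro L2_integrable_scaleR smooth_L2 \<phi> sm m \<Omega>)+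
  have comp: "(LINT x|lebesgue_on \<Omega>. grad ?F x) $ i = 0" for i
  proof -
    have "(LINT x|lebesgue_on \<Omega>. grad ?F x) $ i = (LINT x|lebesgue_on \<Omega>. grad ?F x $ i)"
      using i unfolding gF
      by (intro integral_bounded_linear[OF bounded_linear_vec_nth, symmetric]) auto
    also have "\<dots> = (LINT x|lebesgue. indicator \<Omega> x *\<^sub>R (grad ?F x $ i))"
      using m by (subst integral_restrict_space) auto
    also have "\<dots> = (LINT x|lebesgue. grad ?F x $ i)"
      by (intro Bochner_Integration.integral_cong refl) (auto simp: F0 split: split_indicator)
    also have "\<dots> = 0" by (rule integral_grad_compact_support[OF F K])
    finally show ?thesis .
  qed
  have "(LINT x|lebesgue_on \<Omega>. \<phi> x *\<^sub>R grad \<psi> x) + (LINT x|lebesgue_on \<Omega>. \<psi> x *\<^sub>R grad \<phi> x) =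
    (LINT x|lebesgue_on \<Omega>. grad ?F x)"
    unfolding gF using i by (rule Bochner_Integration.integral_add[symmetric])
  also have "\<dots> = 0" using comp by (simp add: vec_eq_iff)
  finally show "(LINT x|lebesgue_on \<Omega>. \<phi> x *\<^sub>R grad \<psi> x) = - (LINT x|lebesgue_on \<Omega>. \<psi> x *\<^sub>R grad \<phi> x)"
    by (rule add_eq_0_iff2[THEN iffD1])
qed

text \<open>Since \<open>wgrad\<close> is only some weak gradient, this uniqueness is what makes it linear, compatible with
  restriction to subsets and equal to the classical gradient, each almost everywhere.\<close>

lemma weak_grad_unique:
  assumes \<Omega>: "open \<Omega>" "bounded \<Omega>"
    and G: "G \<in> L2 (lebesgue_on \<Omega>)" "H \<in> L2 (lebesgue_on \<Omega>)"
    and w: "is_weak_grad \<Omega> v G" "is_weak_grad \<Omega> v H"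
  shows "AE x in lebesgue_on \<Omega>. G x = H x"
proof -
  have m: "\<Omega> \<in> sets lebesgue" using \<Omega> by auto
  have fin: "finite_measure (lebesgue_on \<Omega>)" using m \<Omega>(2) by (rule finite_measure_lebesgue_on_bounded)
  have GH: "(\<lambda>x. G x - H x) \<in> L2 (lebesgue_on \<Omega>)" using G by (rule L2_diff)
  have "AE x in lebesgue_on \<Omega>. (G x - H x) $ i = 0" for i
  proof (rule fundamental_lemma_calculus_of_variations[OF \<Omega>(1)])
    show "integrable (lebesgue_on \<Omega>) (\<lambda>x. (G x - H x) $ i)"
      using integrable_bounded_linear[OF bounded_linear_vec_nth L2_integrable[OF fin GH]] .
    fix \<phi> assume \<phi>: "\<phi> \<in> test_functions \<Omega>"
    have \<phi>L: "\<phi> \<in> L2 (lebesgue_on \<Omega>)"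
      using test_function_smooth[OF \<phi>] m \<Omega> by (intro smooth_L2)
    have "(LINT x|lebesgue_on \<Omega>. \<phi> x * (G x - H x) $ i) = (LINT x|lebesgue_on \<Omega>. (\<phi> x *\<^sub>R (G x - H x)) $ i)"
      by simp
    also have "\<dots> = (LINT x|lebesgue_on \<Omega>. \<phi> x *\<^sub>R (G x - H x)) $ i"
      by (rule integral_bounded_linear[OF bounded_linear_vec_nth L2_integrable_scaleR[OF \<phi>L GH]])
    also have "(LINT x|lebesgue_on \<Omega>. \<phi> x *\<^sub>R (G x - H x)) =
        (LINT x|lebesgue_on \<Omega>. \<phi> x *\<^sub>R G x) - (LINT x|lebesgue_on \<Omega>. \<phi> x *\<^sub>R H x)"
      unfolding scaleR_diff_right
      by (intro Bochner_Integration.integral_diff L2_integrable_scaleR \<phi>L G)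
    also have "(LINT x|lebesgue_on \<Omega>. \<phi> x *\<^sub>R G x) = (LINT x|lebesgue_on \<Omega>. \<phi> x *\<^sub>R H x)"
      using trans[OF sym[OF bspec[OF w(1)[unfolded is_weak_grad_def] \<phi>]]
        bspec[OF w(2)[unfolded is_weak_grad_def] \<phi>]]
      by (simp only: neg_equal_iff_equal)
    finally show "(LINT x|lebesgue_on \<Omega>. \<phi> x * (G x - H x) $ i) = 0" by simp
  qed
  hence "AE x in lebesgue_on \<Omega>. \<forall>i. (G x - H x) $ i = 0"
    by (subst AE_all_countable) auto
  thus ?thesis by eventually_elim (simp add: vec_eq_iff)
qed

lemma weak_div_unique:
  assumes \<Omega>: "open \<Omega>" "bounded \<Omega>"
    and d: "d \<in> L2 (lebesgue_on \<Omega>)" "e \<in> L2 (lebesgue_on \<Omega>)"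
    and w: "is_weak_div \<Omega> \<tau> d" "is_weak_div \<Omega> \<tau> e"
  shows "AE x in lebesgue_on \<Omega>. d x = e x"
proof -
  have m: "\<Omega> \<in> sets lebesgue" using \<Omega> by auto
  have fin: "finite_measure (lebesgue_on \<Omega>)" using m \<Omega>(2) by (rule finite_measure_lebesgue_on_bounded)
  have "AE x in lebesgue_on \<Omega>. d x - e x = 0"
  proof (rule fundamental_lemma_calculus_of_variations[OF \<Omega>(1)])
    show "integrable (lebesgue_on \<Omega>) (\<lambda>x. d x - e x)"
      by (rule L2_integrable[OF fin L2_diff[OF d]])
    fix \<phi> assume \<phi>: "\<phi> \<in> test_functions \<Omega>"
    have \<phi>L: "\<phi> \<in> L2 (lebesgue_on \<Omega>)"
      using test_function_smooth[OF \<phi>] m \<Omega> by (intro smooth_L2)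
    have "(LINT x|lebesgue_on \<Omega>. \<phi> x * (d x - e x)) =
        (LINT x|lebesgue_on \<Omega>. \<phi> x * d x) - (LINT x|lebesgue_on \<Omega>. \<phi> x * e x)"
      using L2_integrable_scaleR[OF \<phi>L d(1)] L2_integrable_scaleR[OF \<phi>L d(2)]
      by (simp add: right_diff_distrib)
    also have "(LINT x|lebesgue_on \<Omega>. \<phi> x * d x) = (LINT x|lebesgue_on \<Omega>. \<phi> x * e x)"
      using trans[OF sym[OF bspec[OF w(1)[unfolded is_weak_div_def] \<phi>]]
        bspec[OF w(2)[unfolded is_weak_div_def] \<phi>]]
      by (simp only: neg_equal_iff_equal)
    finally show "(LINT x|lebesgue_on \<Omega>. \<phi> x * (d x - e x)) = 0" by simp
  qed
  thus ?thesis by eventually_elim simp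
qed

lemma wgrad_H1:
  assumes "v \<in> H1 \<Omega>"
  shows "wgrad \<Omega> v \<in> L2 (lebesgue_on \<Omega>)" "is_weak_grad \<Omega> v (wgrad \<Omega> v)"
proof -
  have "\<exists>G. G \<in> L2 (lebesgue_on \<Omega>) \<and> is_weak_grad \<Omega> v G"
    using assms by (auto simp: H1_def)
  from someI_ex[OF this]
  show "wgrad \<Omega> v \<in> L2 (lebesgue_on \<Omega>)" "is_weak_grad \<Omega> v (wgrad \<Omega> v)"
    by (simp_all add: wgrad_def)
qed

lemma wgrad_eqI:
  assumes "open \<Omega>" "bounded \<Omega>" "v \<in> L2 (lebesgue_on \<Omega>)"
    "G \<in> L2 (lebesgue_on \<Omega>)" "is_weak_grad \<Omega> v G"
  shows "v \<in> H1 \<Omega>" "AE x in lebesgue_on \<Omega>. wgrad \<Omega> v x = G x"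
proof -
  show H1: "v \<in> H1 \<Omega>" using assms by (auto simp: H1_def)
  show "AE x in lebesgue_on \<Omega>. wgrad \<Omega> v x = G x"
    using assms wgrad_H1[OF H1] by (intro weak_grad_unique)
qed

lemma wdiv_eqI:
  assumes "open \<Omega>" "bounded \<Omega>" "\<tau> \<in> L2 (lebesgue_on \<Omega>)"
    "d \<in> L2 (lebesgue_on \<Omega>)" "is_weak_div \<Omega> \<tau> d"
  shows "\<tau> \<in> Hdiv \<Omega>" "wdiv \<Omega> \<tau> \<in> L2 (lebesgue_on \<Omega>)"
    "AE x in lebesgue_on \<Omega>. wdiv \<Omega> \<tau> x = d x"
proof -
  show "\<tau> \<in> Hdiv \<Omega>" using assms by (auto simp: Hdiv_def)
  have "\<exists>d. d \<in> L2 (lebesgue_on \<Omega>) \<and> is_weak_div \<Omega> \<tau> d" using assms by blast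
  from someI_ex[OF this]
  have *: "wdiv \<Omega> \<tau> \<in> L2 (lebesgue_on \<Omega>)" "is_weak_div \<Omega> \<tau> (wdiv \<Omega> \<tau>)"
    by (simp_all add: wdiv_def)
  show "wdiv \<Omega> \<tau> \<in> L2 (lebesgue_on \<Omega>)" by (rule *)
  show "AE x in lebesgue_on \<Omega>. wdiv \<Omega> \<tau> x = d x"
    using assms * by (intro weak_div_unique)
qed

lemma wgrad_smooth:
  assumes "open \<Omega>" "bounded \<Omega>" "smooth \<phi>"
  shows "\<phi> \<in> H1 \<Omega>" "AE x in lebesgue_on \<Omega>. wgrad \<Omega> \<phi> x = grad \<phi> x"
  using assms by (auto intro!: wgrad_eqI smooth_L2 smooth_is_weak_grad)

lemma wgrad_add_scaled:
  assumes \<Omega>: "open \<Omega>" "bounded \<Omega>" and v: "v \<in> H1 \<Omega>" and w: "w \<in> H1 \<Omega>"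
  shows "(\<lambda>x. v x + c * w x) \<in> H1 \<Omega>"
    "AE x in lebesgue_on \<Omega>. wgrad \<Omega> (\<lambda>x. v x + c * w x) x = wgrad \<Omega> v x + c *\<^sub>R wgrad \<Omega> w x"
proof -
  let ?M = "lebesgue_on \<Omega>"
  have m: "\<Omega> \<in> sets lebesgue" using \<Omega> by auto
  have vL: "v \<in> L2 ?M" "w \<in> L2 ?M" using v w by (auto simp: H1_def)
  note G = wgrad_H1(1)[OF v] wgrad_H1(1)[OF w]
  have wg: "is_weak_grad \<Omega> (\<lambda>x. v x + c * w x) (\<lambda>x. wgrad \<Omega> v x + c *\<^sub>R wgrad \<Omega> w x)"
    unfolding is_weak_grad_def
  proof
    fix \<phi> assume \<phi>: "\<phi> \<in> test_functions \<Omega>"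
    have \<phi>L: "\<phi> \<in> L2 ?M" "grad \<phi> \<in> L2 ?M"
      using test_function_smooth[OF \<phi>] m \<Omega> by (auto intro!: smooth_L2)
    have "(LINT x|?M. (v x + c * w x) *\<^sub>R grad \<phi> x) =
        (LINT x|?M. v x *\<^sub>R grad \<phi> x + c *\<^sub>R (w x *\<^sub>R grad \<phi> x))"
      by (simp add: scaleR_add_left)
    also have "\<dots> = (LINT x|?M. v x *\<^sub>R grad \<phi> x) + c *\<^sub>R (LINT x|?M. w x *\<^sub>R grad \<phi> x)"
      using L2_integrable_scaleR[OF vL(1) \<phi>L(2)] L2_integrable_scaleR[OF vL(2) \<phi>L(2)]
      by (simp del: scaleR_scaleR)
    also have "\<dots> = - ((LINT x|?M. \<phi> x *\<^sub>R wgrad \<Omega> v x) + c *\<^sub>R (LINT x|?M. \<phi> x *\<^sub>R wgrad \<Omega> w x))"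
      using wgrad_H1(2)[OF v] wgrad_H1(2)[OF w] \<phi> by (simp add: is_weak_grad_def)
    also have "(LINT x|?M. \<phi> x *\<^sub>R wgrad \<Omega> v x) + c *\<^sub>R (LINT x|?M. \<phi> x *\<^sub>R wgrad \<Omega> w x) =
        (LINT x|?M. \<phi> x *\<^sub>R wgrad \<Omega> v x + c *\<^sub>R (\<phi> x *\<^sub>R wgrad \<Omega> w x))"
      using L2_integrable_scaleR[OF \<phi>L(1) G(1)] L2_integrable_scaleR[OF \<phi>L(1) G(2)]
      by (simp del: scaleR_scaleR)
    also have "\<dots> = (LINT x|?M. \<phi> x *\<^sub>R (wgrad \<Omega> v x + c *\<^sub>R wgrad \<Omega> w x))"
      by (simp add: scaleR_add_right mult.commute)
    finally show "(LINT x|?M. (v x + c * w x) *\<^sub>R grad \<phi> x) =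
      - (LINT x|?M. \<phi> x *\<^sub>R (wgrad \<Omega> v x + c *\<^sub>R wgrad \<Omega> w x))" .
  qed
  have L: "(\<lambda>x. v x + c * w x) \<in> L2 ?M" using L2_add_scaleR[OF vL] by simp
  show "(\<lambda>x. v x + c * w x) \<in> H1 \<Omega>"
    "AE x in ?M. wgrad \<Omega> (\<lambda>x. v x + c * w x) x = wgrad \<Omega> v x + c *\<^sub>R wgrad \<Omega> w x"
    by (intro wgrad_eqI[OF \<Omega> L _ wg] L2_add_scaleR G)+
qed

lemma L2_restrict:
  assumes "v \<in> L2 (lebesgue_on \<Omega>)" "K \<subseteq> \<Omega>" "K \<in> sets lebesgue" "\<Omega> \<in> sets lebesgue"
  shows "v \<in> L2 (lebesgue_on K)"
proof -
  have "integrable lebesgue (\<lambda>x. indicator K x *\<^sub>R (indicator \<Omega> x *\<^sub>R (norm (v x))\<^sup>2))"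
  proof (rule integrable_mult_indicator)
    show "integrable lebesgue (\<lambda>x. indicator \<Omega> x *\<^sub>R (norm (v x))\<^sup>2)"
      using assms by (simp add: L2_def integrable_restrict_space)
  qed (use assms in auto)
  moreover have "(\<lambda>x. indicator K x *\<^sub>R (indicator \<Omega> x *\<^sub>R (norm (v x))\<^sup>2)) = (\<lambda>x. indicator K x *\<^sub>R (norm (v x))\<^sup>2)"
    using assms by (intro ext) (auto split: split_indicator)
  ultimately have "integrable (lebesgue_on K) (\<lambda>x. (norm (v x))\<^sup>2)"
    using assms by (simp add: integrable_restrict_space)
  moreover have "v \<in> borel_measurable (lebesgue_on K)"
    using assms by (auto simp: L2_def intro: measurable_restrict_mono)
  ultimately show ?thesis by (simp add: L2_def)
qed

lemma is_weak_grad_restrict: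
  assumes "is_weak_grad \<Omega> v G" "K \<subseteq> \<Omega>" "K \<in> sets lebesgue" "\<Omega> \<in> sets lebesgue"
  shows "is_weak_grad K v G"
  unfolding is_weak_grad_def
proof
  fix \<phi> assume \<phi>: "\<phi> \<in> test_functions K"
  have eq: "(LINT x|lebesgue_on K. f x) = (LINT x|lebesgue_on \<Omega>. f x)"
    if "\<And>x. x \<notin> K \<Longrightarrow> f x = 0" for f :: "real^2 \<Rightarrow> real^2"
  proof -
    have "(LINT x|lebesgue_on K. f x) = (LINT x|lebesgue_on \<Omega>. (if x \<in> K then f x else 0))"
      using assms by (intro integral_restrict[symmetric])
    also have "(\<lambda>x. if x \<in> K then f x else 0) = f" using that by auto
    finally show ?thesis .
  qed
  have "(LINT x|lebesgue_on \<Omega>. v x *\<^sub>R grad \<phi> x) = - (LINT x|lebesgue_on \<Omega>. \<phi> x *\<^sub>R G x)"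
    using assms \<phi> test_functions_mono[of K \<Omega>] by (auto simp: is_weak_grad_def)
  thus "(LINT x|lebesgue_on K. v x *\<^sub>R grad \<phi> x) = - (LINT x|lebesgue_on K. \<phi> x *\<^sub>R G x)"
    using test_function_off[OF \<phi>] by (simp add: eq)
qed

text \<open>A test function of the smaller set is one of the larger set, so the weak gradient restricts.
  This relates the elementwise gradients in \<open>broken_grad\<close> to the global one.\<close>

lemma wgrad_restrict:
  assumes "open \<Omega>" "bounded \<Omega>" "open K" "K \<subseteq> \<Omega>" "v \<in> H1 \<Omega>"
  shows "v \<in> H1 K" "AE x in lebesgue_on K. wgrad K v x = wgrad \<Omega> v x"
proof -
  have m: "K \<in> sets lebesgue" "\<Omega> \<in> sets lebesgue" using assms by auto
  have b: "bounded K" using assms bounded_subset by blast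
  have "v \<in> L2 (lebesgue_on K)" "wgrad \<Omega> v \<in> L2 (lebesgue_on K)" "is_weak_grad K v (wgrad \<Omega> v)"
    using assms m wgrad_H1[OF assms(5)]
    by (auto simp: H1_def intro: L2_restrict is_weak_grad_restrict)
  thus "v \<in> H1 K" "AE x in lebesgue_on K. wgrad K v x = wgrad \<Omega> v x"
    using wgrad_eqI[OF assms(3) b] by auto
qed

section \<open>Traces\<close>

lemma space_boundary_measure: "space (boundary_measure \<Omega>) = frontier \<Omega>"
  by (simp add: boundary_measure_def hausdorff1_def space_restrict_space space_measure_of_conv)

text \<open>The generating set function affects the measure of sets but not which sets are measurable.\<close>

lemma sets_hausdorff1: "sets hausdorff1 = sets borel"
  by (simp add: hausdorff1_def sets_measure_of_conv sets.sigma_sets_eq[of borel, simplified])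

lemma continuous_measurable_boundary:
  fixes \<phi> :: "real^2 \<Rightarrow> real"
  assumes "continuous_on UNIV \<phi>"
  shows "\<phi> \<in> borel_measurable (boundary_measure \<Omega>)"
proof -
  have "\<phi> \<in> borel_measurable hausdorff1"
    using borel_measurable_continuous_onI[OF assms] measurable_cong_sets[OF sets_hausdorff1 refl] by blast
  thus ?thesis unfolding boundary_measure_def by (rule measurable_restrict_space1)
qed

text \<open>The trace operator is given by its graph, a closure of pairs. Its linearity is obtained by combining
  the approximating smooth functions; on the boundary, where the convergence is stated by extended
  nonnegative integrals, \<open>(p + q)\<^sup>2 \<le> 2 p\<^sup>2 + 2 q\<^sup>2\<close> takes the place of the triangle inequality.\<close>

lemma has_trace_add_scaled:
  assumes \<Omega>: "open \<Omega>" "bounded \<Omega>" and v: "has_trace \<Omega> v s" and w: "has_trace \<Omega> w t"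
  shows "has_trace \<Omega> (\<lambda>x. v x + c * w x) (\<lambda>x. s x + c * t x)"
proof -
  let ?M = "lebesgue_on \<Omega>" and ?B = "boundary_measure \<Omega>"
  have m: "\<Omega> \<in> sets lebesgue" using \<Omega> by auto
  have vH: "v \<in> H1 \<Omega>" "w \<in> H1 \<Omega>" and sL: "s \<in> L2 ?B" "t \<in> L2 ?B"
    using v w by (auto simp: has_trace_def)
  have vL: "v \<in> L2 ?M" "w \<in> L2 ?M" using vH by (auto simp: H1_def)
  note G = wgrad_H1(1)[OF vH(1)] wgrad_H1(1)[OF vH(2)]
  obtain \<phi> where \<phi>: "\<And>k. smooth (\<phi> k)"
    "(\<lambda>k. L2_norm ?M (\<lambda>x. \<phi> k x - v x)) \<longlonglongrightarrow> 0"
    "(\<lambda>k. L2_norm ?M (\<lambda>x. grad (\<phi> k) x - wgrad \<Omega> v x)) \<longlonglongrightarrow> 0"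
    "(\<lambda>k. \<integral>\<^sup>+x. ennreal ((\<phi> k x - s x)\<^sup>2) \<partial>?B) \<longlonglongrightarrow> 0"
    using v by (auto simp: has_trace_def)
  obtain \<psi> where \<psi>: "\<And>k. smooth (\<psi> k)"
    "(\<lambda>k. L2_norm ?M (\<lambda>x. \<psi> k x - w x)) \<longlonglongrightarrow> 0"
    "(\<lambda>k. L2_norm ?M (\<lambda>x. grad (\<psi> k) x - wgrad \<Omega> w x)) \<longlonglongrightarrow> 0"
    "(\<lambda>k. \<integral>\<^sup>+x. ennreal ((\<psi> k x - t x)\<^sup>2) \<partial>?B) \<longlonglongrightarrow> 0"
    using w by (auto simp: has_trace_def)
  let ?\<chi> = "\<lambda>k x. \<phi> k x + c * \<psi> k x"
  note pL = smooth_L2[OF \<phi>(1) m \<Omega>(2)] and qL = smooth_L2[OF \<psi>(1) m \<Omega>(2)]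
  have sq: "(\<lambda>k. L2_norm ?M (\<lambda>x. a k x + c *\<^sub>R b k x)) \<longlonglongrightarrow> 0"
    if "\<And>k. a k \<in> L2 ?M" "\<And>k. b k \<in> L2 ?M" "(\<lambda>k. L2_norm ?M (a k)) \<longlonglongrightarrow> 0" "(\<lambda>k. L2_norm ?M (b k)) \<longlonglongrightarrow> 0"
    for a b :: "nat \<Rightarrow> real^2 \<Rightarrow> 'x::euclidean_space"
  proof (rule tendsto_sandwich[OF _ _ tendsto_const])
    have "(\<lambda>k. L2_norm ?M (a k) + \<bar>c\<bar> * L2_norm ?M (b k)) \<longlonglongrightarrow> 0 + \<bar>c\<bar> * 0"
      by (intro tendsto_intros that)
    thus "(\<lambda>k. L2_norm ?M (a k) + \<bar>c\<bar> * L2_norm ?M (b k)) \<longlonglongrightarrow> 0" by simp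
  qed (use that in \<open>auto simp: L2_norm_nonneg intro!: always_eventually L2_norm_triangle\<close>)
  have c1: "(\<lambda>k. L2_norm ?M (\<lambda>x. ?\<chi> k x - (v x + c * w x))) \<longlonglongrightarrow> 0"
  proof -
    have "(\<lambda>k. L2_norm ?M (\<lambda>x. (\<phi> k x - v x) + c *\<^sub>R (\<psi> k x - w x))) \<longlonglongrightarrow> 0"
      by (intro sq L2_diff pL qL vL \<phi> \<psi>)
    thus ?thesis by (simp add: algebra_simps)
  qed
  have c2: "(\<lambda>k. L2_norm ?M (\<lambda>x. grad (?\<chi> k) x - wgrad \<Omega> (\<lambda>x. v x + c * w x) x)) \<longlonglongrightarrow> 0"
  proof -
    have "L2_norm ?M (\<lambda>x. grad (?\<chi> k) x - wgrad \<Omega> (\<lambda>x. v x + c * w x) x) =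
        L2_norm ?M (\<lambda>x. (grad (\<phi> k) x - wgrad \<Omega> v x) + c *\<^sub>R (grad (\<psi> k) x - wgrad \<Omega> w x))" for k
    proof (rule L2_norm_cong_AE)
      show "(\<lambda>x. grad (?\<chi> k) x - wgrad \<Omega> (\<lambda>x. v x + c * w x) x) \<in> borel_measurable ?M"
        by (intro L2_measurable L2_diff smooth_L2 smooth_add_scaled \<phi> \<psi> m \<Omega> wgrad_H1 wgrad_add_scaled vH)
      show "(\<lambda>x. (grad (\<phi> k) x - wgrad \<Omega> v x) + c *\<^sub>R (grad (\<psi> k) x - wgrad \<Omega> w x)) \<in> borel_measurable ?M"
        by (intro L2_measurable L2_add_scaleR L2_diff pL qL G)
      show "AE x in ?M. grad (?\<chi> k) x - wgrad \<Omega> (\<lambda>x. v x + c * w x) x =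
          (grad (\<phi> k) x - wgrad \<Omega> v x) + c *\<^sub>R (grad (\<psi> k) x - wgrad \<Omega> w x)"
        using wgrad_add_scaled(2)[OF \<Omega> vH, of c]
        by eventually_elim
          (simp add: grad_add_scaled smooth_differentiable \<phi>(1) \<psi>(1) algebra_simps)
    qed
    moreover have "(\<lambda>k. L2_norm ?M (\<lambda>x. (grad (\<phi> k) x - wgrad \<Omega> v x) + c *\<^sub>R (grad (\<psi> k) x - wgrad \<Omega> w x))) \<longlonglongrightarrow> 0"
      by (intro sq L2_diff pL qL G \<phi> \<psi>)
    ultimately show ?thesis by simp
  qed
  have [measurable]: "\<phi> k \<in> borel_measurable ?B" "\<psi> k \<in> borel_measurable ?B" for k
    by (intro continuous_measurable_boundary smooth_continuous \<phi> \<psi>)+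
  have [measurable]: "s \<in> borel_measurable ?B" "t \<in> borel_measurable ?B"
    using sL by (auto simp: L2_def)
  have c3: "(\<lambda>k. \<integral>\<^sup>+x. ennreal ((?\<chi> k x - (s x + c * t x))\<^sup>2) \<partial>?B) \<longlonglongrightarrow> 0"
  proof (rule tendsto_sandwich[OF _ _ tendsto_const])
    let ?b = "\<lambda>k. ennreal 2 * (\<integral>\<^sup>+x. ennreal ((\<phi> k x - s x)\<^sup>2) \<partial>?B) +
      ennreal (2 * c\<^sup>2) * (\<integral>\<^sup>+x. ennreal ((\<psi> k x - t x)\<^sup>2) \<partial>?B)"
    have "?b \<longlonglongrightarrow> ennreal 2 * 0 + ennreal (2 * c\<^sup>2) * 0"
      by (intro tendsto_add ennreal_tendsto_cmult \<phi> \<psi>) auto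
    thus "?b \<longlonglongrightarrow> 0" by simp
    show "\<forall>\<^sub>F k in sequentially. (\<integral>\<^sup>+x. ennreal ((?\<chi> k x - (s x + c * t x))\<^sup>2) \<partial>?B) \<le> ?b k"
    proof (intro always_eventually allI)
      fix k
      have "(\<integral>\<^sup>+x. ennreal ((?\<chi> k x - (s x + c * t x))\<^sup>2) \<partial>?B) \<le>
        (\<integral>\<^sup>+x. ennreal 2 * ennreal ((\<phi> k x - s x)\<^sup>2) + ennreal (2 * c\<^sup>2) * ennreal ((\<psi> k x - t x)\<^sup>2) \<partial>?B)"
      proof (rule nn_integral_mono)
        fix x
        define p q where "p = \<phi> k x - s x" and "q = c * (\<psi> k x - t x)"
        have "?\<chi> k x - (s x + c * t x) = p + q" by (simp add: p_def q_def algebra_simps)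
        moreover have "(p + q)\<^sup>2 \<le> 2 * p\<^sup>2 + 2 * q\<^sup>2"
          using zero_le_power2[of "p - q"] by (simp add: power2_sum power2_diff)
        ultimately have "(?\<chi> k x - (s x + c * t x))\<^sup>2 \<le> 2 * p\<^sup>2 + 2 * q\<^sup>2" by metis
        also have "\<dots> = 2 * (\<phi> k x - s x)\<^sup>2 + 2 * c\<^sup>2 * (\<psi> k x - t x)\<^sup>2"
          by (simp only: p_def q_def power_mult_distrib mult.assoc)
        finally have "(?\<chi> k x - (s x + c * t x))\<^sup>2 \<le> 2 * (\<phi> k x - s x)\<^sup>2 + 2 * c\<^sup>2 * (\<psi> k x - t x)\<^sup>2" .
        hence "ennreal ((?\<chi> k x - (s x + c * t x))\<^sup>2) \<le>
          ennreal (2 * (\<phi> k x - s x)\<^sup>2 + 2 * c\<^sup>2 * (\<psi> k x - t x)\<^sup>2)"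
          by (rule ennreal_leI)
        also have "\<dots> = ennreal 2 * ennreal ((\<phi> k x - s x)\<^sup>2) + ennreal (2 * c\<^sup>2) * ennreal ((\<psi> k x - t x)\<^sup>2)"
          by (simp add: ennreal_plus ennreal_mult)
        finally show "ennreal ((?\<chi> k x - (s x + c * t x))\<^sup>2) \<le>
          ennreal 2 * ennreal ((\<phi> k x - s x)\<^sup>2) + ennreal (2 * c\<^sup>2) * ennreal ((\<psi> k x - t x)\<^sup>2)" .
      qed
      also have "\<dots> = ?b k"
        by (subst nn_integral_add) (auto simp: nn_integral_cmult)
      finally show "(\<integral>\<^sup>+x. ennreal ((?\<chi> k x - (s x + c * t x))\<^sup>2) \<partial>?B) \<le> ?b k" .
    qed
  qed auto
  have "(\<lambda>x. s x + c * t x) \<in> L2 ?B" using L2_add_scaleR[OF sL, of c] by simp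
  thus ?thesis
    unfolding has_trace_def
    using c1 c2 c3 wgrad_add_scaled(1)[OF \<Omega> vH, of c] smooth_add_scaled[OF \<phi>(1) \<psi>(1)]
    by (intro conjI exI[of _ ?\<chi>]) auto
qed

lemma H1_vanishing_on_add_scaled:
  assumes \<Omega>: "open \<Omega>" "bounded \<Omega>" and v: "v \<in> H1_vanishing_on \<Omega> \<Gamma>" and w: "w \<in> H1_vanishing_on \<Omega> \<Gamma>"
  shows "(\<lambda>x. v x + c * w x) \<in> H1_vanishing_on \<Omega> \<Gamma>"
proof -
  obtain s t where s: "has_trace \<Omega> v s" "AE x in boundary_measure \<Omega>. x \<in> \<Gamma> \<longrightarrow> s x = 0"
    and t: "has_trace \<Omega> w t" "AE x in boundary_measure \<Omega>. x \<in> \<Gamma> \<longrightarrow> t x = 0"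
    using v w by (auto simp: H1_vanishing_on_def has_trace_on_def)
  have "has_trace \<Omega> (\<lambda>x. v x + c * w x) (\<lambda>x. s x + c * t x)"
    by (rule has_trace_add_scaled[OF \<Omega> s(1) t(1)])
  moreover have "AE x in boundary_measure \<Omega>. x \<in> \<Gamma> \<longrightarrow> s x + c * t x = 0"
    using s(2) t(2) by eventually_elim auto
  ultimately show ?thesis
    unfolding H1_vanishing_on_def has_trace_on_def by (auto simp: has_trace_def)
qed

text \<open>The constant sequence \<open>\<phi>\<close> approximates: test functions vanish on the frontier of the open set \<open>\<Omega>\<close>.\<close>

lemma test_function_has_trace_0:
  assumes \<Omega>: "open \<Omega>" "bounded \<Omega>" and \<phi>: "\<phi> \<in> test_functions \<Omega>"
  shows "has_trace \<Omega> \<phi> (\<lambda>_. 0)"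
proof -
  note sm = test_function_smooth[OF \<phi>]
  have m: "\<Omega> \<in> sets lebesgue" using \<Omega> by auto
  have H1: "\<phi> \<in> H1 \<Omega>" using wgrad_smooth \<Omega> sm by blast
  have "L2_norm (lebesgue_on \<Omega>) (\<lambda>x. grad \<phi> x - wgrad \<Omega> \<phi> x) = L2_norm (lebesgue_on \<Omega>) (\<lambda>x. 0 :: real^2)"
  proof (rule L2_norm_cong_AE)
    show "(\<lambda>x. grad \<phi> x - wgrad \<Omega> \<phi> x) \<in> borel_measurable (lebesgue_on \<Omega>)"
      by (intro L2_measurable L2_diff smooth_L2 sm m \<Omega> wgrad_H1 H1)
    show "AE x in lebesgue_on \<Omega>. grad \<phi> x - wgrad \<Omega> \<phi> x = 0"
      using wgrad_smooth(2)[OF \<Omega> sm] by eventually_elim simp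
  qed simp
  hence g: "L2_norm (lebesgue_on \<Omega>) (\<lambda>x. grad \<phi> x - wgrad \<Omega> \<phi> x) = 0"
    by (simp add: L2_norm_def)
  have "(\<integral>\<^sup>+x. ennreal ((\<phi> x - 0)\<^sup>2) \<partial>boundary_measure \<Omega>) = (\<integral>\<^sup>+x. 0 \<partial>boundary_measure \<Omega>)"
  proof (rule nn_integral_cong)
    fix x assume "x \<in> space (boundary_measure \<Omega>)"
    hence "x \<notin> \<Omega>" using \<Omega> by (auto simp: space_boundary_measure frontier_def interior_open)
    thus "ennreal ((\<phi> x - 0)\<^sup>2) = 0" using test_function_off[OF \<phi>] by simp
  qed
  hence b: "(\<integral>\<^sup>+x. ennreal ((\<phi> x - 0)\<^sup>2) \<partial>boundary_measure \<Omega>) = 0" by simp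
  show ?thesis
    unfolding has_trace_def using H1 g b sm
    by (intro conjI exI[of _ "\<lambda>_. \<phi>"]) (auto simp: L2_zero L2_norm_def)
qed

section \<open>Square roots of positive definite matrices\<close>

lemma inner_matrix_2:
  fixes M :: "real^2^2"
  shows "x \<bullet> (M *v x) = M$1$1 * (x$1)\<^sup>2 + (M$1$2 + M$2$1) * (x$1 * x$2) + M$2$2 * (x$2)\<^sup>2"
  by (simp add: inner_vec_def matrix_vector_mult_def sum_2 power2_eq_square algebra_simps)

lemma symmetric_2_iff: "transpose M = M \<longleftrightarrow> M$1$2 = M$2$1" for M :: "real^2^2"
  by (auto simp: vec_eq_iff transpose_def forall_2)

text \<open>Sylvester's criterion. The vector \<open>(- M\<^sub>1\<^sub>2, M\<^sub>1\<^sub>1)\<close> is orthogonal to the first row of \<open>M\<close>, which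
  isolates the determinant; the converse completes the square.\<close>

lemma spd_iff:
  "spd M \<longleftrightarrow> M$1$2 = M$2$1 \<and> M$1$1 > 0 \<and> M$1$1 * M$2$2 - (M$1$2)\<^sup>2 > 0"
proof
  assume M: "spd M"
  hence sym: "M$1$2 = M$2$1" and pos: "\<And>x. x \<noteq> 0 \<Longrightarrow> x \<bullet> (M *v x) > 0"
    by (auto simp: spd_def symmetric_2_iff)
  have a: "M$1$1 > 0"
    using pos[of "vector [1, 0]"] unfolding inner_matrix_2
    by (simp add: vec_eq_iff forall_2)
  have "(vector [- M$1$2, M$1$1] :: real^2) \<noteq> 0" using a by (simp add: vec_eq_iff forall_2)
  from pos[OF this] have "M$1$1 * (M$1$1 * M$2$2 - (M$1$2)\<^sup>2) > 0"
    unfolding inner_matrix_2 by (simp add: sym power2_eq_square algebra_simps)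
  with a sym show "M$1$2 = M$2$1 \<and> M$1$1 > 0 \<and> M$1$1 * M$2$2 - (M$1$2)\<^sup>2 > 0"
    by (simp add: zero_less_mult_iff)
next
  assume M: "M$1$2 = M$2$1 \<and> M$1$1 > 0 \<and> M$1$1 * M$2$2 - (M$1$2)\<^sup>2 > 0"
  show "spd M"
    unfolding spd_def symmetric_2_iff
  proof (intro conjI allI impI)
    fix x :: "real^2" assume x: "x \<noteq> 0"
    have "M$1$1 * (x \<bullet> (M *v x)) = (M$1$1 * x$1 + M$1$2 * x$2)\<^sup>2 + (M$1$1 * M$2$2 - (M$1$2)\<^sup>2) * (x$2)\<^sup>2"
      using M unfolding inner_matrix_2 by (simp add: power2_eq_square algebra_simps)
    also have "\<dots> > 0"
    proof (cases "x$2 = 0")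
      case True
      hence "x$1 \<noteq> 0" using x by (auto simp: vec_eq_iff forall_2)
      thus ?thesis using True M by simp
    next
      case False
      thus ?thesis using M by (intro add_nonneg_pos mult_pos_pos) auto
    qed
    finally show "x \<bullet> (M *v x) > 0" using M by (simp add: zero_less_mult_iff)
  qed (use M in simp)
qed

lemma symmetric_square_2_iff:
  fixes S :: "real^2^2"
  assumes "S$1$2 = S$2$1"
  shows "S ** S = M \<longleftrightarrow> (S$1$1)\<^sup>2 + (S$1$2)\<^sup>2 = M$1$1 \<and> S$1$2 * (S$1$1 + S$2$2) = M$1$2 \<and>
    S$1$2 * (S$1$1 + S$2$2) = M$2$1 \<and> (S$1$2)\<^sup>2 + (S$2$2)\<^sup>2 = M$2$2"
  using assms
  by (auto simp: vec_eq_iff forall_2 matrix_matrix_mult_def sum_2 power2_eq_square algebra_simps)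

text \<open>Cayley-Hamilton gives \<open>S\<^sup>2 + det S = tr S * S\<close>. For a positive definite root \<open>S\<close> of \<open>M\<close> the determinant
  \<open>\<delta>\<close> is the root of \<open>det M\<close> and the trace \<open>t\<close> is the root of \<open>tr M + 2 \<delta>\<close>, so \<open>S = (M + \<delta>) / t\<close> is
  determined by \<open>M\<close>.\<close>

lemma spd_sqrt_entries:
  fixes S M :: "real^2^2"
  assumes S: "spd S" "S ** S = M"
  defines "\<delta> \<equiv> sqrt (M$1$1 * M$2$2 - (M$1$2)\<^sup>2)"
  defines "t \<equiv> sqrt (M$1$1 + M$2$2 + 2 * \<delta>)"
  shows "S = (\<chi> i j. (M$i$j + (if i = j then \<delta> else 0)) / t)"
proof -
  define p q r where "p = S$1$1" and "q = S$1$2" and "r = S$2$2"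
  have s: "S$2$1 = q" "p > 0" "p * r - q\<^sup>2 > 0" using S(1) by (auto simp: spd_iff p_def q_def r_def)
  have r0: "r > 0"
  proof -
    have "p * r > 0" using s zero_le_power2[of q] by linarith
    with s show ?thesis by (simp add: zero_less_mult_iff)
  qed
  have M: "M$1$1 = p\<^sup>2 + q\<^sup>2" "M$1$2 = q * (p + r)" "M$2$1 = q * (p + r)" "M$2$2 = q\<^sup>2 + r\<^sup>2"
    using symmetric_square_2_iff[of S M] S s by (auto simp: p_def q_def r_def)
  have "M$1$1 * M$2$2 - (M$1$2)\<^sup>2 = (p * r - q\<^sup>2)\<^sup>2"
    by (simp add: M power2_eq_square algebra_simps)
  hence d: "\<delta> = p * r - q\<^sup>2" using s by (simp add: \<delta>_def)
  have "M$1$1 + M$2$2 + 2 * \<delta> = (p + r)\<^sup>2"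
    by (simp add: M d power2_eq_square algebra_simps)
  hence t: "t = p + r" using s r0 by (simp add: t_def)
  have "t > 0" using t s r0 by simp
  thus ?thesis
    using s by (simp add: vec_eq_iff forall_2 M d t field_simps flip: p_def q_def r_def)
      (simp add: power2_eq_square algebra_simps)
qed

text \<open>The matrix that uniqueness forces is indeed a root.\<close>

lemma spd_sqrt_exists:
  assumes M: "spd M"
  shows "\<exists>S. spd S \<and> S ** S = M"
proof -
  define a b d where "a = M$1$1" and "b = M$1$2" and "d = M$2$2"
  have M': "M$2$1 = b" "a > 0" "a * d - b\<^sup>2 > 0" using M by (auto simp: spd_iff a_def b_def d_def)
  have d0: "d > 0"
  proof -
    have "a * d > 0" using M' zero_le_power2[of b] by linarith
    with M' show ?thesis by (simp add: zero_less_mult_iff)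
  qed
  define \<delta> where "\<delta> = sqrt (a * d - b\<^sup>2)"
  have \<delta>: "\<delta> > 0" "\<delta>\<^sup>2 = a * d - b\<^sup>2" using M' by (auto simp: \<delta>_def)
  define t where "t = sqrt (a + d + 2 * \<delta>)"
  have t: "t > 0" "t\<^sup>2 = a + d + 2 * \<delta>" using M' d0 \<delta> by (auto simp: t_def)
  define S :: "real^2^2" where "S = (\<chi> i j. (M$i$j + (if i = j then \<delta> else 0)) / t)"
  have S: "S$1$1 = (a + \<delta>) / t" "S$1$2 = b / t" "S$2$1 = b / t" "S$2$2 = (d + \<delta>) / t"
    using M' by (simp_all add: S_def a_def b_def d_def)
  have "(a + \<delta>) * (d + \<delta>) - b\<^sup>2 = \<delta> * t\<^sup>2"
    using \<delta>(2) unfolding t(2) by (simp add: power2_eq_square algebra_simps)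
  hence det: "S$1$1 * S$2$2 - (S$1$2)\<^sup>2 = \<delta>"
    using t(1) by (simp add: S power2_eq_square field_simps)
  have "spd S" unfolding spd_iff det using \<delta> t M' by (simp add: S)
  moreover have "S ** S = M"
  proof -
    have "(a + \<delta>)\<^sup>2 + b\<^sup>2 = a * t\<^sup>2" "b\<^sup>2 + (d + \<delta>)\<^sup>2 = d * t\<^sup>2"
      using \<delta>(2) unfolding t(2) by (simp_all add: power2_eq_square algebra_simps)
    hence "((a + \<delta>)\<^sup>2 + b\<^sup>2) / t\<^sup>2 = a" "(b\<^sup>2 + (d + \<delta>)\<^sup>2) / t\<^sup>2 = d"
      using t(1) by simp_all
    hence diag: "((a + \<delta>) / t)\<^sup>2 + (b / t)\<^sup>2 = a" "(b / t)\<^sup>2 + ((d + \<delta>) / t)\<^sup>2 = d"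
      by (simp_all only: power_divide add_divide_distrib[symmetric])
    have "b / t * ((a + \<delta>) / t + (d + \<delta>) / t) = b * (a + d + 2 * \<delta>) / t\<^sup>2"
      by (simp add: power2_eq_square add_divide_distrib[symmetric] del: add_divide_distrib)
    also have "\<dots> = b" using t(1) unfolding t(2)[symmetric] by simp
    finally show ?thesis
      using diag M' unfolding symmetric_square_2_iff[of S M, unfolded S, OF refl] by (simp add: a_def b_def d_def)
  qed
  ultimately show ?thesis by blast
qed

lemma mat_sqrt_spd:
  assumes "spd M"
  shows "spd (mat_sqrt M)" "mat_sqrt M ** mat_sqrt M = M"
proof -
  have "\<exists>!S. spd S \<and> S ** S = M"
  proof (rule ex_ex1I[OF spd_sqrt_exists[OF assms]])
    fix S S' assume "spd S \<and> S ** S = M" "spd S' \<and> S' ** S' = M"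
    hence S: "spd S" "S ** S = M" and S': "spd S'" "S' ** S' = M" by auto
    show "S = S'" by (rule trans[OF spd_sqrt_entries[OF S] sym[OF spd_sqrt_entries[OF S']]])
  qed
  from theI'[OF this] show "spd (mat_sqrt M)" "mat_sqrt M ** mat_sqrt M = M"
    by (simp_all add: mat_sqrt_def)
qed

lemma spd_invertible:
  assumes "spd S"
  shows "invertible S"
proof -
  have "inj ((*v) S)"
  proof (rule injI)
    fix x y assume "S *v x = S *v y"
    hence "S *v (x - y) = 0" by (simp add: matrix_vector_mult_diff_distrib)
    hence "(x - y) \<bullet> (S *v (x - y)) = 0" by simp
    thus "x = y" using assms unfolding spd_def by (metis eq_iff_diff_eq_0 less_irrefl)
  qed
  thus ?thesis by (simp add: invertible_left_inverse matrix_left_invertible_injective)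
qed

lemma spd_self_adjoint:
  assumes "spd S"
  shows "(S *v x) \<bullet> y = x \<bullet> (S *v y)"
proof -
  have "S *v x = x v* transpose S" by (rule vector_transpose_matrix[symmetric])
  also have "transpose S = S" using assms by (simp add: spd_def)
  finally show ?thesis by (simp only: dot_lmul_matrix)
qed

lemma matrix_inv_inverse:
  assumes "invertible A"
  shows "A ** matrix_inv A = mat 1" "matrix_inv A ** A = mat 1"
proof -
  have "\<exists>B. A ** B = mat 1 \<and> B ** A = mat 1" using assms by (simp add: invertible_def)
  from someI_ex[OF this] show "A ** matrix_inv A = mat 1" "matrix_inv A ** A = mat 1"
    by (simp_all add: matrix_inv_def)
qed

lemma mat_sqrt_apply:
  assumes "spd M"
  shows "mat_sqrt M *v (mat_sqrt M *v x) = M *v x"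
    "mat_sqrt M *v (matrix_inv (mat_sqrt M) *v x) = x"
    "matrix_inv (mat_sqrt M) *v (mat_sqrt M *v x) = x"
  using mat_sqrt_spd[OF assms] spd_invertible[OF mat_sqrt_spd(1)[OF assms]]
  by (simp_all add: matrix_vector_mul_assoc matrix_inv_inverse)

section \<open>Coverings of the domain up to null sets\<close>

lemma negligible_frontier_polygonal:
  assumes "polygonal S"
  shows "negligible (frontier S)"
proof -
  obtain E :: "((real^2) \<times> (real^2)) set" where E: "finite E"
    "frontier S = (\<Union>(a, b)\<in>E. closed_segment a b)"
    using assms by (auto simp: polygonal_def)
  have "negligible (closed_segment a b)" for a b :: "real^2"
    by (subst negligible_convex_interior) (auto simp: interior_closed_segment_ge2)
  thus ?thesis unfolding E(2) using E(1) by (intro negligible_Union) auto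
qed

lemma AE_lebesgue_on_cover:
  assumes "\<Omega> \<in> sets lebesgue" "negligible N" "\<Omega> \<subseteq> U \<union> N"
  shows "AE x in lebesgue_on \<Omega>. x \<in> U"
proof -
  have "AE x in lebesgue. x \<notin> N"
    using assms by (simp add: negligible_iff_null_sets AE_not_in)
  hence "AE x in lebesgue. x \<in> \<Omega> \<longrightarrow> x \<in> U"
    by eventually_elim (use assms in blast)
  thus ?thesis using assms by (simp add: AE_restrict_space_iff)
qed

lemma UN_cover_split:
  assumes "A \<subseteq> (\<Union>i\<in>I. C i)" "\<And>i. C i \<subseteq> S i \<union> N i"
  shows "A \<subseteq> (\<Union>i\<in>I. S i) \<union> (\<Union>i\<in>I. N i)"
proof
  fix x assume "x \<in> A"
  then obtain i where "i \<in> I" "x \<in> C i" using assms(1) by blast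
  with assms(2)[of i] show "x \<in> (\<Union>i\<in>I. S i) \<union> (\<Union>i\<in>I. N i)" by blast
qed

text \<open>The rest of the domain lies in the frontiers of the subdomains, which are finite unions of
  segments.\<close>

lemma AE_subdomain_partition:
  assumes "subdomain_partition \<Omega> n \<Omega>s" "open \<Omega>"
  shows "AE x in lebesgue_on \<Omega>. \<exists>i<n. x \<in> \<Omega>s i"
proof -
  have "AE x in lebesgue_on \<Omega>. x \<in> (\<Union>i<n. \<Omega>s i)"
  proof (rule AE_lebesgue_on_cover[of _ "\<Union>i<n. frontier (\<Omega>s i)"])
    show "negligible (\<Union>i<n. frontier (\<Omega>s i))"
      using assms by (intro negligible_Union) (auto simp: subdomain_partition_def negligible_frontier_polygonal)
    have "closure \<Omega> = (\<Union>i<n. closure (\<Omega>s i))"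
      using assms by (simp add: subdomain_partition_def)
    with closure_subset[of \<Omega>] have "\<Omega> \<subseteq> (\<Union>i<n. closure (\<Omega>s i))" by simp
    moreover have "closure (\<Omega>s i) \<subseteq> \<Omega>s i \<union> frontier (\<Omega>s i)" for i
      by (simp add: closure_Un_frontier)
    ultimately show "\<Omega> \<subseteq> (\<Union>i<n. \<Omega>s i) \<union> (\<Union>i<n. frontier (\<Omega>s i))"
      by (rule UN_cover_split)
  qed (use assms in auto)
  thus ?thesis by eventually_elim auto
qed

text \<open>The rest of the domain lies in the frontiers of the elements, which are null because elements are
  convex.\<close>

lemma AE_regular_partition:
  assumes "regular_partition \<Omega> T" "open \<Omega>"
  shows "AE x in lebesgue_on \<Omega>. \<exists>K\<in>T. x \<in> interior K"
proof -
  have "AE x in lebesgue_on \<Omega>. x \<in> (\<Union>K\<in>T. interior K)"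
  proof (rule AE_lebesgue_on_cover[of _ "\<Union>K\<in>T. frontier K"])
    show "negligible (\<Union>K\<in>T. frontier K)"
      using assms by (intro negligible_Union)
        (auto simp: regular_partition_def intro!: negligible_convex_frontier polytope_imp_convex)
    have "\<Omega> \<subseteq> (\<Union>K\<in>T. K)"
      using assms closure_subset[of \<Omega>] by (simp add: regular_partition_def)
    moreover have "K \<subseteq> interior K \<union> frontier K" for K :: "(real^2) set"
      using closure_subset by (auto simp: frontier_def)
    ultimately show "\<Omega> \<subseteq> (\<Union>K\<in>T. interior K) \<union> (\<Union>K\<in>T. frontier K)"
      by (rule UN_cover_split)
  qed (use assms in auto)
  thus ?thesis by eventually_elim auto
qed

text \<open>A Lipschitz domain has no slits: below every boundary point, in the local coordinates, there are
  points arbitrarily close to it that are not limits of \<open>\<Omega>\<close>. So a boundary point is never interior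
  to the closure.\<close>

lemma lipschitz_boundary_interior_closure:
  assumes lip: "lipschitz_boundary \<Omega>" and op: "open \<Omega>"
  shows "interior (closure \<Omega>) \<subseteq> \<Omega>"
proof
  fix p assume p: "p \<in> interior (closure \<Omega>)"
  show "p \<in> \<Omega>"
  proof (rule ccontr)
    assume pn: "p \<notin> \<Omega>"
    have "p \<in> frontier \<Omega>"
      using p pn op interior_subset by (auto simp: frontier_def interior_open)
    then obtain r a b L and \<gamma> :: "real \<Rightarrow> real" where r: "r > 0"
      and ab: "norm a = 1" "norm b = 1" "a \<bullet> b = 0" and \<gamma>: "L-lipschitz_on UNIV \<gamma>"
      and eq: "\<Omega> \<inter> ball p r = {x \<in> ball p r. (x - p) \<bullet> b > \<gamma> ((x - p) \<bullet> a)}"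
      using lip unfolding lipschitz_boundary_def by blast
    have g0: "\<gamma> 0 \<ge> 0"
    proof (rule ccontr)
      assume "\<not> \<gamma> 0 \<ge> 0"
      hence "p \<in> \<Omega> \<inter> ball p r" unfolding eq using r by simp
      with pn show False by simp
    qed
    obtain s where s: "s > 0" "ball p s \<subseteq> closure \<Omega>"
      using p open_contains_ball[of "interior (closure \<Omega>)"] interior_subset by blast
    define e where "e = min r s / 2"
    have e: "0 < e" "e < r" "e < s" using r s by (auto simp: e_def)
    \<comment> \<open>\<open>y\<close> lies strictly below the graph of \<open>\<gamma>\<close>, whose value at 0 is nonnegative because \<open>p\<close> is not in \<open>\<Omega>\<close>\<close>
    define y where "y = p - e *\<^sub>R b"
    have dy: "dist p y = e" using e ab by (simp add: y_def dist_norm)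
    have "continuous_on UNIV \<gamma>" using \<gamma> by (rule lipschitz_on_continuous_on)
    define D where "D = ball p r \<inter> {x. (x - p) \<bullet> b < \<gamma> ((x - p) \<bullet> a)}"
    have "open {x. (x - p) \<bullet> b < \<gamma> ((x - p) \<bullet> a)}"
      by (intro open_Collect_less continuous_intros
        continuous_on_compose2[OF \<open>continuous_on UNIV \<gamma>\<close>]) auto
    hence oD: "open D" by (simp add: D_def open_Int)
    have "b \<bullet> a = 0" using ab by (simp add: inner_commute)
    moreover have "b \<bullet> b = 1" using ab by (simp add: norm_eq_1)
    ultimately have "y \<in> D" using g0 e dy by (simp add: D_def y_def)
    moreover have False if "x \<in> D" "x \<in> \<Omega>" for x
    proof -
      have "x \<in> \<Omega> \<inter> ball p r" using that by (simp add: D_def)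
      hence "(x - p) \<bullet> b > \<gamma> ((x - p) \<bullet> a)" unfolding eq by simp
      with that show False by (simp add: D_def)
    qed
    hence "D \<inter> \<Omega> = {}" by blast
    ultimately have "y \<notin> closure \<Omega>" using oD open_Int_closure_eq_empty by blast
    moreover have "y \<in> ball p s" using dy e by simp
    ultimately show False using s by blast
  qed
qed

text \<open>The partition covers only the closure of \<open>\<Omega>\<close>, so that an element interior could a priori contain
  points of the frontier. Containment is what allows restricting weak gradients to elements.\<close>

lemma element_interior_subset:
  assumes "regular_partition \<Omega> T" "lipschitz_boundary \<Omega>" "open \<Omega>" "K \<in> T"
  shows "interior K \<subseteq> \<Omega>"
proof -
  have "K \<subseteq> closure \<Omega>" using assms by (auto simp: regular_partition_def)
  hence "interior K \<subseteq> interior (closure \<Omega>)" by (rule interior_mono)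
  with lipschitz_boundary_interior_closure[OF assms(2,3)] show ?thesis by blast
qed

section \<open>Piecewise defined fields and broken gradients\<close>

lemma L2_indicator_extend:
  fixes v :: "'a::euclidean_space \<Rightarrow> 'b::euclidean_space"
  assumes v: "v \<in> L2 (lebesgue_on K)" and K: "K \<subseteq> \<Omega>" "K \<in> sets lebesgue" "\<Omega> \<in> sets lebesgue"
  shows "(\<lambda>x. indicator K x *\<^sub>R v x) \<in> L2 (lebesgue_on \<Omega>)"
proof -
  have "(\<lambda>x. indicator K x *\<^sub>R v x) \<in> borel_measurable lebesgue"
    using v K borel_measurable_restrict_space_iff[of K lebesgue v] by (simp add: L2_def)
  hence "(\<lambda>x. indicator K x *\<^sub>R v x) \<in> borel_measurable (lebesgue_on \<Omega>)"
    by (rule measurable_restrict_space1)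
  moreover have "integrable (lebesgue_on \<Omega>) (\<lambda>x. (norm (indicator K x *\<^sub>R v x))\<^sup>2)"
  proof -
    have "integrable lebesgue (\<lambda>x. indicator K x *\<^sub>R (norm (v x))\<^sup>2)"
      using v K by (simp add: L2_def integrable_restrict_space)
    also have "(\<lambda>x. indicator K x *\<^sub>R (norm (v x))\<^sup>2) = (\<lambda>x. indicator \<Omega> x *\<^sub>R (norm (indicator K x *\<^sub>R v x))\<^sup>2)"
      using K by (intro ext) (auto split: split_indicator)
    finally show ?thesis using K by (simp add: integrable_restrict_space)
  qed
  ultimately show ?thesis by (simp add: L2_def)
qed

text \<open>Almost everywhere, \<open>v\<close> is the finite sum of the pieces extended by zero.\<close>

lemma L2_piecewise:
  fixes v :: "'a::euclidean_space \<Rightarrow> 'b::euclidean_space"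
  assumes \<Omega>: "\<Omega> \<in> sets lebesgue" and I: "finite I"
    and S: "\<And>i. i \<in> I \<Longrightarrow> S i \<in> sets lebesgue" "\<And>i. i \<in> I \<Longrightarrow> S i \<subseteq> \<Omega>"
    and disj: "\<And>i j. i \<in> I \<Longrightarrow> j \<in> I \<Longrightarrow> i \<noteq> j \<Longrightarrow> S i \<inter> S j = {}"
    and cover: "AE x in lebesgue_on \<Omega>. \<exists>i\<in>I. x \<in> S i"
    and v: "\<And>i. i \<in> I \<Longrightarrow> w i \<in> L2 (lebesgue_on (S i))"
      "\<And>i x. i \<in> I \<Longrightarrow> x \<in> S i \<Longrightarrow> v x = w i x"
  shows "v \<in> L2 (lebesgue_on \<Omega>)"
proof -
  let ?f = "\<lambda>x. \<Sum>i\<in>I. indicator (S i) x *\<^sub>R w i x"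
  have L: "?f \<in> L2 (lebesgue_on \<Omega>)"
    using I by (rule L2_sum) (intro L2_indicator_extend v S \<Omega>)
  have ae: "AE x in lebesgue_on \<Omega>. ?f x = v x"
    using cover
  proof eventually_elim
    case (elim x)
    then obtain i where i: "i \<in> I" "x \<in> S i" by blast
    have "?f x = (\<Sum>j\<in>I. if j = i then w i x else 0)"
      using i disj by (intro sum.cong) (auto simp: indicator_def)
    also have "\<dots> = w i x" using I i by simp
    finally show ?case using v(2)[OF i] by simp
  qed
  have "v \<in> borel_measurable (lebesgue_on \<Omega>)"
    by (rule borel_measurable_lebesgue_on_cong_AE[OF \<Omega> L2_measurable[OF L] ae])
  moreover have "AE x in lebesgue_on \<Omega>. v x = ?f x" using ae by eventually_elim simp
  ultimately show ?thesis using L2_cong_AE[OF _ L] by blast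
qed

lemma L2_matrix_vector_mult:
  fixes B :: "real^2^2"
  assumes "G \<in> L2 M"
  shows "(\<lambda>x. B *v G x) \<in> L2 M"
proof -
  obtain C where C: "\<And>x. norm (B *v x) \<le> norm x * C"
    using bounded_linear.bounded[OF matrix_vector_mul_bounded_linear[of B]] by blast
  have "continuous_on UNIV ((*v) B)" by (intro linear_continuous_on matrix_vector_mul_bounded_linear)
  hence "((*v) B) \<in> borel_measurable borel" by (rule borel_measurable_continuous_onI)
  from measurable_compose[OF L2_measurable[OF assms] this]
  have "(\<lambda>x. B *v G x) \<in> borel_measurable M" .
  thus ?thesis
    using C by (intro L2_bound[OF _ assms, of _ C]) (auto simp: mult.commute)
qed

lemma L2_piecewise_constant_mult:
  fixes B :: "real^2^2 \<Rightarrow> real^2^2"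
  assumes \<Omega>: "open \<Omega>" and part: "subdomain_partition \<Omega> n \<Omega>s"
    and A: "piecewise_constant_spd n \<Omega>s A" and G: "G \<in> L2 (lebesgue_on \<Omega>)"
  shows "(\<lambda>x. B (A x) *v G x) \<in> L2 (lebesgue_on \<Omega>)"
proof -
  obtain M where M: "\<And>i x. i < n \<Longrightarrow> x \<in> \<Omega>s i \<Longrightarrow> A x = M i"
    using A unfolding piecewise_constant_spd_def by metis
  have S: "\<Omega>s i \<in> sets lebesgue" "\<Omega>s i \<subseteq> \<Omega>" if "i < n" for i
    using part that by (auto simp: subdomain_partition_def)
  show ?thesis
  proof (rule L2_piecewise[where I = "{..<n}" and S = \<Omega>s and w = "\<lambda>i x. B (M i) *v G x"])
    show "AE x in lebesgue_on \<Omega>. \<exists>i\<in>{..<n}. x \<in> \<Omega>s i"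
      using AE_subdomain_partition[OF part \<Omega>] by eventually_elim auto
    show "(\<lambda>x. B (M i) *v G x) \<in> L2 (lebesgue_on (\<Omega>s i))" if "i \<in> {..<n}" for i
      by (rule L2_matrix_vector_mult, rule L2_restrict[OF G]) (use that S \<Omega> in auto)
  qed (use S M part \<Omega> in \<open>auto simp: subdomain_partition_def\<close>)
qed

lemma AE_spd:
  assumes "open \<Omega>" "subdomain_partition \<Omega> n \<Omega>s" "piecewise_constant_spd n \<Omega>s A"
  shows "AE x in lebesgue_on \<Omega>. spd (A x)"
  using AE_subdomain_partition[OF assms(2,1)]
  by eventually_elim (use assms(3) in \<open>auto simp: piecewise_constant_spd_def\<close>)

lemma broken_grad_interior:
  assumes "regular_partition \<Omega> T" "K \<in> T" "x \<in> interior K"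
  shows "broken_grad T v x = wgrad (interior K) v x"
proof -
  have "(THE K. K \<in> T \<and> x \<in> interior K) = K"
    using assms by (intro the_equality) (auto simp: regular_partition_def)
  thus ?thesis using assms by (auto simp: broken_grad_def)
qed

lemma broken_grad_L2:
  assumes \<Omega>: "open \<Omega>" "lipschitz_boundary \<Omega>" and T: "regular_partition \<Omega> T" and w: "w \<in> H1_broken \<Omega> T"
  shows "broken_grad T w \<in> L2 (lebesgue_on \<Omega>)"
proof (rule L2_piecewise[where I = T and S = interior and w = "\<lambda>K. wgrad (interior K) w"])
  show "AE x in lebesgue_on \<Omega>. \<exists>K\<in>T. x \<in> interior K" by (rule AE_regular_partition[OF T \<Omega>(1)])
  show "wgrad (interior K) w \<in> L2 (lebesgue_on (interior K))" if "K \<in> T" for K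
    using w that by (intro wgrad_H1) (auto simp: H1_broken_def)
  show "interior K \<subseteq> \<Omega>" if "K \<in> T" for K by (rule element_interior_subset[OF T \<Omega>(2,1) that])
  show "broken_grad T w x = wgrad (interior K) w x" if "K \<in> T" "x \<in> interior K" for K x
    by (rule broken_grad_interior[OF T that])
qed (use \<Omega> T in \<open>auto simp: regular_partition_def\<close>)

text \<open>On each element all three gradients are weak gradients on that element, and the one of \<open>v\<close> is the
  restriction of its global weak gradient. Finitely many exceptional null sets remain null.\<close>

lemma broken_grad_diff:
  assumes \<Omega>: "open \<Omega>" "bounded \<Omega>" "lipschitz_boundary \<Omega>" and T: "regular_partition \<Omega> T"
    and w: "w \<in> H1_broken \<Omega> T" and v: "v \<in> H1 \<Omega>"
  shows "AE x in lebesgue_on \<Omega>. broken_grad T (\<lambda>y. v y - w y) x = wgrad \<Omega> v x - broken_grad T w x"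
proof -
  have fin: "finite T" using T by (simp add: regular_partition_def)
  have each: "AE x in lebesgue_on \<Omega>. x \<in> interior K \<longrightarrow>
      broken_grad T (\<lambda>y. v y - w y) x = wgrad \<Omega> v x - broken_grad T w x" if K: "K \<in> T" for K
  proof -
    have sub: "interior K \<subseteq> \<Omega>" by (rule element_interior_subset[OF T \<Omega>(3,1) K])
    hence b: "bounded (interior K)" using \<Omega> bounded_subset by blast
    note r = wgrad_restrict[OF \<Omega>(1,2) open_interior sub v]
    have wK: "w \<in> H1 (interior K)" using w K by (auto simp: H1_broken_def)
    have "AE x in lebesgue_on (interior K). wgrad (interior K) (\<lambda>y. v y - w y) x =
        wgrad (interior K) v x - wgrad (interior K) w x"
      using wgrad_add_scaled(2)[OF open_interior b r(1) wK, of "-1"] by simp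
    with r(2) have "AE x in lebesgue_on (interior K).
        broken_grad T (\<lambda>y. v y - w y) x = wgrad \<Omega> v x - broken_grad T w x"
    proof (rule AE_mp[OF AE_conjI], intro AE_I2 impI)
      fix x assume "x \<in> space (lebesgue_on (interior K))"
      hence "x \<in> interior K" by simp
      moreover assume "wgrad (interior K) v x = wgrad \<Omega> v x \<and>
        wgrad (interior K) (\<lambda>y. v y - w y) x = wgrad (interior K) v x - wgrad (interior K) w x"
      ultimately show "broken_grad T (\<lambda>y. v y - w y) x = wgrad \<Omega> v x - broken_grad T w x"
        by (simp add: broken_grad_interior[OF T K])
    qed
    hence "AE x in lebesgue. x \<in> interior K \<longrightarrow>
        broken_grad T (\<lambda>y. v y - w y) x = wgrad \<Omega> v x - broken_grad T w x"
      by (simp add: AE_restrict_space_iff)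
    hence "AE x in lebesgue. x \<in> \<Omega> \<longrightarrow> x \<in> interior K \<longrightarrow>
        broken_grad T (\<lambda>y. v y - w y) x = wgrad \<Omega> v x - broken_grad T w x"
      by eventually_elim simp
    thus ?thesis using \<Omega> by (simp add: AE_restrict_space_iff)
  qed
  have "AE x in lebesgue_on \<Omega>. \<forall>K\<in>T. x \<in> interior K \<longrightarrow>
      broken_grad T (\<lambda>y. v y - w y) x = wgrad \<Omega> v x - broken_grad T w x"
    using fin each by (rule AE_finite_allI)
  with AE_regular_partition[OF T \<Omega>(1)] show ?thesis
    by eventually_elim auto
qed

section \<open>Equilibrated fluxes as an orthogonality condition\<close>

lemma has_trace_H1: "has_trace \<Omega> v s \<Longrightarrow> v \<in> H1 \<Omega>"
  by (simp add: has_trace_def)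

lemma test_function_in_H1_vanishing_on:
  assumes "open \<Omega>" "bounded \<Omega>" "\<phi> \<in> test_functions \<Omega>"
  shows "\<phi> \<in> H1_vanishing_on \<Omega> \<Gamma>"
  using test_function_has_trace_0[OF assms] has_trace_H1
  by (fastforce simp: H1_vanishing_on_def has_trace_on_def)

text \<open>Normal traces are tested with functions that vanish off the Neumann part, the weak formulation with
  functions that vanish on the Dirichlet part. The conditions agree: the Dirichlet part lies off the
  Neumann part, as their closures are disjoint, and makes up the rest of the frontier up to a null set.\<close>

lemma H1_vanishing_off_Neumann_part:
  assumes "boundary_decomposition \<Omega> \<Gamma>\<^sub>D \<Gamma>\<^sub>N"
  shows "H1_vanishing_on \<Omega> (frontier \<Omega> - \<Gamma>\<^sub>N) = H1_vanishing_on \<Omega> \<Gamma>\<^sub>D"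
proof -
  let ?B = "boundary_measure \<Omega>"
  have sub: "\<Gamma>\<^sub>D \<subseteq> frontier \<Omega> - \<Gamma>\<^sub>N"
    using assms closure_subset[of \<Gamma>\<^sub>D] closure_subset[of \<Gamma>\<^sub>N]
    by (auto simp: boundary_decomposition_def)
  have "frontier \<Omega> - (\<Gamma>\<^sub>D \<union> \<Gamma>\<^sub>N) \<in> null_sets ?B"
    using assms unfolding boundary_measure_def boundary_decomposition_def
    by (subst null_sets_restrict_space) (auto simp: sets_hausdorff1)
  hence ae: "AE x in ?B. x \<notin> frontier \<Omega> - (\<Gamma>\<^sub>D \<union> \<Gamma>\<^sub>N)" by (rule AE_not_in)
  have "(AE x in ?B. x \<in> frontier \<Omega> - \<Gamma>\<^sub>N \<longrightarrow> s x = 0) \<longleftrightarrow> (AE x in ?B. x \<in> \<Gamma>\<^sub>D \<longrightarrow> s x = 0)"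
    for s :: "real^2 \<Rightarrow> real"
  proof
    assume "AE x in ?B. x \<in> frontier \<Omega> - \<Gamma>\<^sub>N \<longrightarrow> s x = 0"
    thus "AE x in ?B. x \<in> \<Gamma>\<^sub>D \<longrightarrow> s x = 0" by eventually_elim (use sub in blast)
  next
    assume "AE x in ?B. x \<in> \<Gamma>\<^sub>D \<longrightarrow> s x = 0"
    with ae show "AE x in ?B. x \<in> frontier \<Omega> - \<Gamma>\<^sub>N \<longrightarrow> s x = 0" by eventually_elim blast
  qed
  thus ?thesis by (simp add: H1_vanishing_on_def has_trace_on_def)
qed

lemma H_minus_half_zero:
  assumes "open \<Omega>" "bounded \<Omega>" "g \<in> H_minus_half \<Omega> \<Gamma>"
  shows "g (\<lambda>_. 0) = 0"
proof -
  have "(\<lambda>_. 0) \<in> test_functions \<Omega>"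
    by (auto simp: test_functions_def smooth_def Ck_const)
  hence t: "has_trace \<Omega> (\<lambda>_. 0) (\<lambda>_. 0)"
    by (rule test_function_has_trace_0[OF assms(1,2)])
  hence "has_trace_on \<Omega> \<Gamma> (\<lambda>_. 0) (\<lambda>_. 0)"
    unfolding has_trace_on_def by (intro exI[of _ "\<lambda>_. 0"]) simp
  hence z: "(\<lambda>_. 0) \<in> H_half \<Omega> \<Gamma>"
    unfolding H_half_def using has_trace_H1[OF t] by blast
  have "\<forall>s\<in>H_half \<Omega> \<Gamma>. \<forall>t\<in>H_half \<Omega> \<Gamma>. \<forall>c. g (\<lambda>x. s x + c * t x) = g s + c * g t"
    using assms(3) by (simp add: H_minus_half_def)
  from this[rule_format, OF z z, of 1] show ?thesis by simp
qed

text \<open>Subtracting the weak formulation of \<open>u\<close> from Green's formula for \<open>\<tau>\<close> cancels \<open>f\<close> and \<open>g\<close>. Hence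
  an admissible flux is one that differs from \<open>- A \<nabla>u\<close> by a field orthogonal to all gradients of
  functions that vanish on the Dirichlet part. For the converse the divergence is recovered from the
  orthogonality to gradients of test functions, whose boundary term is \<open>g 0 = 0\<close>.\<close>

lemma Sigma_f_iff_orthogonal:
  assumes \<Omega>: "open \<Omega>" "bounded \<Omega>" and \<Gamma>: "boundary_decomposition \<Omega> \<Gamma>\<^sub>D \<Gamma>\<^sub>N"
    and f: "f \<in> L2 (lebesgue_on \<Omega>)" and g: "g \<in> H_minus_half \<Omega> \<Gamma>\<^sub>N"
    and u: "is_weak_solution \<Omega> \<Gamma>\<^sub>D \<Gamma>\<^sub>N A f g u"
    and Au: "(\<lambda>x. A x *v wgrad \<Omega> u x) \<in> L2 (lebesgue_on \<Omega>)"
  shows "\<tau> \<in> Sigma_f \<Omega> \<Gamma>\<^sub>N f g \<longleftrightarrow> \<tau> \<in> L2 (lebesgue_on \<Omega>) \<and>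
    (\<forall>v\<in>H1_vanishing_on \<Omega> \<Gamma>\<^sub>D. L2_inner (lebesgue_on \<Omega>) (\<lambda>x. \<tau> x + A x *v wgrad \<Omega> u x) (wgrad \<Omega> v) = 0)"
    (is "_ \<longleftrightarrow> _ \<and> (\<forall>v\<in>?V. L2_inner ?M ?\<sigma> _ = 0)")
proof -
  note V = H1_vanishing_off_Neumann_part[OF \<Gamma>]
  have H1: "v \<in> H1 \<Omega>" if "v \<in> ?V" for v using that by (simp add: H1_vanishing_on_def)
  have split: "L2_inner ?M ?\<sigma> (wgrad \<Omega> v) =
      L2_inner ?M \<tau> (wgrad \<Omega> v) + L2_inner ?M f v - g t"
    if "\<tau> \<in> L2 ?M" "v \<in> ?V" "has_trace_on \<Omega> \<Gamma>\<^sub>N v t" for v t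
  proof -
    have "L2_inner ?M (\<lambda>x. A x *v wgrad \<Omega> u x) (wgrad \<Omega> v) = L2_inner ?M f v - g t"
      using u that by (auto simp: is_weak_solution_def)
    thus ?thesis using that wgrad_H1(1)[OF H1[OF that(2)]] Au by (simp add: L2_inner_add_left)
  qed
  have div: "L2_inner ?M (wdiv \<Omega> \<tau>) v = L2_inner ?M f v"
    if "wdiv \<Omega> \<tau> \<in> L2 ?M" "AE x in ?M. wdiv \<Omega> \<tau> x = f x" "v \<in> ?V" for v
    using that f H1[OF that(3)] by (intro L2_inner_cong_AE) (auto simp: L2_def H1_def)
  show ?thesis
  proof
    assume \<tau>: "\<tau> \<in> Sigma_f \<Omega> \<Gamma>\<^sub>N f g"
    hence L: "\<tau> \<in> L2 ?M" and ae: "AE x in ?M. wdiv \<Omega> \<tau> x = f x"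
      and nt: "has_normal_trace_on \<Omega> \<Gamma>\<^sub>N \<tau> g"
      by (auto simp: Sigma_f_def Hdiv_def)
    have dL: "wdiv \<Omega> \<tau> \<in> L2 ?M"
      using \<tau> wdiv_eqI(2)[OF \<Omega> L] by (auto simp: Sigma_f_def Hdiv_def)
    have "L2_inner ?M ?\<sigma> (wgrad \<Omega> v) = 0" if v: "v \<in> ?V" for v
    proof -
      obtain s where "has_trace \<Omega> v s" using v by (auto simp: H1_vanishing_on_def has_trace_on_def)
      hence s: "has_trace_on \<Omega> \<Gamma>\<^sub>N v s" by (auto simp: has_trace_on_def)
      have "L2_inner ?M \<tau> (wgrad \<Omega> v) + L2_inner ?M (wdiv \<Omega> \<tau>) v = g s"
        using nt v s unfolding has_normal_trace_on_def V by blast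
      thus ?thesis using split[OF L v s] div[OF dL ae v] by simp
    qed
    with L show "\<tau> \<in> L2 ?M \<and> (\<forall>v\<in>?V. L2_inner ?M ?\<sigma> (wgrad \<Omega> v) = 0)" by blast
  next
    assume "\<tau> \<in> L2 ?M \<and> (\<forall>v\<in>?V. L2_inner ?M ?\<sigma> (wgrad \<Omega> v) = 0)"
    hence L: "\<tau> \<in> L2 ?M" and orth: "\<And>v. v \<in> ?V \<Longrightarrow> L2_inner ?M ?\<sigma> (wgrad \<Omega> v) = 0" by auto
    have wd: "is_weak_div \<Omega> \<tau> f"
      unfolding is_weak_div_def
    proof
      fix \<phi> assume \<phi>: "\<phi> \<in> test_functions \<Omega>"
      note sm = test_function_smooth[OF \<phi>]
      have \<phi>V: "\<phi> \<in> ?V" by (rule test_function_in_H1_vanishing_on[OF \<Omega> \<phi>])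
      have tr: "has_trace_on \<Omega> \<Gamma>\<^sub>N \<phi> (\<lambda>_. 0)"
        using test_function_has_trace_0[OF \<Omega> \<phi>] by (auto simp: has_trace_on_def)
      have "L2_inner ?M \<tau> (wgrad \<Omega> \<phi>) = - L2_inner ?M f \<phi>"
        using split[OF L \<phi>V tr] orth[OF \<phi>V] H_minus_half_zero[OF \<Omega> g] by simp
      moreover have "L2_inner ?M \<tau> (wgrad \<Omega> \<phi>) = L2_inner ?M \<tau> (grad \<phi>)"
      proof (rule L2_inner_cong_AE)
        show "grad \<phi> \<in> borel_measurable ?M" using smooth_L2(2)[OF sm _ \<Omega>(2)] \<Omega> by (auto simp: L2_def)
      qed (use L wgrad_H1(1)[OF H1[OF \<phi>V]] wgrad_smooth(2)[OF \<Omega> sm] in \<open>auto simp: L2_def\<close>)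
      ultimately show "(LINT x|?M. \<tau> x \<bullet> grad \<phi> x) = - (LINT x|?M. \<phi> x * f x)"
        by (simp add: L2_inner_def mult.commute)
    qed
    note d = wdiv_eqI[OF \<Omega> L f wd]
    have "has_normal_trace_on \<Omega> \<Gamma>\<^sub>N \<tau> g"
      unfolding has_normal_trace_on_def V
    proof (intro ballI allI impI)
      fix v t assume v: "v \<in> ?V" and t: "has_trace_on \<Omega> \<Gamma>\<^sub>N v t"
      show "L2_inner ?M \<tau> (wgrad \<Omega> v) + L2_inner ?M (wdiv \<Omega> \<tau>) v = g t"
        using split[OF L v t] orth[OF v] div[OF d(2,3) v] by simp
    qed
    with d show "\<tau> \<in> Sigma_f \<Omega> \<Gamma>\<^sub>N f g" by (simp add: Sigma_f_def)
  qed
qed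

section \<open>The error identity\<close>

theorem lemma3p4:
  fixes \<Omega> \<Gamma>\<^sub>D \<Gamma>\<^sub>N :: "(real^2) set"
    and n :: nat and \<Omega>s :: "nat \<Rightarrow> (real^2) set"
    and A :: "real^2 \<Rightarrow> real^2^2"
    and T :: "(real^2) set set"
    and f u :: "real^2 \<Rightarrow> real"
    and g :: "(real^2 \<Rightarrow> real) \<Rightarrow> real"
  assumes "polygonal_lipschitz_domain \<Omega>"
    and "boundary_decomposition \<Omega> \<Gamma>\<^sub>D \<Gamma>\<^sub>N"
    and "subdomain_partition \<Omega> n \<Omega>s"
    and "piecewise_constant_spd n \<Omega>s A"
    and "regular_partition \<Omega> T"
    and "interfaces_respected n \<Omega>s T"
    and "f \<in> L2 (lebesgue_on \<Omega>)"
    and "g \<in> H_minus_half \<Omega> \<Gamma>\<^sub>N"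
    and "is_weak_solution \<Omega> \<Gamma>\<^sub>D \<Gamma>\<^sub>N A f g u"
  shows "\<forall>w\<in>H1_broken \<Omega> T.
    (L2_norm (lebesgue_on \<Omega>)
       (\<lambda>x. mat_sqrt (A x) *v broken_grad T (\<lambda>y. u y - w y) x))\<^sup>2 =
    (INF \<tau>\<in>Sigma_f \<Omega> \<Gamma>\<^sub>N f g.
       (L2_norm (lebesgue_on \<Omega>)
          (\<lambda>x. matrix_inv (mat_sqrt (A x)) *v \<tau> x + mat_sqrt (A x) *v broken_grad T w x))\<^sup>2) +
    (INF v\<in>H1_vanishing_on \<Omega> \<Gamma>\<^sub>D.
       (L2_norm (lebesgue_on \<Omega>)
          (\<lambda>x. mat_sqrt (A x) *v broken_grad T (\<lambda>y. v y - w y) x))\<^sup>2)"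
proof
  fix w assume w: "w \<in> H1_broken \<Omega> T"
  let ?M = "lebesgue_on \<Omega>" and ?V = "H1_vanishing_on \<Omega> \<Gamma>\<^sub>D" and ?\<Sigma> = "Sigma_f \<Omega> \<Gamma>\<^sub>N f g"
  let ?S = "\<lambda>x. mat_sqrt (A x)" and ?R = "\<lambda>x. matrix_inv (mat_sqrt (A x))"
  let ?G = "broken_grad T w"
  have \<Omega>: "open \<Omega>" "bounded \<Omega>" and lip: "lipschitz_boundary \<Omega>"
    using assms(1) by (auto simp: polygonal_lipschitz_domain_def)
  have m: "\<Omega> \<in> sets lebesgue" using \<Omega> by auto
  note fin = finite_measure_lebesgue_on_bounded[OF m \<Omega>(2)]
  have mult: "(\<lambda>x. B (A x) *v G x) \<in> L2 ?M" if "G \<in> L2 ?M"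
    for B :: "real^2^2 \<Rightarrow> real^2^2" and G
    using L2_piecewise_constant_mult[OF \<Omega>(1) assms(3,4) that] .
  note multS = mult[where B = mat_sqrt] and multR = mult[where B = "\<lambda>M. matrix_inv (mat_sqrt M)"]
    and multA = mult[where B = "\<lambda>M. M"]
  note spd = AE_spd[OF \<Omega>(1) assms(3,4)]
  have uV: "u \<in> ?V" using assms(9) by (simp add: is_weak_solution_def)
  have H1: "v \<in> H1 \<Omega>" if "v \<in> ?V" for v using that by (simp add: H1_vanishing_on_def)
  have gradL: "wgrad \<Omega> v \<in> L2 ?M" if "v \<in> ?V" for v using H1[OF that] by (rule wgrad_H1)
  have GL: "?G \<in> L2 ?M" by (rule broken_grad_L2[OF \<Omega>(1) lip assms(5) w])
  note \<Sigma> = Sigma_f_iff_orthogonal[OF \<Omega> assms(2,7,8,9) multA[OF gradL[OF uV]]]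
  have lin: "(\<lambda>x. v x + c * v' x) \<in> ?V" if "v \<in> ?V" "v' \<in> ?V" for v v' c
    using H1_vanishing_on_add_scaled[OF \<Omega> that] .
  have lin_grad: "AE x in ?M. wgrad \<Omega> (\<lambda>x. v x + c * v' x) x = wgrad \<Omega> v x + c *\<^sub>R wgrad \<Omega> v' x"
    if "v \<in> ?V" "v' \<in> ?V" for v v' c
    using wgrad_add_scaled(2)[OF \<Omega> H1[OF that(1)] H1[OF that(2)]] .
  \<comment> \<open>membership up to null sets, since \<open>wgrad\<close> is linear only almost everywhere\<close>
  define W where "W = {q \<in> L2 ?M. \<exists>v\<in>?V. AE x in ?M. q x = ?S x *v wgrad \<Omega> v x}"
  define E where "E x = ?S x *v wgrad \<Omega> u x - ?S x *v ?G x" for x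
  have SW: "(\<lambda>x. ?S x *v wgrad \<Omega> v x) \<in> W" if "v \<in> ?V" for v
    unfolding W_def using that multS[OF gradL[OF that]] by auto
  have EL: "E \<in> L2 ?M"
    unfolding E_def by (intro L2_diff multS gradL uV GL)
  have W_lin: "(\<lambda>x. p x + c *\<^sub>R q x) \<in> W" if "p \<in> W" "q \<in> W" for p q c
  proof -
    obtain v v' where v: "v \<in> ?V" "AE x in ?M. p x = ?S x *v wgrad \<Omega> v x"
      and v': "v' \<in> ?V" "AE x in ?M. q x = ?S x *v wgrad \<Omega> v' x"
      using \<open>p \<in> W\<close> \<open>q \<in> W\<close> by (auto simp: W_def)
    have "AE x in ?M. p x + c *\<^sub>R q x = ?S x *v wgrad \<Omega> (\<lambda>x. v x + c * v' x) x"
      using v(2) v'(2) lin_grad[OF v(1) v'(1), of c]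
      by eventually_elim (simp add: matrix_vector_right_distrib matrix_vector_mult_scaleR)
    moreover have "(\<lambda>x. p x + c *\<^sub>R q x) \<in> L2 ?M"
      using that by (intro L2_add_scaleR) (auto simp: W_def)
    ultimately show ?thesis using lin[OF v(1) v'(1), of c] by (auto simp: W_def)
  qed
  have adj: "L2_inner ?M p (\<lambda>x. ?S x *v z x) = L2_inner ?M (\<lambda>x. ?S x *v p x) z"
    if "p \<in> L2 ?M" "z \<in> L2 ?M" for p z
    unfolding L2_inner_def
  proof (rule integral_cong_AE)
    show "(\<lambda>x. p x \<bullet> (?S x *v z x)) \<in> borel_measurable ?M" "(\<lambda>x. (?S x *v p x) \<bullet> z x) \<in> borel_measurable ?M"
      using L2_integrable_inner[OF that(1) multS[OF that(2)]] L2_integrable_inner[OF multS[OF that(1)] that(2)]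
      by auto
    show "AE x in ?M. p x \<bullet> (?S x *v z x) = (?S x *v p x) \<bullet> z x"
      using spd by eventually_elim (simp add: spd_self_adjoint mat_sqrt_spd)
  qed
  have W_orth: "(\<forall>q\<in>W. L2_inner ?M p q = 0) \<longleftrightarrow>
      (\<forall>v\<in>?V. L2_inner ?M (\<lambda>x. ?S x *v p x) (wgrad \<Omega> v) = 0)" if p: "p \<in> L2 ?M" for p
  proof
    assume orth: "\<forall>q\<in>W. L2_inner ?M p q = 0"
    show "\<forall>v\<in>?V. L2_inner ?M (\<lambda>x. ?S x *v p x) (wgrad \<Omega> v) = 0"
    proof
      fix v assume v: "v \<in> ?V"
      from bspec[OF orth SW[OF v]] show "L2_inner ?M (\<lambda>x. ?S x *v p x) (wgrad \<Omega> v) = 0"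
        by (simp only: adj[OF p gradL[OF v]])
    qed
  next
    assume orth: "\<forall>v\<in>?V. L2_inner ?M (\<lambda>x. ?S x *v p x) (wgrad \<Omega> v) = 0"
    show "\<forall>q\<in>W. L2_inner ?M p q = 0"
    proof
      fix q assume "q \<in> W"
      then obtain v where v: "v \<in> ?V" and q: "q \<in> L2 ?M" "AE x in ?M. q x = ?S x *v wgrad \<Omega> v x"
        by (auto simp: W_def)
      have "L2_inner ?M p q = L2_inner ?M p (\<lambda>x. ?S x *v wgrad \<Omega> v x)"
        using p q multS[OF gradL[OF v]] by (intro L2_inner_cong_AE) (auto simp: L2_def)
      thus "L2_inner ?M p q = 0" using adj[OF p gradL[OF v]] orth v by simp
    qed
  qed
  have norm_V: "L2_norm ?M (\<lambda>x. ?S x *v broken_grad T (\<lambda>y. v y - w y) x) =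
      L2_norm ?M (\<lambda>x. E x - q x)"
    if v: "v \<in> ?V" and q: "q \<in> L2 ?M" "AE x in ?M. q x = ?S x *v (wgrad \<Omega> u x - wgrad \<Omega> v x)" for v q
  proof -
    have ae: "AE x in ?M. E x - q x = ?S x *v broken_grad T (\<lambda>y. v y - w y) x"
      using q(2) broken_grad_diff[OF \<Omega> lip assms(5) w H1[OF v]]
      by eventually_elim (simp add: E_def matrix_vector_mult_diff_distrib)
    have L: "(\<lambda>x. E x - q x) \<in> L2 ?M" by (rule L2_diff[OF EL q(1)])
    have "(\<lambda>x. ?S x *v broken_grad T (\<lambda>y. v y - w y) x) \<in> borel_measurable ?M"
      by (rule borel_measurable_lebesgue_on_cong_AE[OF m L2_measurable[OF L] ae])
    from L2_norm_cong_AE[OF L2_measurable[OF L] this ae] show ?thesis by simp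
  qed
  have norm_\<Sigma>: "L2_norm ?M (\<lambda>x. ?R x *v \<tau> x + ?S x *v ?G x) = L2_norm ?M (\<lambda>x. E x - p x)"
    if \<tau>: "\<tau> \<in> L2 ?M" and p: "p \<in> L2 ?M" "AE x in ?M. p x = ?R x *v \<tau> x + ?S x *v wgrad \<Omega> u x" for \<tau> p
  proof -
    have "L2_norm ?M (\<lambda>x. ?R x *v \<tau> x + ?S x *v ?G x) = L2_norm ?M (\<lambda>x. p x - E x)"
    proof (rule L2_norm_cong_AE)
      show "AE x in ?M. ?R x *v \<tau> x + ?S x *v ?G x = p x - E x"
        using p(2) by eventually_elim (simp add: E_def)
    qed (intro L2_measurable L2_add L2_diff multS multR GL \<tau> p EL)+
    also have "\<dots> = L2_norm ?M (\<lambda>x. E x - p x)"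
      by (simp add: L2_norm_def norm_minus_commute)
    finally show ?thesis .
  qed
  \<comment> \<open>\<open>\<tau> = A\<^bsup>1/2\<^esup> p - A \<nabla>u\<close> identifies admissible fluxes with the orthogonal complement of \<open>W\<close>\<close>
  have \<Sigma>_image: "(\<lambda>\<tau>. (L2_norm ?M (\<lambda>x. ?R x *v \<tau> x + ?S x *v ?G x))\<^sup>2) ` ?\<Sigma> =
      (\<lambda>p. (L2_norm ?M (\<lambda>x. E x - p x))\<^sup>2) ` {p\<in>L2 ?M. \<forall>q\<in>W. L2_inner ?M p q = 0}" (is "?l ` _ = ?r ` ?P")
  proof (intro equalityI subsetI)
    fix y assume "y \<in> ?l ` ?\<Sigma>"
    then obtain \<tau> where \<tau>: "\<tau> \<in> ?\<Sigma>" and y: "y = ?l \<tau>" by blast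
    have L: "\<tau> \<in> L2 ?M" using \<tau> by (simp add: \<Sigma>)
    let ?p = "\<lambda>x. ?R x *v \<tau> x + ?S x *v wgrad \<Omega> u x"
    have pL: "?p \<in> L2 ?M" by (intro L2_add multR multS L gradL uV)
    have eq: "L2_inner ?M (\<lambda>x. ?S x *v ?p x) (wgrad \<Omega> v) =
        L2_inner ?M (\<lambda>x. \<tau> x + A x *v wgrad \<Omega> u x) (wgrad \<Omega> v)" if v: "v \<in> ?V" for v
    proof (rule L2_inner_cong_AE)
      show "AE x in ?M. ?S x *v ?p x = \<tau> x + A x *v wgrad \<Omega> u x"
        using spd by eventually_elim (simp add: matrix_vector_right_distrib mat_sqrt_apply)
    qed (intro L2_measurable L2_add multS multA pL L gradL uV v AE_I2 refl)+
    have "?p \<in> ?P" using \<tau> pL by (simp add: W_orth \<Sigma> eq)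
    moreover have "y = ?r ?p" unfolding y using norm_\<Sigma>[OF L pL] by simp
    ultimately show "y \<in> ?r ` ?P" by - (rule rev_image_eqI)
  next
    fix y assume "y \<in> ?r ` ?P"
    then obtain p where p: "p \<in> ?P" and y: "y = ?r p" by blast
    have pL: "p \<in> L2 ?M" using p by simp
    let ?\<tau> = "\<lambda>x. ?S x *v p x - A x *v wgrad \<Omega> u x"
    have L: "?\<tau> \<in> L2 ?M" by (intro L2_diff multS multA pL gradL uV)
    have "?\<tau> \<in> ?\<Sigma>" unfolding \<Sigma> using p L W_orth[OF pL] by simp
    moreover have "y = ?l ?\<tau>"
    proof -
      have "AE x in ?M. p x = ?R x *v ?\<tau> x + ?S x *v wgrad \<Omega> u x"
        using spd
      proof eventually_elim
        case (elim x)
        have "?R x *v (A x *v wgrad \<Omega> u x) = ?S x *v wgrad \<Omega> u x"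
          by (subst mat_sqrt_apply(1)[OF elim, symmetric]) (rule mat_sqrt_apply(3)[OF elim])
        thus ?case by (simp add: matrix_vector_mult_diff_distrib mat_sqrt_apply(3)[OF elim])
      qed
      from norm_\<Sigma>[OF L pL this] show ?thesis unfolding y by simp
    qed
    ultimately show "y \<in> ?l ` ?\<Sigma>" by - (rule rev_image_eqI)
  qed
  have diffL: "(\<lambda>x. ?S x *v (wgrad \<Omega> u x - wgrad \<Omega> v x)) \<in> L2 ?M" if "v \<in> ?V" for v
    by (intro multS L2_diff gradL uV that)
  \<comment> \<open>\<open>v\<close> corresponds to \<open>A\<^bsup>1/2\<^esup> \<nabla>(u - v)\<close>; this reaches all of \<open>W\<close> because \<open>u\<close> satisfies the Dirichlet condition\<close>
  have V_image: "(\<lambda>v. (L2_norm ?M (\<lambda>x. ?S x *v broken_grad T (\<lambda>y. v y - w y) x))\<^sup>2) ` ?V =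
      (\<lambda>q. (L2_norm ?M (\<lambda>x. E x - q x))\<^sup>2) ` W" (is "?l ` _ = ?r ` _")
  proof (intro equalityI subsetI)
    fix y assume "y \<in> ?l ` ?V"
    then obtain v where v: "v \<in> ?V" and y: "y = ?l v" by blast
    let ?q = "\<lambda>x. ?S x *v (wgrad \<Omega> u x - wgrad \<Omega> v x)"
    have "AE x in ?M. ?q x = ?S x *v wgrad \<Omega> (\<lambda>x. u x + (-1) * v x) x"
      using lin_grad[OF uV v, of "-1"] by eventually_elim simp
    hence "?q \<in> W" unfolding W_def using diffL[OF v] lin[OF uV v, of "-1"] by blast
    moreover have "y = ?r ?q" unfolding y using norm_V[OF v diffL[OF v]] by simp
    ultimately show "y \<in> ?r ` W" by - (rule rev_image_eqI)
  next
    fix y assume "y \<in> ?r ` W"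
    then obtain q v' where q: "q \<in> L2 ?M" "AE x in ?M. q x = ?S x *v wgrad \<Omega> v' x"
      and v': "v' \<in> ?V" and y: "y = ?r q" by (auto simp: W_def)
    let ?v = "\<lambda>x. u x + (-1) * v' x"
    have v: "?v \<in> ?V" by (rule lin[OF uV v'])
    have "AE x in ?M. q x = ?S x *v (wgrad \<Omega> u x - wgrad \<Omega> ?v x)"
      using q(2) lin_grad[OF uV v', of "-1"] by eventually_elim simp
    hence "y = ?l ?v" unfolding y using norm_V[OF v q(1)] by simp
    with v show "y \<in> ?l ` ?V" by - (rule rev_image_eqI)
  qed
  have lhs: "L2_norm ?M (\<lambda>x. ?S x *v broken_grad T (\<lambda>y. u y - w y) x) = L2_norm ?M E"
    using norm_V[OF uV L2_zero] by simp
  have "W \<subseteq> L2 ?M" "W \<noteq> {}" using SW[OF uV] by (auto simp: W_def)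
  from L2_orthogonal_split_INF[OF fin this W_lin EL]
  show "(L2_norm ?M (\<lambda>x. ?S x *v broken_grad T (\<lambda>y. u y - w y) x))\<^sup>2 =
    (INF \<tau>\<in>?\<Sigma>. (L2_norm ?M (\<lambda>x. ?R x *v \<tau> x + ?S x *v broken_grad T w x))\<^sup>2) +
    (INF v\<in>?V. (L2_norm ?M (\<lambda>x. ?S x *v broken_grad T (\<lambda>y. v y - w y) x))\<^sup>2)"
    unfolding lhs \<Sigma>_image V_image .
qed

end
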